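(* Let $W\in C^1((-\infty,1],\mathbb{R})$ satisfy $W(0)=0$, $W(t)>0$ for all $t\in(-\infty,1]\setminus\{0\}$, and $W$ strictly convex. Let $n>m\ge7$ and $B^m$ the unit ball of $\mathbb{R}^m$. For $\varepsilon>0$ let $h_\varepsilon$ be the increasing positive solution of $$-h''-\tfrac{m-1}{r}h'+\tfrac{m-1}{r^2}h=\tfrac{h}{\varepsilon^2}W'(1-h^2)\ \text{ for } r\in(0,1),\qquad h(0)=0,\ h(1)=1,$$ and set $u_\varepsilon(x)=(h_\varepsilon(|x|)\frac{x}{|x|},0_{\mathbb{R}^{n-m}})$ for $x\in B^m$. Then for every $\varepsilon>0$, $u_\varepsilon$ is the unique minimiser of $E_\varepsilon(u)=\int_{B^m}[\frac12|\nabla u|^2+\frac1{2\varepsilon^2}W(1-|u|^2)]dx$ over $\{u\in H^1(B^m;\mathbb{R}^n): u=u_{bd}\text{ on }\partial B^m\}$, where $u_{bd}(x)=(x,0_{\mathbb{R}^{n-m}})$ for $x\in\partial B^m$.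
   Context: Boundary values are in the sense of $H^{1/2}$ traces. *)

theory Defs
  imports "HOL-Analysis.Analysis"
begin

definition strictly_convex_on :: "real set \<Rightarrow> (real \<Rightarrow> real) \<Rightarrow> bool" where
  "strictly_convex_on S f \<longleftrightarrow>
     (\<forall>x\<in>S. \<forall>y\<in>S. \<forall>t. x \<noteq> y \<and> 0 < t \<and> t < 1 \<longrightarrow>
        f (t * x + (1 - t) * y) < t * f x + (1 - t) * f y)"

definition smooth_on :: "'a::euclidean_space set \<Rightarrow> ('a \<Rightarrow> 'b::real_normed_vector) \<Rightarrow> bool" where
  "smooth_on U f \<longleftrightarrow>
     (\<exists>F. f \<in> F \<and> (\<forall>g\<in>F. g differentiable_on U \<and>
        (\<forall>i\<in>Basis. (\<lambda>x. frechet_derivative g (at x) i) \<in> F)))"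

definition test_fun :: "'a::euclidean_space set \<Rightarrow> ('a \<Rightarrow> 'b::real_normed_vector) \<Rightarrow> bool" where
  "test_fun U \<phi> \<longleftrightarrow> smooth_on U \<phi> \<and> compact (closure {x. \<phi> x \<noteq> 0})
      \<and> closure {x. \<phi> x \<noteq> 0} \<subseteq> U"

definition L2_on :: "'a::euclidean_space set \<Rightarrow> ('a \<Rightarrow> 'b::euclidean_space) \<Rightarrow> bool" where
  "L2_on U u \<longleftrightarrow> u \<in> borel_measurable (lebesgue_on U)
      \<and> (\<integral>\<^sup>+ x. ennreal ((norm (u x))\<^sup>2) \<partial>lebesgue_on U) < \<infinity>"

definition H1_weak_grad :: "'a::euclidean_space set \<Rightarrow> ('a \<Rightarrow> 'b::euclidean_space)
     \<Rightarrow> ('a \<Rightarrow> 'a \<Rightarrow> 'b) \<Rightarrow> bool" where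
  "H1_weak_grad U u Du \<longleftrightarrow> L2_on U u \<and> (\<forall>i\<in>Basis. L2_on U (\<lambda>x. Du x i))
     \<and> (\<forall>\<phi>::'a \<Rightarrow> real. test_fun U \<phi> \<longrightarrow> (\<forall>i\<in>Basis.
          (\<integral>x. \<phi> x *\<^sub>R Du x i \<partial>lebesgue_on U)
            = - (\<integral>x. frechet_derivative \<phi> (at x) i *\<^sub>R u x \<partial>lebesgue_on U)))"

definition H10 :: "'a::euclidean_space set \<Rightarrow> ('a \<Rightarrow> 'b::euclidean_space)
     \<Rightarrow> ('a \<Rightarrow> 'a \<Rightarrow> 'b) \<Rightarrow> bool" where
  "H10 U v Dv \<longleftrightarrow> H1_weak_grad U v Dv \<and>
     (\<exists>\<phi>::nat \<Rightarrow> 'a \<Rightarrow> 'b. (\<forall>k. test_fun U (\<phi> k)) \<and>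
        ((\<lambda>k. \<integral>\<^sup>+ x. ennreal ((norm (\<phi> k x - v x))\<^sup>2
              + (\<Sum>i\<in>Basis. (norm (frechet_derivative (\<phi> k) (at x) i - Dv x i))\<^sup>2))
            \<partial>lebesgue_on U) \<longlonglongrightarrow> 0))"

text \<open>Boundary values in the trace sense: u = g on the boundary of U iff u - g is in H^1_0(U),
  where g is an H^1 extension of the boundary datum.\<close>
definition trace_eq :: "'a::euclidean_space set \<Rightarrow> ('a \<Rightarrow> 'b::euclidean_space) \<Rightarrow> ('a \<Rightarrow> 'a \<Rightarrow> 'b)
     \<Rightarrow> ('a \<Rightarrow> 'b) \<Rightarrow> ('a \<Rightarrow> 'a \<Rightarrow> 'b) \<Rightarrow> bool" where
  "trace_eq U u Du g Dg \<longleftrightarrow> H10 U (\<lambda>x. u x - g x) (\<lambda>x i. Du x i - Dg x i)"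

definition GL_energy :: "(real \<Rightarrow> real) \<Rightarrow> real \<Rightarrow> 'a::euclidean_space set
     \<Rightarrow> ('a \<Rightarrow> 'b::euclidean_space) \<Rightarrow> ('a \<Rightarrow> 'a \<Rightarrow> 'b) \<Rightarrow> ennreal" where
  "GL_energy W \<epsilon> U u Du = (\<integral>\<^sup>+ x. ennreal (1/2 * (\<Sum>i\<in>Basis. (norm (Du x i))\<^sup>2)
        + 1 / (2 * \<epsilon>\<^sup>2) * W (1 - (norm (u x))\<^sup>2)) \<partial>lebesgue_on U)"

end

theory Submission
  imports Defs
begin

text \<open>
  Write \<open>u = u_eps + v\<close> with \<open>v\<close> in \<open>H10\<close> and \<open>V = W'(1 - h^2) / eps^2\<close>, which is nonnegative
  and bounded on the unit ball. Convexity of \<open>W\<close> bounds the energy excess of \<open>u\<close> from below by the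
  first variation of the energy at \<open>u_eps\<close>, which vanishes, plus half of the integral of
  \<open>|Dv|^2 - V |v|^2\<close>. With \<open>a = (m - 2)/2\<close> the function \<open>w = h(r) r^(-a)\<close> satisfies
  \<open>- Laplace w - V w \<ge> (a^2 - (m - 1)) w / r^2\<close>, since \<open>h\<close> is increasing, and
  \<open>a^2 - (m - 1) \<ge> 1/4\<close> because \<open>m \<ge> 7\<close>. Integrating \<open>|Dv - v Dw / w|^2 \<ge> 0\<close> shows that the
  quadratic form dominates a quarter of the integral of \<open>|v|^2\<close>. The singularities at the origin are
  harmless, as \<open>0 \<le> h' \<le> h / r\<close>, and \<open>1 / r^2\<close> is integrable.
\<close>

section \<open>Integration by parts with a singularity at the origin\<close>

text \<open>The identities are proved for smooth compactly supported \<phi>, where they all follow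
  from one fact: a partial derivative of a field that vanishes near the unit sphere integrates to 0,
  even if the field is singular at the origin, as long as the derivative is of size C / |x|^2. No
  small ball is cut out: Fubini along lines parallel to an axis suffices, since almost every such
  line misses the origin. Elements of H^1_0 are then reached by density. The sign of V comes from
  the tangent to W at s > 0, compared with W at its zero 0. That sign in turn gives
  \<open>h' \<le> h / r\<close>, because r^(m+1) (h/r)' is decreasing. A separate obstacle is the
  trace of the radial map. By definition, u_eps(x) - (x, 0) must be an H^1 limit of smooth maps with
  compact support in the ball, while h is only known to be twice differentiable. Instead of
  mollifying, the derivative of the profile with respect to t = |x|^2 is approximated by
  polynomials, multiplied by an explicit smooth cutoff and integrated back from t = 1. Using |x|^2
  rather than |x| keeps the result smooth at the origin.\<close>

lemma integrable_ball_inverse_square: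
  assumes dim: "DIM('a::euclidean_space) \<ge> 3"
  shows "integrable lborel (\<lambda>x::'a. indicator (ball 0 1) x / (norm x)\<^sup>2)"
proof -
  let ?N = "DIM('a)"
  define c where "c = unit_ball_vol (real DIM('a))"
  have c0: "c \<ge> 0" by (simp add: c_def)
  have em: "emeasure lborel (cball (0::'a) (1/2^k)) = ennreal (c * (1/2^k) ^ ?N)" for k::nat
    by (subst emeasure_cball) (auto simp: c_def)
  \<comment> \<open>Dyadic decomposition: for 1/2^(k+1) < |x| <= 1/2^k the quotient is at most
    4^(k+1), and replacing the shell by the whole ball of radius 1/2^k only enlarges the sum. At the
    origin the quotient is 0 by the convention on division by zero.\<close>
  have le: "ennreal (indicator (ball 0 1) x / (norm x)\<^sup>2)
      \<le> (\<Sum>k. ennreal (4^(k+1)) * indicator (cball 0 (1/2^k)) x)" for x :: 'a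
  proof (cases "x \<in> ball 0 1 \<and> x \<noteq> 0")
    case True
    then have x: "norm x < 1" "norm x > 0" by auto
    have "\<exists>k::nat. norm x > 1/2^(k+1)"
    proof -
      obtain n where n: "(1/2) ^ n < norm x" using real_arch_pow_inv[of "norm x" "1/2"] x by auto
      have "(1/2::real) ^ (n+1) \<le> (1/2) ^ n" by (intro power_decreasing) auto
      then show ?thesis using n by (intro exI[of _ n]) (simp only: power_one_over)
    qed
    then obtain k where k: "norm x > 1/2^(k+1)" "\<And>j. j < k \<Longrightarrow> \<not> norm x > 1/2^(j+1)"
      using exists_least_iff[of "\<lambda>k. norm x > 1/2^(k+1)"] by blast
    have "norm x \<le> 1/2^k"
      using k(2)[of "k-1"] x by (cases k) auto
    then have xk: "x \<in> cball 0 (1/2^k)" by simp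
    have "(1/2^(k+1))\<^sup>2 \<le> (norm x)\<^sup>2" using k(1) by (intro power_mono) auto
    then have "1 / (norm x)\<^sup>2 \<le> 1 / (1/2^(k+1))\<^sup>2"
      by (intro divide_left_mono) (use x in auto)
    also have "\<dots> = 4^(k+1)"
      by (simp add: power_divide power2_eq_square power_mult_distrib[symmetric])
    finally have "ennreal (indicator (ball 0 1) x / (norm x)\<^sup>2) \<le> ennreal (4^(k+1)) * indicator (cball 0 (1/2^k)) x"
      using xk True by (simp add: ennreal_leI)
    also have "\<dots> \<le> (\<Sum>j. ennreal (4^(j+1)) * indicator (cball 0 (1/2^j)) x)"
    proof -
      define F where "F j = ennreal (4^(j+1)) * indicator (cball 0 (1/2^j)) x" for j
      have "F k = sum F {k}" by simp
      also have "\<dots> \<le> suminf F" by (rule sum_le_suminf) auto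
      finally show ?thesis unfolding F_def[abs_def] .
    qed
    finally show ?thesis .
  qed auto
  have "(\<integral>\<^sup>+x. ennreal (norm (indicator (ball 0 1) x / (norm x)\<^sup>2)) \<partial>(lborel::'a measure))
      \<le> (\<integral>\<^sup>+x. (\<Sum>k. ennreal (4^(k+1)) * indicator (cball 0 (1/2^k)) x) \<partial>(lborel::'a measure))"
    by (intro nn_integral_mono) (use le in \<open>simp del: power_Suc\<close>)
  also have "\<dots> = (\<Sum>k. ennreal (4^(k+1)) * ennreal (c * (1/2^k) ^ ?N))"
  proof (subst nn_integral_suminf)
    show "(\<lambda>x::'a. ennreal (4^(k+1)) * indicator (cball 0 (1/2^k)) x) \<in> borel_measurable lborel" for k
      by (intro borel_measurable_times_ennreal borel_measurable_indicator) auto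
    show "(\<Sum>k. \<integral>\<^sup>+x. ennreal (4^(k+1)) * indicator (cball 0 (1/2^k)) (x::'a) \<partial>lborel)
        = (\<Sum>k. ennreal (4^(k+1)) * ennreal (c * (1/2^k) ^ ?N))"
      by (subst nn_integral_cmult_indicator) (auto simp only: em sets_lborel borel_closed closed_cball)
  qed
  also have "\<dots> \<le> (\<Sum>k. ennreal (4 * c * (1/2)^k))"
  proof (intro suminf_le)
    fix k :: nat
    \<comment> \<open>Dimension at least 3 makes the k-th term at most 4 c (4/8)^k, a geometric
      series with ratio 1/2.\<close>
    have "(1/2^k) ^ ?N \<le> (1/2^k::real) ^ 3" by (intro power_decreasing) (use dim in auto)
    then have "4^(k+1) * (c * (1/2^k) ^ ?N) \<le> 4^(k+1) * (c * (1/2^k) ^ 3)"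
      using c0 by (intro mult_left_mono) auto
    also have "\<dots> = 4 * c * (4^k * ((1/2)^k)^3)" by (simp add: power_one_over)
    also have "(4::real)^k * ((1/2)^k)^3 = (4 * (1/2)^3)^k"
      by (simp only: power_mult_distrib) (simp add: power_mult[symmetric] mult.commute)
    finally have "4^(k+1) * (c * (1/2^k) ^ ?N) \<le> 4 * c * (1/2)^k" by (simp add: power3_eq_cube)
    then show "ennreal (4^(k+1)) * ennreal (c * (1/2^k) ^ ?N) \<le> ennreal (4 * c * (1/2)^k)"
      using c0 by (simp add: ennreal_mult[symmetric] ennreal_leI)
  qed auto
  also have "\<dots> < \<infinity>"
  proof -
    have "summable (\<lambda>k. 4 * c * (1/2)^k)" by (intro summable_mult summable_geometric) auto
    then show ?thesis using c0 by (subst suminf_ennreal2) auto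
  qed
  finally show ?thesis
    by (intro integrableI_bounded borel_measurable_divide borel_measurable_indicator
        borel_measurable_power borel_measurable_norm) auto
qed

text \<open>Fubini with the coordinate along \<open>i\<close> innermost. A line parallel to
  \<open>i\<close> meets the origin only if all other coordinates vanish, and such lines form a null
  set because there is at least one other coordinate. On every remaining line the fundamental
  theorem of calculus applies, and \<open>g\<close> vanishes at both ends.\<close>

lemma integral_partial_eq_0:
  fixes g gi :: "'a::euclidean_space \<Rightarrow> 'b::euclidean_space"
  assumes i: "i \<in> Basis" and dim: "DIM('a) \<ge> 2"
    and int: "integrable lborel gi"
    and der: "\<And>x. x \<noteq> 0 \<Longrightarrow> ((\<lambda>t. g (x + t *\<^sub>R i)) has_vector_derivative gi x) (at 0)"
    and zero: "\<And>x. norm x \<ge> 1 \<Longrightarrow> g x = 0"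
  shows "(\<integral>x. gi x \<partial>lborel) = 0"
proof -
  define I where "I = Basis - {i}"
  have I: "Basis = insert i I" "i \<notin> I" "finite I" using i by (auto simp: I_def)
  have IB: "c \<in> Basis" "c \<noteq> i" if "c \<in> I" for c using that by (auto simp: I_def)
  have Ine: "I \<noteq> {}"
  proof
    assume "I = {}"
    then have "Basis = {i}" using I by simp
    then have "DIM('a) = card {i}" by (rule arg_cong)
    then show False using dim by simp
  qed
  define S where "S = (\<lambda>f::'a\<Rightarrow>real. \<Sum>b\<in>Basis. f b *\<^sub>R b)"
  have Sup: "S (x(i := y)) = (\<Sum>b\<in>I. x b *\<^sub>R b) + y *\<^sub>R i" for x y
    unfolding S_def I(1) using I by (subst sum.insert) (auto intro!: sum.cong simp: add.commute)
  interpret product_sigma_finite "\<lambda>_::'a. lborel::real measure" by standard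
  have Smeas: "S \<in> measurable (\<Pi>\<^sub>M b\<in>Basis. lborel) borel" unfolding S_def by measurable
  have lb: "lborel = distr (\<Pi>\<^sub>M b\<in>Basis. lborel) borel S"
    unfolding S_def by (rule lborel_eq)
  have int': "integrable (\<Pi>\<^sub>M b\<in>insert i I. lborel) (\<lambda>f. gi (S f))"
    using int unfolding lb using Smeas integrable_distr[of S "\<Pi>\<^sub>M b\<in>Basis. lborel" borel gi]
    by (simp add: I(1))
  have "(\<integral>x. gi x \<partial>lborel) = (\<integral>f. gi (S f) \<partial>(\<Pi>\<^sub>M b\<in>Basis. lborel))"
    by (subst lb, subst integral_distr) (use Smeas borel_measurable_integrable[OF int] in auto)
  also have "\<dots> = (\<integral>x. (\<integral>y. gi (S (x(i := y))) \<partial>lborel) \<partial>(\<Pi>\<^sub>M b\<in>I. lborel))"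
    unfolding I(1) by (rule product_integral_insert[OF I(3,2) int'])
  also have "\<dots> = 0"
  proof (rule integral_eq_zero_AE)
    have null: "(\<Pi>\<^sub>E b\<in>I. {0}) \<in> null_sets (\<Pi>\<^sub>M b\<in>I. (lborel::real measure))"
    proof
      show "(\<Pi>\<^sub>E b\<in>I. {0}) \<in> sets (\<Pi>\<^sub>M b\<in>I. (lborel::real measure))"
        using I by (intro sets_PiM_I_finite) auto
      show "emeasure (\<Pi>\<^sub>M b\<in>I. lborel) (\<Pi>\<^sub>E b\<in>I. {0::real}) = 0"
        using I Ine by (subst emeasure_PiM) auto
    qed
    show "AE x in (\<Pi>\<^sub>M b\<in>I. lborel). (\<integral>y. gi (S (x(i := y))) \<partial>lborel) = 0"
    proof (rule AE_I[where N="\<Pi>\<^sub>E b\<in>I. {0}"])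
      show "{x \<in> space (\<Pi>\<^sub>M b\<in>I. lborel). (\<integral>y. gi (S (x(i := y))) \<partial>lborel) \<noteq> 0} \<subseteq> (\<Pi>\<^sub>E b\<in>I. {0})"
      proof (rule subsetI, rule ccontr)
        fix x assume x: "x \<in> {x \<in> space (\<Pi>\<^sub>M b\<in>I. lborel). (\<integral>y. gi (S (x(i := y))) \<partial>lborel) \<noteq> 0}"
          and nx: "x \<notin> (\<Pi>\<^sub>E b\<in>I. {0})"
        have "x \<in> extensional I" using x by (auto simp: space_PiM PiE_def)
        then obtain b where b: "b \<in> I" "x b \<noteq> 0" using nx unfolding PiE_iff by blast
        define X where "X = (\<Sum>b\<in>I. x b *\<^sub>R b)"
        have Xb: "(X + y *\<^sub>R i) \<bullet> b = x b" for y
        proof -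
          have "X \<bullet> b = (\<Sum>c\<in>I. x c * (c \<bullet> b))" by (simp add: X_def inner_sum_left)
          also have "\<dots> = (\<Sum>c\<in>I. if c = b then x c else 0)"
            by (intro sum.cong refl) (use b in \<open>auto simp: inner_Basis IB\<close>)
          also have "\<dots> = x b" using b I by simp
          finally show ?thesis using b IB i by (auto simp: inner_add_left inner_Basis)
        qed
        have ne: "X + y *\<^sub>R i \<noteq> 0" for y using Xb[of y] b by auto
        have Xi: "(X + y *\<^sub>R i) \<bullet> i = y" for y
        proof -
          have "X \<bullet> i = (\<Sum>c\<in>I. x c * (c \<bullet> i))" by (simp add: X_def inner_sum_left)
          also have "\<dots> = 0" using IB i by (intro sum.neutral) (auto simp: inner_Basis)
          finally show ?thesis using i by (simp add: inner_add_left)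
        qed
        have big: "norm (X + y *\<^sub>R i) \<ge> \<bar>y\<bar>" for y using Basis_le_norm[OF i, of "X + y *\<^sub>R i"] Xi by simp
        have dy: "((\<lambda>y. g (X + y *\<^sub>R i)) has_vector_derivative gi (X + y *\<^sub>R i)) (at y)" for y
        proof -
          have "((\<lambda>t. g ((X + y *\<^sub>R i) + t *\<^sub>R i)) \<circ> (\<lambda>s. s - y) has_vector_derivative (1 *\<^sub>R gi (X + y *\<^sub>R i))) (at y)"
            by (rule vector_diff_chain_at) (auto intro!: derivative_eq_intros simp: der[OF ne])
          then show ?thesis by (simp add: o_def algebra_simps)
        qed
        have "((\<lambda>y. gi (X + y *\<^sub>R i)) has_integral (g (X + 1 *\<^sub>R i) - g (X + (-1) *\<^sub>R i))) {-1..1}"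
          by (rule fundamental_theorem_of_calculus) (auto intro: has_vector_derivative_at_within dy)
        moreover have "g (X + 1 *\<^sub>R i) = 0" "g (X + (-1) *\<^sub>R i) = 0"
          using big[of 1] big[of "-1"] by (auto intro!: zero)
        ultimately have "((\<lambda>y. gi (X + y *\<^sub>R i)) has_integral 0) {-1..1}" by simp
        \<comment> \<open>For |y| > 1 the function \<open>g\<close> is locally 0 along the line, so
          \<open>gi\<close> is 0 there by uniqueness of derivatives.\<close>
        then have hi: "((\<lambda>y. gi (X + y *\<^sub>R i)) has_integral 0) UNIV"
        proof (rule has_integral_on_superset)
          fix y :: real assume "y \<notin> {-1..1}"
          then have y: "\<bar>y\<bar> > 1" by auto
          have "((\<lambda>y. g (X + y *\<^sub>R i)) has_vector_derivative 0) (at y)"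
          proof (rule has_vector_derivative_transform_within_open[where f="\<lambda>_. 0" and S="{y. \<bar>y\<bar> > 1}"])
            show "open {y::real. \<bar>y\<bar> > 1}" by (intro open_Collect_less continuous_intros)
            show "0 = g (X + z *\<^sub>R i)" if "z \<in> {y. \<bar>y\<bar> > 1}" for z
              using big[of z] that zero[of "X + z *\<^sub>R i"] by auto
          qed (use y in auto)
          then show "gi (X + y *\<^sub>R i) = 0" using dy[of y] vector_derivative_unique_at by blast
        qed auto
        have "(\<integral>y. gi (S (x(i := y))) \<partial>lborel) = 0"
        \<comment> \<open>If \<open>gi\<close> is not integrable on this line, its Bochner integral
          there is 0 by convention, so no further null set has to be removed.\<close>
        proof (cases "integrable lborel (\<lambda>y. gi (X + y *\<^sub>R i))")
          case True
          then show ?thesis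
            using hi integral_lborel[OF True] by (simp add: Sup X_def[symmetric] integral_unique)
        next
          case False
          then show ?thesis by (simp add: Sup X_def[symmetric] not_integrable_integral_eq)
        qed
        then show False using x by simp
      qed
    qed (use null in auto)
  qed
  finally show ?thesis .
qed

text \<open>Radial expressions are controlled only for x different from 0; at the origin they take
  whatever value division by zero yields. This removes that point from measurability
  questions.\<close>

lemma measurable_modify_at_point:
  fixes G g :: "'a::euclidean_space \<Rightarrow> 'b::topological_space"
  assumes g: "g \<in> borel_measurable (lebesgue_on S)" and S: "S \<in> sets borel"
    and eq: "\<And>x. x \<in> S \<Longrightarrow> x \<noteq> a \<Longrightarrow> G x = g x"
  shows "G \<in> borel_measurable (lebesgue_on S)"
proof -
  have S': "S \<in> sets lebesgue" using S by auto
  have "(\<lambda>x. if x \<in> {a} then G a else g x) \<in> borel_measurable (lebesgue_on S)"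
  proof (rule measurable_If_set)
    have "{a} \<inter> S \<in> sets lebesgue" using S' by auto
    then show "{a} \<inter> space (lebesgue_on S) \<in> sets (lebesgue_on S)"
      using S' by (subst sets_restrict_space_iff) auto
  qed (use g in auto)
  then show ?thesis
    by (rule measurable_cong[THEN iffD1, rotated]) (use eq in auto)
qed

lemma AE_lebesgue_on_neq:
  assumes "S \<in> sets borel"
  shows "AE x in lebesgue_on S. x \<noteq> (a::'a::euclidean_space)"
proof -
  have "AE x in lebesgue. x \<noteq> a"
    by (rule AE_I[where N="{a}"]) (auto simp: emeasure_completion)
  then show ?thesis using assms by (subst AE_restrict_space_iff) auto
qed

text \<open>Bridge between two measures: Fubini is used for \<open>lborel\<close>, a product of
  one-dimensional measures, while weak gradients and energies are integrals over
  \<open>lebesgue_on\<close> the ball. The exempted point \<open>a\<close> is the origin in all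
  uses.\<close>

lemma lborel_integral_lebesgue_on:
  fixes g G :: "'a::euclidean_space \<Rightarrow> 'b::euclidean_space"
  assumes int: "integrable lborel g" and S: "S \<in> sets borel"
    and out: "\<And>x. x \<notin> S \<Longrightarrow> g x = 0"
    and eq: "\<And>x. x \<in> S \<Longrightarrow> x \<noteq> a \<Longrightarrow> G x = g x"
  shows "integrable (lebesgue_on S) G" "(\<integral>x. G x \<partial>lebesgue_on S) = (\<integral>x. g x \<partial>lborel)"
proof -
  have S': "S \<in> sets lebesgue" using S by auto
  have ind: "(\<lambda>x. indicator S x *\<^sub>R g x) = g" using out by (auto simp: indicator_def)
  have gi: "integrable lebesgue g" using int
    by (subst integrable_completion) (auto dest: borel_measurable_integrable)
  have i1: "integrable (lebesgue_on S) g"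
    using gi S' by (subst integrable_restrict_space) (auto simp: ind)
  have mG: "G \<in> borel_measurable (lebesgue_on S)"
    by (rule measurable_modify_at_point[OF borel_measurable_integrable[OF i1] S eq])
  have ae: "AE x in lebesgue_on S. g x = G x"
    using AE_lebesgue_on_neq[OF S, of a] AE_space by eventually_elim (use eq in auto)
  show "integrable (lebesgue_on S) G"
    by (rule integrable_cong_AE_imp[OF i1 mG]) (use ae in eventually_elim, simp)
  have "(\<integral>x. G x \<partial>lebesgue_on S) = (\<integral>x. g x \<partial>lebesgue_on S)"
    by (rule integral_cong_AE[OF mG borel_measurable_integrable[OF i1]]) (use ae in eventually_elim, simp)
  also have "\<dots> = (\<integral>x. g x \<partial>lebesgue)"
    using S' by (subst integral_restrict_space) (auto simp: ind)
  also have "\<dots> = (\<integral>x. g x \<partial>lborel)"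
    by (rule integral_completion) (use int in \<open>auto dest: borel_measurable_integrable\<close>)
  finally show "(\<integral>x. G x \<partial>lebesgue_on S) = (\<integral>x. g x \<partial>lborel)" .
qed

lemma integrable_lebesgue_on_inverse_square:
  assumes dim: "DIM('a::euclidean_space) \<ge> 3"
  shows "integrable (lebesgue_on (ball 0 1)) (\<lambda>x::'a. C / (norm x)\<^sup>2)"
proof -
  have "integrable (lebesgue_on (ball 0 1)) (\<lambda>x::'a. 1 / (norm x)\<^sup>2)"
    by (rule lborel_integral_lebesgue_on(1)[OF integrable_ball_inverse_square[OF dim], where a=0]) auto
  then have "integrable (lebesgue_on (ball 0 1)) (\<lambda>x::'a. C * (1 / (norm x)\<^sup>2))"
    by (rule integrable_mult_right)
  then show ?thesis by simp
qed

lemma has_derivative_imp_has_vector_derivative_line: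
  assumes "(f has_derivative f') (at x)"
  shows "((\<lambda>t. f (x + t *\<^sub>R i)) has_vector_derivative f' i) (at 0)"
proof -
  have "((\<lambda>t. x + t *\<^sub>R i) has_derivative (\<lambda>t. t *\<^sub>R i)) (at 0)"
    by (auto intro!: derivative_eq_intros)
  moreover have "(f has_derivative f') (at (x + 0 *\<^sub>R i))" using assms by simp
  ultimately have "((\<lambda>t. f (x + t *\<^sub>R i)) has_derivative (\<lambda>t. f' (t *\<^sub>R i))) (at 0)"
    by (rule has_derivative_compose)
  moreover have "linear f'" using assms has_derivative_linear by blast
  ultimately show ?thesis by (simp add: has_vector_derivative_def linear_scale)
qed

lemma has_real_derivative_norm_line:
  fixes x :: "'a::euclidean_space"
  assumes "x \<noteq> 0"
  shows "((\<lambda>t. norm (x + t *\<^sub>R i)) has_real_derivative (x \<bullet> i) / norm x) (at 0)"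
proof -
  have "((\<lambda>t. norm (x + t *\<^sub>R i)) has_vector_derivative i \<bullet> sgn x) (at 0)"
    by (rule has_derivative_imp_has_vector_derivative_line[OF has_derivative_norm[OF assms]])
  moreover have "i \<bullet> sgn x = (x \<bullet> i) / norm x"
    by (simp add: sgn_div_norm inner_commute divide_inverse mult.commute)
  ultimately show ?thesis by (simp add: has_real_derivative_iff_has_vector_derivative)
qed

lemma has_vector_derivative_radial_scale:
  fixes \<psi> :: "'a::euclidean_space \<Rightarrow> 'b::euclidean_space"
  assumes x: "0 < norm x" and q: "(q has_real_derivative q') (at (norm x))"
    and \<psi>: "((\<lambda>t. \<psi> (x + t *\<^sub>R i)) has_vector_derivative \<psi>i) (at 0)"
  shows "((\<lambda>t. q (norm (x + t *\<^sub>R i)) *\<^sub>R \<psi> (x + t *\<^sub>R i)) has_vector_derivative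
           q (norm x) *\<^sub>R \<psi>i + (q' * (x \<bullet> i) / norm x) *\<^sub>R \<psi> x) (at 0)"
proof -
  have "((\<lambda>t. q (norm (x + t *\<^sub>R i))) has_real_derivative q' * ((x \<bullet> i) / norm x)) (at 0)"
    by (rule DERIV_chain'[where g=q]) (use x q has_real_derivative_norm_line[of x i] in auto)
  from has_vector_derivative_scaleR[OF this \<psi>] show ?thesis by simp
qed

text \<open>By the product rule the integrand is the partial derivative along \<open>i\<close> of
  \<open>q (norm x) *\<^sub>R \<psi> x\<close>. The two growth bounds make it integrable across the
  singularity of \<open>q\<close>, and the compact support of \<psi> removes the boundary term.
  Later \<open>q\<close> is \<open>f\<close>, \<open>b\<close>, \<open>s\<close> or the factor of a
  general radial field.\<close>

lemma radial_integral_by_parts: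
  fixes \<psi> \<psi>i :: "'a::euclidean_space \<Rightarrow> 'b::euclidean_space" and q q' :: "real \<Rightarrow> real"
  assumes i: "i \<in> Basis" and dim: "DIM('a) \<ge> 3"
    and q: "\<And>r. 0 < r \<Longrightarrow> r < 1 \<Longrightarrow> (q has_real_derivative q' r) (at r)"
    and q'_cont: "continuous_on {0<..<1} q'"
    and \<psi>: "\<And>x. ((\<lambda>t. \<psi> (x + t *\<^sub>R i)) has_vector_derivative \<psi>i x) (at 0)"
    and cont: "continuous_on UNIV \<psi>" "continuous_on UNIV \<psi>i"
    and K: "compact K" "K \<subseteq> ball 0 1" "\<And>x. x \<notin> K \<Longrightarrow> \<psi> x = 0"
    and bd: "\<And>x. 0 < norm x \<Longrightarrow> norm x < 1 \<Longrightarrow> norm (q (norm x) *\<^sub>R \<psi>i x) \<le> C / (norm x)\<^sup>2"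
    and bd': "\<And>x. 0 < norm x \<Longrightarrow> norm x < 1 \<Longrightarrow> norm (q' (norm x) *\<^sub>R \<psi> x) \<le> C / (norm x)\<^sup>2"
  shows "has_bochner_integral (lebesgue_on (ball 0 1))
           (\<lambda>x. q (norm x) *\<^sub>R \<psi>i x + (q' (norm x) * (x \<bullet> i) / norm x) *\<^sub>R \<psi> x) 0"
proof -
  define A where "A = {x::'a. x \<noteq> 0} \<inter> ball 0 1"
  define G where "G x = q (norm x) *\<^sub>R \<psi>i x + (q' (norm x) * (x \<bullet> i) / norm x) *\<^sub>R \<psi> x" for x
  define gi where "gi x = indicator A x *\<^sub>R G x" for x
  define g where "g x = (if x \<in> A then q (norm x) *\<^sub>R \<psi> x else 0)" for x
  have openA: "open A" unfolding A_def by (intro open_Int open_ball open_Collect_neq continuous_intros)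
  have Ax: "x \<in> A \<longleftrightarrow> 0 < norm x \<and> norm x < 1" for x by (auto simp: A_def)
  have q_cont: "continuous_on {0<..<1} q"
    by (intro continuous_at_imp_continuous_on) (auto intro!: DERIV_isCont q)
  have contG: "continuous_on A G"
    unfolding G_def
    by (intro continuous_intros continuous_on_compose2[OF q_cont] continuous_on_compose2[OF q'_cont]
         continuous_on_subset[OF cont(1)] continuous_on_subset[OF cont(2)]) (auto simp: Ax)
  have meas: "gi \<in> borel_measurable lborel"
    unfolding gi_def using borel_measurable_continuous_on_indicator[OF _ contG] openA by auto
  have bound: "norm (gi x) \<le> 2 * (C * (indicator (ball 0 1) x / (norm x)\<^sup>2))" for x
  proof (cases "x \<in> A")
    case True
    have r: "0 < norm x" "norm x < 1" using True Ax by auto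
    have "\<bar>x \<bullet> i\<bar> / norm x \<le> 1" using Basis_le_norm[OF i, of x] r by (simp add: divide_le_eq)
    then have "norm ((q' (norm x) * (x \<bullet> i) / norm x) *\<^sub>R \<psi> x) \<le> 1 * norm (q' (norm x) *\<^sub>R \<psi> x)"
      using mult_right_mono[of "\<bar>x \<bullet> i\<bar> / norm x" 1 "norm (q' (norm x) *\<^sub>R \<psi> x)"]
      by (simp add: abs_mult mult_ac)
    then have "norm (G x) \<le> C / (norm x)\<^sup>2 + C / (norm x)\<^sup>2"
      unfolding G_def using bd[OF r] bd'[OF r] norm_triangle_ineq by (smt (verit))
    then show ?thesis using True by (simp add: gi_def A_def)
  next
    case False
    then have "x = 0 \<or> x \<notin> ball 0 1" by (auto simp: A_def)
    then show ?thesis using False by (auto simp: gi_def)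
  qed
  have int: "integrable lborel gi"
  proof (rule Bochner_Integration.integrable_bound)
    show "integrable lborel (\<lambda>x::'a. 2 * (C * (indicator (ball 0 1) x / (norm x)\<^sup>2)))"
      by (intro integrable_mult_right integrable_ball_inverse_square dim)
    show "AE x in lborel. norm (gi x) \<le> norm (2 * (C * (indicator (ball 0 1) x / (norm x)\<^sup>2)))"
      unfolding real_norm_def by (intro AE_I2 order_trans[OF bound] abs_ge_self)
  qed (rule meas)
  have \<psi>i0: "\<psi>i x = 0" if "x \<notin> K" for x
  proof -
    have "((\<lambda>t. \<psi> (x + t *\<^sub>R i)) has_vector_derivative 0) (at 0)"
    proof (rule has_vector_derivative_transform_within_open[where f="\<lambda>_. 0" and S="(\<lambda>t. x + t *\<^sub>R i) -` (- K)"])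
      show "open ((\<lambda>t. x + t *\<^sub>R i) -` (- K))"
        by (intro open_vimage continuous_intros) (use K(1) in \<open>auto intro: compact_imp_closed\<close>)
    qed (use that K(3) in auto)
    then show ?thesis using \<psi> vector_derivative_unique_at by blast
  qed
  have der: "((\<lambda>t. g (x + t *\<^sub>R i)) has_vector_derivative gi x) (at 0)" if "x \<noteq> 0" for x
  proof (cases "x \<in> A")
    case True
    have "((\<lambda>t. q (norm (x + t *\<^sub>R i)) *\<^sub>R \<psi> (x + t *\<^sub>R i)) has_vector_derivative G x) (at 0)"
      unfolding G_def
      by (rule has_vector_derivative_radial_scale) (use True Ax q \<psi> in auto)
    then have "((\<lambda>t. g (x + t *\<^sub>R i)) has_vector_derivative G x) (at 0)"
    proof (rule has_vector_derivative_transform_within_open[where S="(\<lambda>t. x + t *\<^sub>R i) -` A"])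
      show "open ((\<lambda>t. x + t *\<^sub>R i) -` A)" by (intro open_vimage continuous_intros openA)
    qed (use True in \<open>auto simp: g_def\<close>)
    then show ?thesis using True by (simp add: gi_def)
  next
    case False
    then have xK: "x \<notin> K" using K(2) that by (auto simp: A_def)
    have "((\<lambda>t. g (x + t *\<^sub>R i)) has_vector_derivative 0) (at 0)"
    proof (rule has_vector_derivative_transform_within_open[where f="\<lambda>_. 0" and S="(\<lambda>t. x + t *\<^sub>R i) -` (- K)"])
      show "open ((\<lambda>t. x + t *\<^sub>R i) -` (- K))"
        by (intro open_vimage continuous_intros) (use K(1) in \<open>auto intro: compact_imp_closed\<close>)
    qed (use xK K(3) in \<open>auto simp: g_def\<close>)
    then show ?thesis using False by (simp add: gi_def)
  qed
  have zero: "(\<integral>x. gi x \<partial>lborel) = 0"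
    by (rule integral_partial_eq_0[OF i _ int der]) (use dim in \<open>auto simp: g_def Ax\<close>)
  have *: "ball (0::'a) 1 \<in> sets borel" "\<And>x. x \<notin> ball 0 1 \<Longrightarrow> gi x = 0"
    "\<And>x. x \<in> ball 0 1 \<Longrightarrow> x \<noteq> 0 \<Longrightarrow> G x = gi x"
    by (auto simp: gi_def A_def)
  show ?thesis
    using lborel_integral_lebesgue_on[OF int *] zero unfolding has_bochner_integral_iff G_def by simp
qed

text \<open>\<open>smooth_on\<close> controls \<phi> only on \<open>U\<close>. Off the compact
  support \<phi> is locally 0, so its derivative exists and is 0 there; gluing over the open sets
  \<open>U\<close> and \<open>- K\<close> gives continuous partials on the whole space. Compactness
  of \<open>K\<close> then gives one bound for \<phi> and all its partials.\<close>

lemma test_funE: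
  fixes \<phi> :: "'a::euclidean_space \<Rightarrow> 'b::euclidean_space"
  assumes "test_fun U \<phi>" and U: "open U"
  obtains K C where "compact K" "K \<subseteq> U" "\<And>x. x \<notin> K \<Longrightarrow> \<phi> x = 0"
    "\<And>x i. x \<notin> K \<Longrightarrow> frechet_derivative \<phi> (at x) i = 0"
    "\<And>x. (\<phi> has_derivative frechet_derivative \<phi> (at x)) (at x)"
    "\<And>i. i \<in> Basis \<Longrightarrow> continuous_on UNIV (\<lambda>x. frechet_derivative \<phi> (at x) i)"
    "0 \<le> C" "\<And>x. norm (\<phi> x) \<le> C" "\<And>x i. i \<in> Basis \<Longrightarrow> norm (frechet_derivative \<phi> (at x) i) \<le> C"
proof -
  define K where "K = closure {x. \<phi> x \<noteq> 0}"
  have K: "compact K" "K \<subseteq> U" and sm: "smooth_on U \<phi>"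
    using assms(1) by (auto simp: test_fun_def K_def)
  have cl: "closed K" using K compact_imp_closed by blast
  have K0: "\<phi> x = 0" if "x \<notin> K" for x
    using that closure_subset[of "{x. \<phi> x \<noteq> 0}"] by (auto simp: K_def)
  obtain F where F: "\<phi> \<in> F" "\<And>g. g \<in> F \<Longrightarrow> g differentiable_on U"
      "\<And>g i. g \<in> F \<Longrightarrow> i \<in> Basis \<Longrightarrow> (\<lambda>x. frechet_derivative g (at x) i) \<in> F"
    using sm unfolding smooth_on_def by blast
  have off: "(\<phi> has_derivative (\<lambda>_. 0)) (at x)" if "x \<notin> K" for x
    by (rule has_derivative_transform_within_open[of "\<lambda>_. 0" _ _ _ "-K"]) (use that cl K0 in auto)
  have off0: "frechet_derivative \<phi> (at x) i = 0" if "x \<notin> K" for x i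
    using frechet_derivative_at[OF off[OF that]] by (metis)
  have der: "(\<phi> has_derivative frechet_derivative \<phi> (at x)) (at x)" for x
  proof (cases "x \<in> K")
    case True
    then have "\<phi> differentiable at x"
      using F(1,2) K(2) U by (metis differentiable_on_eq_differentiable_at subsetD)
    then show ?thesis by (simp add: frechet_derivative_works)
  next
    case False
    then show ?thesis using frechet_derivative_at[OF off[OF False]] off[OF False] by simp
  qed
  have cont: "continuous_on UNIV (\<lambda>x. frechet_derivative \<phi> (at x) i)" if i: "i \<in> Basis" for i
  proof -
    have "continuous_on U (\<lambda>x. frechet_derivative \<phi> (at x) i)"
      using F i by (intro differentiable_imp_continuous_on) auto
    moreover have "continuous_on (-K) (\<lambda>x. frechet_derivative \<phi> (at x) i)"
      by (rule continuous_on_eq[of _ "\<lambda>_. 0"]) (use off0 in auto)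
    ultimately have "continuous_on (U \<union> -K) (\<lambda>x. frechet_derivative \<phi> (at x) i)"
      using U cl by (intro continuous_on_open_Un) auto
    moreover have "U \<union> -K = UNIV" using K by auto
    ultimately show ?thesis by simp
  qed
  have contphi: "continuous_on UNIV \<phi>"
    by (intro continuous_at_imp_continuous_on ballI) (use der has_derivative_continuous in blast)
  have bdd: "\<exists>C. \<forall>x. norm (f x) \<le> C" if "continuous_on UNIV f" "\<And>x. x \<notin> K \<Longrightarrow> f x = 0" for f :: "'a \<Rightarrow> 'b"
  proof -
    have "bounded (f ` K)"
      using compact_continuous_image[OF continuous_on_subset[OF that(1)] K(1)] compact_imp_bounded by auto
    then obtain C where C: "\<And>x. x \<in> K \<Longrightarrow> norm (f x) \<le> C" by (auto simp: bounded_iff)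
    show ?thesis
      by (rule exI[of _ "max 0 C"]) (metis C that(2) max.coboundedI1 max.coboundedI2 norm_zero order_refl)
  qed
  obtain C0 where C0: "\<And>x. norm (\<phi> x) \<le> C0" using bdd[OF contphi] K0 by auto
  have "\<forall>i\<in>Basis. \<exists>C. \<forall>x. norm (frechet_derivative \<phi> (at x) i) \<le> C"
    using bdd[OF cont] off0 by blast
  then obtain c where c: "\<And>i x. i \<in> Basis \<Longrightarrow> norm (frechet_derivative \<phi> (at x) i) \<le> c i" by metis
  have "c i \<le> (\<Sum>i\<in>Basis. \<bar>c i\<bar>)" if "i \<in> Basis" for i
    using member_le_sum[OF that, of "\<lambda>i. \<bar>c i\<bar>"] by auto
  then have c': "norm (frechet_derivative \<phi> (at x) i) \<le> max C0 (\<Sum>i\<in>Basis. \<bar>c i\<bar>)" if "i \<in> Basis" for i x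
    using c[OF that, of x] that by (meson max.coboundedI2 order_trans)
  have C1: "norm (\<phi> x) \<le> max C0 (\<Sum>i\<in>Basis. \<bar>c i\<bar>)" for x using C0[of x] by auto
  then have "0 \<le> max C0 (\<Sum>i\<in>Basis. \<bar>c i\<bar>)" using norm_ge_zero order_trans by blast
  with c' C1 K K0 off0 der cont show ?thesis using that by blast
qed

section \<open>The radial profile\<close>

lemma continuous_on_real_derivative:
  assumes "\<And>r. 0 < r \<Longrightarrow> r < 1 \<Longrightarrow> (q has_real_derivative q' r) (at r)"
  shows "continuous_on {0<..<1} q"
  by (intro continuous_at_imp_continuous_on) (auto intro!: DERIV_isCont assms)

text \<open>\<open>V r\<close> stands for \<open>W' (1 - (h r)^2) / eps^2\<close>; only its bounds and continuity matter.\<close>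
locale radial_profile =
  fixes N :: nat and h h' h'' V :: "real \<Rightarrow> real" and M :: real
  assumes N: "N \<ge> 7"
    and h_der: "\<And>r. 0 < r \<Longrightarrow> r < 1 \<Longrightarrow> (h has_real_derivative h' r) (at r)"
    and h'_der: "\<And>r. 0 < r \<Longrightarrow> r < 1 \<Longrightarrow> (h' has_real_derivative h'' r) (at r)"
    and ode: "\<And>r. 0 < r \<Longrightarrow> r < 1 \<Longrightarrow>
        - h'' r - (real N - 1) / r * h' r + (real N - 1) / r\<^sup>2 * h r = h r * V r"
    and V_cont: "continuous_on {0<..<1} V"
    and V_nonneg: "\<And>r. 0 < r \<Longrightarrow> r < 1 \<Longrightarrow> 0 \<le> V r"
    and V_le: "\<And>r. 0 < r \<Longrightarrow> r < 1 \<Longrightarrow> V r \<le> M"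
    and h_pos: "\<And>r. 0 < r \<Longrightarrow> r < 1 \<Longrightarrow> 0 < h r"
    and h_lt_1: "\<And>r. 0 < r \<Longrightarrow> r < 1 \<Longrightarrow> h r < 1"
    and h'_nonneg: "\<And>r. 0 < r \<Longrightarrow> r < 1 \<Longrightarrow> 0 \<le> h' r"
    and h_cont: "continuous_on {0..1} h"
    and h_0: "h 0 = 0" and h_1: "h 1 = 1"
begin

text \<open>Substituting h = r f, the radial equation becomes
  \<open>f'' + (N + 1) / r * f' + V * f = 0\<close>, a radial Laplace operator in dimension N + 2.
  \<open>f''\<close> is defined by this equation and only afterwards shown to be the derivative of
  \<open>f'\<close>. \<open>b\<close> is the coefficient of the rank-one part of the gradient of
  f(|x|) x.\<close>

definition f where "f r = h r / r"
definition f' where "f' r = (h' r - h r / r) / r"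
definition f'' where "f'' r = - V r * f r - (real N + 1) / r * f' r"
definition b where "b r = f' r / r"
definition b' where "b' r = (f'' r - f' r / r) / r"

lemma M_nonneg: "0 \<le> M"
  using V_nonneg[of "1/2"] V_le[of "1/2"] by simp

lemma h''_eq: "0 < r \<Longrightarrow> r < 1 \<Longrightarrow> h'' r = - V r * h r - (real N - 1) * f' r"
proof -
  assume r: "0 < r" "r < 1"
  have "(real N - 1) * f' r = (real N - 1) / r * h' r - (real N - 1) / r\<^sup>2 * h r"
    using r by (simp add: f'_def field_simps power2_eq_square)
  then show ?thesis using ode[OF r] by (simp add: mult.commute)
qed

lemma f_der:
  assumes "0 < r" "r < 1"
  shows "(f has_real_derivative f' r) (at r)"
  unfolding f_def[abs_def] f'_def
  by (rule DERIV_cong[OF DERIV_divide[OF h_der[OF assms] DERIV_ident]]) (use assms in \<open>auto simp: field_simps\<close>)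

lemma f'_der:
  assumes "0 < r" "r < 1"
  shows "(f' has_real_derivative f'' r) (at r)"
proof -
  have "((\<lambda>r. (h' r - f r) / r) has_real_derivative ((h'' r - f' r) * r - (h' r - f r)) / (r * r)) (at r)"
    by (rule DERIV_cong[OF DERIV_divide[OF DERIV_diff[OF h'_der[OF assms] f_der[OF assms]] DERIV_ident]])
       (use assms in auto)
  moreover have "((h'' r - f' r) * r - (h' r - f r)) / (r * r) = f'' r"
  proof -
    have e: "h' r - f r = r * f' r" using assms by (simp add: f'_def f_def)
    have "((h'' r - f' r) * r - r * f' r) / (r * r) = f'' r"
      unfolding h''_eq[OF assms] f''_def using assms by (simp add: f_def field_simps)
    then show ?thesis by (simp add: e)
  qed
  ultimately show ?thesis by (simp add: f'_def[abs_def] f_def)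
qed

lemma b_der:
  assumes "0 < r" "r < 1"
  shows "(b has_real_derivative b' r) (at r)"
  unfolding b_def[abs_def] b'_def
  by (rule DERIV_cong[OF DERIV_divide[OF f'_der[OF assms] DERIV_ident]]) (use assms in \<open>auto simp: field_simps\<close>)

lemma continuous_on_f: "continuous_on {0<..<1} f" by (rule continuous_on_real_derivative[OF f_der])
lemma continuous_on_f': "continuous_on {0<..<1} f'" by (rule continuous_on_real_derivative[OF f'_der])
lemma continuous_on_b: "continuous_on {0<..<1} b" by (rule continuous_on_real_derivative[OF b_der])
lemma continuous_on_h: "continuous_on {0<..<1} h" by (rule continuous_on_real_derivative[OF h_der])
lemma continuous_on_h': "continuous_on {0<..<1} h'" by (rule continuous_on_real_derivative[OF h'_der])

lemma continuous_on_b': "continuous_on {0<..<1} b'"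
  unfolding b'_def[abs_def] f''_def[abs_def]
  by (intro continuous_intros V_cont continuous_on_f continuous_on_f') auto

text \<open>By the equation \<open>r^(N+1) f'\<close> is antitone, so if it were positive somewhere then
  \<open>f\<close> would tend to minus infinity at the origin.\<close>
lemma f'_nonpos:
  assumes "0 < r" "r < 1"
  shows "f' r \<le> 0"
proof (rule ccontr)
  assume "\<not> f' r \<le> 0"
  define G where "G r = r ^ (N+1) * f' r" for r
  define q where "q = G r"
  have q: "q > 0" using \<open>\<not> f' r \<le> 0\<close> assms by (simp add: q_def G_def)
  have G_der: "(G has_real_derivative - (t ^ (N+1) * V t * f t)) (at t)" if t: "0 < t" "t < 1" for t
  proof -
    have "(G has_real_derivative real (N+1) * t ^ N * f' t + f'' t * t ^ (N+1)) (at t)"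
      unfolding G_def[abs_def]
      by (rule DERIV_cong[OF DERIV_mult[OF DERIV_pow f'_der[OF t]]]) simp
    moreover have "real (N+1) * t ^ N * f' t + f'' t * t ^ (N+1) = - (t ^ (N+1) * V t * f t)"
      using t by (simp add: f''_def field_simps)
    ultimately show ?thesis by simp
  qed
  have f_pos: "f t > 0" if "0 < t" "t < 1" for t using h_pos[OF that] that by (simp add: f_def)
  have G_ge: "G t \<ge> q" if t: "0 < t" "t \<le> r" for t
    unfolding q_def
  proof (rule DERIV_nonpos_imp_nonincreasing[OF t(2)])
    fix x assume "t \<le> x" "x \<le> r"
    then have x: "0 < x" "x < 1" using t assms by auto
    show "\<exists>y. (G has_real_derivative y) (at x) \<and> y \<le> 0"
      using G_der[OF x] f_pos[OF x] V_nonneg[OF x] x by (intro exI conjI) auto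
  qed
  \<comment> \<open>The added term is an antiderivative of \<open>- q / t ^ (N+1)\<close>, while
    \<open>G \<ge> q\<close> says that \<open>f'\<close> is at least \<open>q / t ^ (N+1)\<close>.
    Hence \<open>D\<close> is nondecreasing, and its bound by \<open>D r\<close> forces
    \<open>f\<close> down as t tends to 0.\<close>
  define D where "D t = f t + (q / N) * inverse (t ^ N)" for t
  have D_le: "D t \<le> D r" if t: "0 < t" "t \<le> r" for t
  proof (rule DERIV_nonneg_imp_nondecreasing[OF t(2)])
    fix x assume xt: "t \<le> x" "x \<le> r"
    then have x: "0 < x" "x < 1" using t assms by auto
    have "(D has_real_derivative f' x - (q / N) * (real N * x ^ (N - 1) * inverse (x ^ N) ^ 2)) (at x)"
      unfolding D_def[abs_def]
      by (rule DERIV_cong[OF DERIV_add[OF f_der[OF x] DERIV_cmult[OF DERIV_inverse_fun[OF DERIV_pow]]]])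
         (use x in \<open>auto simp: power2_eq_square\<close>)
    moreover have "(q / N) * (real N * x ^ (N - 1) * inverse (x ^ N) ^ 2) = q / x ^ (N+1)"
    proof -
      have "x ^ N = x * x ^ (N - 1)" using N by (simp add: power_eq_if)
      then show ?thesis using N x by (simp add: field_simps power2_eq_square)
    qed
    moreover have "f' x = G x / x ^ (N+1)" using x by (simp add: G_def)
    moreover have "G x \<ge> q" using G_ge xt t by auto
    then have "G x / x ^ (N+1) - q / x ^ (N+1) \<ge> 0" using x by (simp add: divide_right_mono)
    ultimately show "\<exists>y. (D has_real_derivative y) (at x) \<and> 0 \<le> y" by metis
  qed
  define L where "L = max 1 (D r)"
  \<comment> \<open>Small enough that \<open>(q / N) * inverse t \<ge> 2 * L\<close>. Since t^N <= t
    and \<open>f t > 0\<close>, this makes \<open>D t\<close> exceed \<open>L\<close>, hence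
    \<open>D r\<close>. The maximum with 1 keeps \<open>L\<close> positive.\<close>
  define t where "t = min r (q / (N * L) / 2)"
  have t: "0 < t" "t \<le> r" using q assms N by (auto simp: t_def L_def)
  have "t ^ N \<le> t ^ 1" using t assms N by (intro power_decreasing) auto
  then have "inverse (t ^ N) \<ge> inverse t" using t by (intro le_imp_inverse_le) auto
  then have "(q / N) * inverse (t ^ N) \<ge> (q / N) * inverse t" using q by (intro mult_left_mono) auto
  moreover have "(q / N) * inverse t \<ge> 2 * L"
  proof -
    have "t \<le> q / (N * L) / 2" by (simp add: t_def)
    then show ?thesis using t N q by (simp add: L_def field_simps)
  qed
  moreover have "f t > 0" using f_pos t assms by auto
  moreover have "D t = f t + (q / N) * inverse (t ^ N)" by (simp add: D_def)
  moreover have "1 \<le> L" by (simp add: L_def)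
  ultimately have "D t > L" by linarith
  then show False using D_le[OF t] by (simp add: L_def)
qed

section \<open>Growth of the profile and its derivatives at the origin\<close>

lemma h'_le: "0 < r \<Longrightarrow> r < 1 \<Longrightarrow> h' r \<le> h r / r"
  using f'_nonpos[of r] by (simp add: f'_def divide_le_0_iff)

lemma f_nonneg: "0 < r \<Longrightarrow> r < 1 \<Longrightarrow> 0 \<le> f r"
  using h_pos[of r] by (simp add: f_def)

text \<open>Deliberately crude: only h < 1 enters. The bounds that follow lose one more power of r
  per derivative, and the factors of x in the fields to be integrated bring the singularity back to
  1/r^2.\<close>

lemma f_le: "0 < r \<Longrightarrow> r < 1 \<Longrightarrow> f r \<le> 1 / r"
  using h_lt_1[of r] by (simp add: f_def divide_right_mono)

lemma abs_f_le: "0 < r \<Longrightarrow> r < 1 \<Longrightarrow> \<bar>f r\<bar> \<le> 1 / r"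
  using f_le f_nonneg by simp

lemma abs_f'_le:
  assumes r: "0 < r" "r < 1" shows "\<bar>f' r\<bar> \<le> 1 / r\<^sup>2"
proof -
  have "\<bar>f' r\<bar> = (f r - h' r) / r"
    using f'_nonpos[OF r] by (simp add: f'_def f_def diff_divide_distrib)
  also have "\<dots> \<le> (1 / r) / r"
    using f_le[OF r] h'_nonneg[OF r] r by (intro divide_right_mono) auto
  finally show ?thesis by (simp add: power2_eq_square)
qed

lemma abs_f''_le:
  assumes r: "0 < r" "r < 1" shows "\<bar>f'' r\<bar> \<le> (M + real N + 1) / r ^ 3"
proof -
  have "\<bar>f'' r\<bar> \<le> \<bar>V r * f r\<bar> + \<bar>(real N + 1) / r * f' r\<bar>"
    unfolding f''_def minus_mult_left[symmetric]
    by (rule order_trans[OF abs_triangle_ineq4]) (simp only: abs_minus_cancel order_refl)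
  also have "\<bar>V r * f r\<bar> \<le> M * (1 / r)"
    unfolding abs_mult using V_nonneg[OF r] V_le[OF r] abs_f_le[OF r] r M_nonneg by (intro mult_mono) auto
  also have "\<bar>(real N + 1) / r * f' r\<bar> \<le> (real N + 1) / r * (1 / r\<^sup>2)"
    unfolding abs_mult using abs_f'_le[OF r] r by (intro mult_mono) auto
  also have "M * (1 / r) \<le> M * (1 / r ^ 3)"
  proof -
    have "r ^ 3 \<le> r ^ 1" using r by (intro power_decreasing) auto
    then show ?thesis using r M_nonneg by (intro mult_left_mono divide_left_mono) auto
  qed
  finally show ?thesis by (simp add: add_divide_distrib power3_eq_cube power2_eq_square)
qed

lemma abs_b_le:
  assumes r: "0 < r" "r < 1" shows "\<bar>b r\<bar> \<le> 1 / r ^ 3"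
proof -
  have "\<bar>f' r\<bar> / r \<le> (1 / r\<^sup>2) / r" using abs_f'_le[OF r] r by (intro divide_right_mono) auto
  then show ?thesis using r by (simp add: b_def power3_eq_cube power2_eq_square mult.assoc)
qed

lemma abs_b'_le:
  assumes r: "0 < r" "r < 1" shows "\<bar>b' r\<bar> \<le> (M + real N + 2) / r ^ 4"
proof -
  have "\<bar>b' r\<bar> = \<bar>f'' r - b r\<bar> / r" using r by (simp add: b'_def b_def)
  also have "\<dots> \<le> ((M + real N + 1) / r ^ 3 + 1 / r ^ 3) / r"
    using abs_f''_le[OF r] abs_b_le[OF r] r by (intro divide_right_mono) auto
  also have "\<dots> = (M + real N + 2) / r ^ 4" using r by (simp add: field_simps eval_nat_numeral)
  finally show ?thesis .
qed

definition a where "a = (real N - 2) / 2"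

text \<open>\<open>s(|x|) x\<close> is the logarithmic gradient of the supersolution \<open>h(|x|) |x|^(-a)\<close>;
  the exponent maximises \<open>a (N - 2 - a)\<close>, the constant in Hardy's inequality.\<close>
definition s where "s r = h' r / (h r * r) - a / r\<^sup>2"
definition s' where
  "s' r = (h'' r / h r - (h' r / h r)\<^sup>2) / r - h' r / (h r * r\<^sup>2) + 2 * a / r ^ 3"

lemma s_der:
  assumes r: "0 < r" "r < 1"
  shows "(s has_real_derivative s' r) (at r)"
proof -
  have hr: "h r \<noteq> 0" using h_pos[OF r] by simp
  show ?thesis
  unfolding s_def[abs_def] s'_def
    by (rule DERIV_cong[OF DERIV_diff[OF DERIV_divide[OF h'_der[OF r] DERIV_mult[OF h_der[OF r] DERIV_ident]]
            DERIV_divide[OF DERIV_const DERIV_pow]]])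
       (use r hr in \<open>auto simp: field_simps eval_nat_numeral\<close>)
qed

lemma continuous_on_s': "continuous_on {0<..<1} s'"
proof -
  have "continuous_on {0<..<1} (\<lambda>r. - V r * h r - (real N - 1) * f' r)"
    by (intro continuous_intros V_cont continuous_on_h continuous_on_f')
  then have c: "continuous_on {0<..<1} h''"
    by (rule continuous_on_eq) (auto simp: h''_eq)
  have "h r \<noteq> 0" if "r \<in> {0<..<1}" for r using h_pos[of r] that by auto
  then show ?thesis unfolding s'_def[abs_def]
    by (intro continuous_intros c continuous_on_h continuous_on_h') auto
qed

text \<open>The upper bound on the logarithmic derivative of \<open>h\<close> is the monotonicity of
  h / r.\<close>

lemma k_bounds:
  assumes r: "0 < r" "r < 1" shows "0 \<le> h' r / h r" "h' r / h r \<le> 1 / r"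
  using h'_nonneg[OF r] h'_le[OF r] h_pos[OF r] r by (auto simp: field_simps)

lemma a_nonneg: "0 \<le> a" using N by (simp add: a_def)

lemma abs_s_le:
  assumes r: "0 < r" "r < 1" shows "\<bar>s r\<bar> \<le> (1 + a) / r\<^sup>2"
proof -
  have e: "h' r / (h r * r) = (h' r / h r) / r" by simp
  have "0 \<le> (h' r / h r) / r" "(h' r / h r) / r \<le> (1 / r) / r"
    using k_bounds[OF r] r by (auto intro!: divide_right_mono simp del: divide_divide_eq_left)
  moreover have "0 \<le> a / r\<^sup>2" using a_nonneg by simp
  moreover have "(1 + a) / r\<^sup>2 = (1 / r) / r + a / r\<^sup>2" by (simp add: add_divide_distrib power2_eq_square)
  moreover have "0 \<le> (1 / r) / r" using r by simp
  ultimately show ?thesis unfolding s_def e by linarith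
qed

lemma h''_div:
  assumes r: "0 < r" "r < 1"
  shows "h'' r / h r = - V r - (real N - 1) * (h' r / h r) / r + (real N - 1) / r\<^sup>2"
  using h_pos[OF r] r unfolding h''_eq[OF r] f'_def by (simp add: field_simps power2_eq_square)

lemma abs_s'_le:
  assumes r: "0 < r" "r < 1" shows "\<bar>s' r\<bar> \<le> (M + 2 * real N + 2 * a) / r ^ 3"
proof -
  define k where "k = h' r / h r"
  have k: "0 \<le> k" "k \<le> 1 / r" using k_bounds[OF r] by (auto simp: k_def)
  have r2: "1 \<le> 1 / r\<^sup>2" using r by (simp add: power_le_one)
  have kr: "0 \<le> k / r" "k / r \<le> 1 / r\<^sup>2"
    using k r divide_right_mono[OF k(2), of r] by (auto simp: power2_eq_square)
  have k2: "0 \<le> k\<^sup>2" "k\<^sup>2 \<le> 1 / r\<^sup>2" using power_mono[OF k(2) k(1), of 2] by (auto simp: power_divide)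
  have VM: "0 \<le> V r" "V r \<le> M * (1 / r\<^sup>2)"
    using V_nonneg[OF r] V_le[OF r] mult_left_mono[OF r2 M_nonneg] by auto
  have ar: "0 \<le> a * (1 / r\<^sup>2)" using a_nonneg by simp
  have N1: "0 \<le> real N - 1" using N by simp
  have Nk: "0 \<le> (real N - 1) * (k / r)" "(real N - 1) * (k / r) \<le> (real N - 1) * (1 / r\<^sup>2)"
    using mult_nonneg_nonneg[OF N1 kr(1)] mult_left_mono[OF kr(2) N1] by auto
  have "s' r = ((- V r - (real N - 1) * (k / r) + (real N - 1) * (1 / r\<^sup>2) - k\<^sup>2) - k / r + 2 * (a * (1 / r\<^sup>2))) / r"
    unfolding s'_def h''_div[OF r] k_def using r h_pos[OF r] by (simp add: field_simps eval_nat_numeral)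
  then have "\<bar>s' r\<bar> = \<bar>(- V r - (real N - 1) * (k / r) + (real N - 1) * (1 / r\<^sup>2) - k\<^sup>2) - k / r + 2 * (a * (1 / r\<^sup>2))\<bar> / r"
    using r by simp
  also have "\<dots> \<le> ((M + 2 * real N + 2 * a) * (1 / r\<^sup>2)) / r"
  proof (rule divide_right_mono)
    have nn: "0 \<le> real N * (1 / r\<^sup>2)" by simp
    show "\<bar>(- V r - (real N - 1) * (k / r) + (real N - 1) * (1 / r\<^sup>2) - k\<^sup>2) - k / r + 2 * (a * (1 / r\<^sup>2))\<bar>
       \<le> (M + 2 * real N + 2 * a) * (1 / r\<^sup>2)"
      using VM Nk k2 kr ar r2 nn unfolding ring_distribs mult.assoc left_diff_distrib by linarith
  qed (use r in auto)
  also have "\<dots> = (M + 2 * real N + 2 * a) / r ^ 3" by (simp add: power3_eq_cube power2_eq_square mult.assoc)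
  finally show ?thesis .
qed

text \<open>For the field F(x) = s(|x|) x = Dw / w one has div F = N s + r s' and |F|^2 = r^2 s^2,
  so the right-hand side is - Laplace w / w. Inserting the equation for \<open>h\<close> leaves
  \<open>V r\<close>, the nonnegative term \<open>2 * a * (k / r)\<close>, and a constant multiple
  of 1/r^2.\<close>

lemma s_supersolution:
  assumes r: "0 < r" "r < 1"
  shows "V r + 1/4 \<le> - (real N * s r + r * s' r + r\<^sup>2 * (s r)\<^sup>2)"
proof -
  define k where "k = h' r / h r"
  have k: "0 \<le> k" using k_bounds[OF r] by (auto simp: k_def)
  have hr: "h r \<noteq> 0" using h_pos[OF r] by simp
  have e1: "s r = k / r - a / r\<^sup>2" by (simp add: s_def k_def)
  have e2: "r * s' r = (- V r - (real N - 1) * k / r + (real N - 1) / r\<^sup>2) - k\<^sup>2 - k / r + 2 * a / r\<^sup>2"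
    unfolding s'_def h''_div[OF r] k_def[symmetric] using r hr
    by (simp add: k_def field_simps eval_nat_numeral)
  have "- (real N * s r + r * s' r + r\<^sup>2 * (s r)\<^sup>2)
      = V r + 2 * a * (k / r) + (a * (real N - 2 - a) - (real N - 1)) * (1 / r\<^sup>2)"
    unfolding e1 e2 using r by (simp add: field_simps eval_nat_numeral)
  moreover have "0 \<le> 2 * a * (k / r)" using a_nonneg k r by simp
  moreover have "1/4 \<le> (a * (real N - 2 - a) - (real N - 1)) * (1 / r\<^sup>2)"
  proof -
    \<comment> \<open>For a = (N - 2)/2 the constant exceeds 1/4 by exactly (N - 7) (N - 1) / 4. The
      factor 1/r^2, at least 1 in the unit ball, can then be dropped.\<close>
    have "(real N - 7) * (real N - 1) \<ge> 0" using N by simp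
    then have "1/4 \<le> a * (real N - 2 - a) - (real N - 1)" by (simp add: a_def field_simps)
    moreover have "1 \<le> 1 / r\<^sup>2" using r by (simp add: power_le_one)
    ultimately have "1/4 * 1 \<le> (a * (real N - 2 - a) - (real N - 1)) * (1 / r\<^sup>2)"
      by (intro mult_mono) auto
    then show ?thesis by simp
  qed
  ultimately show ?thesis by linarith
qed

end

section \<open>First and second variation on test functions\<close>

lemma integral_modify_at_point:
  fixes g G :: "'a::euclidean_space \<Rightarrow> 'b::euclidean_space"
  assumes int: "integrable (lebesgue_on S) g" and S: "S \<in> sets borel"
    and eq: "\<And>x. x \<in> S \<Longrightarrow> x \<noteq> a \<Longrightarrow> G x = g x"
  shows "integrable (lebesgue_on S) G" "(\<integral>x. G x \<partial>lebesgue_on S) = (\<integral>x. g x \<partial>lebesgue_on S)"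
proof -
  have mG: "G \<in> borel_measurable (lebesgue_on S)"
    by (rule measurable_modify_at_point[OF borel_measurable_integrable[OF int] S eq])
  have ae: "AE x in lebesgue_on S. g x = G x"
    using AE_lebesgue_on_neq[OF S, of a] AE_space by eventually_elim (use eq in auto)
  show "integrable (lebesgue_on S) G"
    by (rule integrable_cong_AE_imp[OF int mG]) (use ae in eventually_elim, simp)
  show "(\<integral>x. G x \<partial>lebesgue_on S) = (\<integral>x. g x \<partial>lebesgue_on S)"
    by (rule integral_cong_AE[OF mG borel_measurable_integrable[OF int]]) (use ae in eventually_elim, simp)
qed

lemma borel_measurable_lebesgue_on_punctured:
  fixes F :: "'a::euclidean_space \<Rightarrow> 'b::euclidean_space"
  assumes c: "continuous_on (S - {a}) F" and S: "open S"
  shows "F \<in> borel_measurable (lebesgue_on S)"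
proof (rule measurable_modify_at_point[where a=a])
  have "(\<lambda>x. indicator (S - {a}) x *\<^sub>R F x) \<in> borel_measurable borel"
    using borel_measurable_continuous_on_indicator[OF _ c] S by auto
  then show "(\<lambda>x. indicator (S - {a}) x *\<^sub>R F x) \<in> borel_measurable (lebesgue_on S)"
    by (intro measurable_restrict_space1 measurable_completion) auto
qed (use S in auto)

lemma integrable_inverse_square_singularity:
  fixes F :: "'a::euclidean_space \<Rightarrow> 'b::euclidean_space"
  assumes dim: "DIM('a) \<ge> 3" and c: "continuous_on (ball 0 1 - {0}) F"
    and bd: "\<And>x. 0 < norm x \<Longrightarrow> norm x < 1 \<Longrightarrow> norm (F x) \<le> C / (norm x)\<^sup>2"
  shows "integrable (lebesgue_on (ball 0 1)) F"
proof (rule Bochner_Integration.integrable_bound[OF integrable_lebesgue_on_inverse_square[OF dim, of C]])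
  show "F \<in> borel_measurable (lebesgue_on (ball 0 1))"
    by (rule borel_measurable_lebesgue_on_punctured[OF c open_ball])
  show "AE x in lebesgue_on (ball 0 1). norm (F x) \<le> norm (C / (norm x)\<^sup>2)"
    using AE_lebesgue_on_neq[of "ball 0 1" "0::'a", simplified] AE_space
  proof eventually_elim
    fix x :: 'a assume "x \<noteq> 0" "x \<in> space (lebesgue_on (ball 0 1))"
    then have "norm (F x) \<le> C / (norm x)\<^sup>2" by (intro bd) auto
    then show "norm (F x) \<le> norm (C / (norm x)\<^sup>2)" by (metis abs_ge_self order_trans real_norm_def)
  qed
qed

lemma continuous_on_radial:
  assumes "continuous_on {0<..<1} q"
  shows "continuous_on (ball (0::'a::euclidean_space) 1 - {0}) (\<lambda>x. q (norm x))"
  by (rule continuous_on_compose2[OF assms continuous_on_norm_id]) auto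

lemma has_vector_derivative_coordinate_mult:
  fixes g :: "real \<Rightarrow> real" and x :: "'a::euclidean_space"
  assumes i: "i \<in> Basis" and g: "(g has_vector_derivative g') (at 0)"
  shows "((\<lambda>t. ((x + t *\<^sub>R i) \<bullet> i) * g t) has_vector_derivative (g 0 + (x \<bullet> i) * g')) (at 0)"
proof -
  have "((\<lambda>t. x \<bullet> i + t) has_vector_derivative 1) (at 0)"
    by (auto intro!: derivative_eq_intros)
  moreover have "(\<lambda>t. (x + t *\<^sub>R i) \<bullet> i) = (\<lambda>t. x \<bullet> i + t)" using i by (simp add: inner_add_left)
  ultimately have "((\<lambda>t. (x + t *\<^sub>R i) \<bullet> i) has_vector_derivative 1) (at 0)" by simp
  from has_vector_derivative_mult[OF this g] show ?thesis by (simp add: add.commute)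
qed

lemma le_inverse_square:
  assumes "0 < r" "r < (1::real)" "0 \<le> C"
  shows "C \<le> C / r\<^sup>2" "C / r \<le> C / r\<^sup>2"
proof -
  have "r\<^sup>2 \<le> 1" using assms by (simp add: power_le_one)
  then show "C \<le> C / r\<^sup>2" using assms mult_left_mono[of "r\<^sup>2" 1 C] by (simp add: le_divide_eq)
  have "r\<^sup>2 \<le> r" using assms by (simp add: power2_eq_square mult_left_le)
  then show "C / r \<le> C / r\<^sup>2" using assms by (intro divide_left_mono) auto
qed

lemma Basis_sum_inner:
  fixes x y :: "'a::euclidean_space"
  shows "(\<Sum>i\<in>Basis. (x \<bullet> i) * (i \<bullet> y)) = x \<bullet> y"
  by (simp add: euclidean_inner[of x y] inner_commute)

lemma Basis_sum_square:
  fixes x :: "'a::euclidean_space"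
  shows "(\<Sum>i\<in>Basis. (x \<bullet> i)\<^sup>2) = (norm x)\<^sup>2"
  using Basis_sum_inner[of x x] by (simp add: power2_eq_square inner_commute dot_square_norm)

context radial_profile
begin

definition u_rad :: "'a::euclidean_space \<Rightarrow> 'a \<times> 'c::euclidean_space" where
  "u_rad x = (f (norm x) *\<^sub>R x, 0)"

definition Du_rad :: "'a::euclidean_space \<Rightarrow> 'a \<Rightarrow> 'a \<times> 'c::euclidean_space" where
  "Du_rad x i = (f (norm x) *\<^sub>R i + (b (norm x) * (x \<bullet> i)) *\<^sub>R x, 0)"

lemma u_rad_eq: "u_rad x = (h (norm x) *\<^sub>R sgn x, 0)"
  by (simp add: u_rad_def f_def sgn_div_norm divide_inverse)

lemma norm_u_rad: "norm x < 1 \<Longrightarrow> norm (u_rad x) = h (norm x)"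
  using h_pos[of "norm x"] by (cases "x = 0") (auto simp: u_rad_def f_def norm_Pair h_0)

text \<open>The integrand is the divergence of the field with components
  \<open>Du_rad x i \<bullet> \<phi> x\<close>: derivatives falling on \<open>Du_rad\<close> produce
  the Laplacian of \<open>u_rad\<close>, which is \<open>- V\<close> times \<open>u_rad\<close>.
  Each component is split into a part with coefficient \<open>f\<close> and a part with coefficient
  \<open>b\<close>, whose singularities differ. Only the first component of \<phi>
  contributes.\<close>

lemma euler_lagrange_test:
  fixes \<phi> :: "'a::euclidean_space \<Rightarrow> 'a \<times> 'c::euclidean_space"
  assumes dim: "DIM('a) = N" and \<phi>: "test_fun (ball 0 1) \<phi>"
  shows "(\<integral>x. (\<Sum>i\<in>Basis. Du_rad x i \<bullet> frechet_derivative \<phi> (at x) i)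
             - V (norm x) * (u_rad x \<bullet> \<phi> x) \<partial>lebesgue_on (ball 0 1)) = 0"
proof -
  obtain K C where K: "compact K" "K \<subseteq> ball 0 1" "\<And>x. x \<notin> K \<Longrightarrow> \<phi> x = 0"
    "\<And>x i. x \<notin> K \<Longrightarrow> frechet_derivative \<phi> (at x) i = 0"
    and der: "\<And>x. (\<phi> has_derivative frechet_derivative \<phi> (at x)) (at x)"
    and cont: "\<And>i. i \<in> Basis \<Longrightarrow> continuous_on UNIV (\<lambda>x. frechet_derivative \<phi> (at x) i)"
    and C0: "0 \<le> C" and C: "\<And>x. norm (\<phi> x) \<le> C" "\<And>x i. i \<in> Basis \<Longrightarrow> norm (frechet_derivative \<phi> (at x) i) \<le> C"
    using test_funE[OF \<phi> open_ball] by metis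
  have dim3: "DIM('a) \<ge> 3" using dim N by simp
  define p where "p x = fst (\<phi> x)" for x
  define dp where "dp x i = fst (frechet_derivative \<phi> (at x) i)" for x i
  have cphi: "continuous_on UNIV \<phi>"
    by (intro continuous_at_imp_continuous_on ballI) (use der has_derivative_continuous in blast)
  have cp: "continuous_on UNIV p" unfolding p_def by (intro continuous_intros cphi)
  have cdp: "continuous_on UNIV (\<lambda>x. dp x i)" if "i \<in> Basis" for i
    unfolding dp_def by (intro continuous_intros cont that)
  have dpl: "((\<lambda>t. p (x + t *\<^sub>R i)) has_vector_derivative dp x i) (at 0)" for x i
    unfolding p_def dp_def
    by (rule has_derivative_imp_has_vector_derivative_line[where f="\<lambda>x. fst (\<phi> x)" and f'="\<lambda>h. fst (frechet_derivative \<phi> (at x) h)"])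
       (rule has_derivative_fst[OF der])
  have pC: "norm (p x) \<le> C" for x using C(1)[of x] norm_fst_le[of "fst (\<phi> x)" "snd (\<phi> x)"] by (simp add: p_def)
  have dpC: "norm (dp x i) \<le> C" if "i \<in> Basis" for x i
    using C(2)[OF that, of x]
      norm_fst_le[of "fst (frechet_derivative \<phi> (at x) i)" "snd (frechet_derivative \<phi> (at x) i)"]
    by (simp add: dp_def)
  have p0: "p x = 0" if "x \<notin> K" for x using K(3) that by (simp add: p_def)
  have ip: "\<bar>i \<bullet> y\<bar> \<le> norm y" if "i \<in> Basis" for i y :: 'a using Basis_le_norm[OF that, of y] by (simp add: inner_commute)
  \<comment> \<open>\<open>b\<close> and \<open>b'\<close> are controlled by r^(-3) and r^(-4). Here
    \<psi> is of order |x|^2 and its derivative of order |x|, so both products are of order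
    r^(-2).\<close>
  define \<psi> where "\<psi> i x = (x \<bullet> i) * (x \<bullet> p x)" for i x
  define \<psi>' where "\<psi>' i x = (x \<bullet> p x) + (x \<bullet> i) * (i \<bullet> p x + x \<bullet> dp x i)" for i x
  have xp: "\<bar>x \<bullet> p x\<bar> \<le> norm x * C" for x
    using Cauchy_Schwarz_ineq2[of x "p x"] mult_left_mono[OF pC norm_ge_zero, of x] by (rule order_trans)
  have \<psi>_le: "\<bar>\<psi> i x\<bar> \<le> (norm x)\<^sup>2 * C" if "i \<in> Basis" for i x
    unfolding \<psi>_def abs_mult power2_eq_square mult.assoc
    by (intro mult_mono xp Basis_le_norm that) auto
  have \<psi>'_le: "\<bar>\<psi>' i x\<bar> \<le> 3 * C * norm x" if i: "i \<in> Basis" and x: "norm x < 1" for i x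
  proof -
    have "\<bar>x \<bullet> dp x i\<bar> \<le> norm x * norm (dp x i)" by (rule Cauchy_Schwarz_ineq2)
    also have "\<dots> \<le> 1 * C" using x dpC[OF i, of x] by (intro mult_mono) auto
    finally have "\<bar>i \<bullet> p x + x \<bullet> dp x i\<bar> \<le> C + C"
      using ip[OF i, of "p x"] pC[of x] by linarith
    then have "\<bar>(x \<bullet> i) * (i \<bullet> p x + x \<bullet> dp x i)\<bar> \<le> norm x * (C + C)"
      unfolding abs_mult by (intro mult_mono Basis_le_norm i) auto
    then show ?thesis using xp[of x] unfolding \<psi>'_def by (simp add: algebra_simps)
  qed
  define T1 where "T1 i x = f (norm x) *\<^sub>R (i \<bullet> dp x i) + (f' (norm x) * (x \<bullet> i) / norm x) *\<^sub>R (i \<bullet> p x)" for i x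
  define T2 where "T2 i x = b (norm x) *\<^sub>R \<psi>' i x + (b' (norm x) * (x \<bullet> i) / norm x) *\<^sub>R \<psi> i x" for i x
  have T1: "has_bochner_integral (lebesgue_on (ball 0 1)) (T1 i) 0"
    if i: "i \<in> Basis" for i
    unfolding T1_def
  proof (rule radial_integral_by_parts[OF i dim3 f_der continuous_on_f', where C=C and K=K])
    show "((\<lambda>t. i \<bullet> p (x + t *\<^sub>R i)) has_vector_derivative i \<bullet> dp x i) (at 0)" for x
      by (rule bounded_linear.has_vector_derivative[OF bounded_linear_inner_right dpl])
    show "continuous_on UNIV (\<lambda>x. i \<bullet> p x)" "continuous_on UNIV (\<lambda>x. i \<bullet> dp x i)"
      by (intro continuous_intros cp cdp i)+
    show "norm (f (norm x) *\<^sub>R (i \<bullet> dp x i)) \<le> C / (norm x)\<^sup>2" if x: "0 < norm x" "norm x < 1" for x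
    proof -
      have "\<bar>f (norm x)\<bar> * \<bar>i \<bullet> dp x i\<bar> \<le> (1 / norm x) * C"
        using abs_f_le[OF x] ip[OF i, of "dp x i"] dpC[OF i, of x] x by (intro mult_mono) auto
      then show ?thesis using le_inverse_square(2)[OF x C0] by (simp add: abs_mult)
    qed
    show "norm (f' (norm x) *\<^sub>R (i \<bullet> p x)) \<le> C / (norm x)\<^sup>2" if x: "0 < norm x" "norm x < 1" for x
    proof -
      have "\<bar>f' (norm x)\<bar> * \<bar>i \<bullet> p x\<bar> \<le> (1 / (norm x)\<^sup>2) * C"
        using abs_f'_le[OF x] ip[OF i, of "p x"] pC[of x] x by (intro mult_mono) auto
      then show ?thesis by (simp add: abs_mult)
    qed
  qed (use K p0 in auto)
  define C2 where "C2 = max (3 * C) ((M + real N + 2) * C)"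
  have T2: "has_bochner_integral (lebesgue_on (ball 0 1)) (T2 i) 0"
    if i: "i \<in> Basis" for i
    unfolding T2_def
  proof (rule radial_integral_by_parts[OF i dim3 b_der continuous_on_b', where C=C2 and K=K])
    show "((\<lambda>t. \<psi> i (x + t *\<^sub>R i)) has_vector_derivative \<psi>' i x) (at 0)" for x
    proof -
      have "((\<lambda>t. (x + t *\<^sub>R i) \<bullet> p (x + t *\<^sub>R i)) has_vector_derivative
            ((x + 0 *\<^sub>R i) \<bullet> dp x i + i \<bullet> p (x + 0 *\<^sub>R i))) (at 0)"
        by (rule bounded_bilinear.has_vector_derivative[OF bounded_bilinear_inner _ dpl])
           (auto intro!: derivative_eq_intros)
      from has_vector_derivative_coordinate_mult[OF i this, of x] show ?thesis
        by (simp add: \<psi>_def \<psi>'_def add.commute)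
    qed
    show "continuous_on UNIV (\<lambda>x. \<psi> i x)" "continuous_on UNIV (\<lambda>x. \<psi>' i x)"
      unfolding \<psi>_def \<psi>'_def by (intro continuous_intros cp cdp i)+
    show "norm (b (norm x) *\<^sub>R \<psi>' i x) \<le> C2 / (norm x)\<^sup>2" if x: "0 < norm x" "norm x < 1" for x
    proof -
      have "\<bar>b (norm x)\<bar> * \<bar>\<psi>' i x\<bar> \<le> (1 / norm x ^ 3) * (3 * C * norm x)"
        using abs_b_le[OF x] \<psi>'_le[OF i x(2)] x by (intro mult_mono) auto
      also have "\<dots> = 3 * C / (norm x)\<^sup>2" using x by (simp add: power3_eq_cube power2_eq_square)
      also have "\<dots> \<le> C2 / (norm x)\<^sup>2" by (intro divide_right_mono) (auto simp: C2_def)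
      finally show ?thesis by (simp add: abs_mult)
    qed
    show "norm (b' (norm x) *\<^sub>R \<psi> i x) \<le> C2 / (norm x)\<^sup>2" if x: "0 < norm x" "norm x < 1" for x
    proof -
      have "\<bar>b' (norm x)\<bar> * \<bar>\<psi> i x\<bar> \<le> ((M + real N + 2) / norm x ^ 4) * ((norm x)\<^sup>2 * C)"
        using abs_b'_le[OF x] \<psi>_le[OF i, of x] x M_nonneg by (intro mult_mono) auto
      also have "\<dots> = (M + real N + 2) * C / (norm x)\<^sup>2" using x by (simp add: eval_nat_numeral)
      also have "\<dots> \<le> C2 / (norm x)\<^sup>2" by (intro divide_right_mono) (auto simp: C2_def)
      finally show ?thesis by (simp add: abs_mult)
    qed
  qed (use K p0 in \<open>auto simp: \<psi>_def\<close>)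
  have "has_bochner_integral (lebesgue_on (ball 0 1)) (\<lambda>x. \<Sum>i\<in>Basis. T1 i x + T2 i x) (\<Sum>i\<in>(Basis::'a set). 0 + 0)"
    by (intro has_bochner_integral_sum has_bochner_integral_add T1 T2)
  then have int: "integrable (lebesgue_on (ball 0 1)) (\<lambda>x. \<Sum>i\<in>Basis. T1 i x + T2 i x)"
    and zero: "(\<integral>x. (\<Sum>i\<in>Basis. T1 i x + T2 i x) \<partial>lebesgue_on (ball 0 1)) = 0"
    by (simp_all add: has_bochner_integral_iff)
  have eq: "(\<Sum>i\<in>Basis. Du_rad x i \<bullet> frechet_derivative \<phi> (at x) i) - V (norm x) * (u_rad x \<bullet> \<phi> x)
      = (\<Sum>i\<in>Basis. T1 i x + T2 i x)" if x: "x \<in> ball 0 1" "x \<noteq> 0" for x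
  proof -
    define r where "r = norm x"
    have r: "0 < r" "r < 1" using x by (auto simp: r_def)
    have "(\<Sum>i\<in>Basis. T1 i x + T2 i x)
       = (\<Sum>i\<in>Basis. (f r * (i \<bullet> dp x i) + b r * ((x \<bullet> i) * (x \<bullet> dp x i)))
            + (f' r / r * ((x \<bullet> i) * (i \<bullet> p x)) + b r * ((x \<bullet> i) * (i \<bullet> p x)) + b r * (x \<bullet> p x) + b' r / r * (x \<bullet> p x) * (x \<bullet> i)\<^sup>2))"
      by (intro sum.cong refl) (simp add: T1_def T2_def \<psi>_def \<psi>'_def r_def field_simps power2_eq_square)
    also have "\<dots> = (\<Sum>i\<in>Basis. f r * (i \<bullet> dp x i) + b r * ((x \<bullet> i) * (x \<bullet> dp x i)))
        + (f' r / r * (x \<bullet> p x) + b r * (x \<bullet> p x) + N * (b r * (x \<bullet> p x)) + b' r / r * (x \<bullet> p x) * r\<^sup>2)"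
      by (simp only: sum.distrib sum_distrib_left[symmetric] Basis_sum_inner Basis_sum_square sum_constant dim r_def)
         (simp add: ac_simps)
    \<comment> \<open>The coefficients of \<open>x \<bullet> p x\<close> add up to
      \<open>f'' + (N + 1) / r * f'\<close>, which is \<open>- V * f\<close>.\<close>
    also have "f' r / r * (x \<bullet> p x) + b r * (x \<bullet> p x) + N * (b r * (x \<bullet> p x)) + b' r / r * (x \<bullet> p x) * r\<^sup>2
       = - (V r * f r * (x \<bullet> p x))"
      using r by (simp add: b_def b'_def f''_def field_simps power2_eq_square)
    finally show ?thesis
      by (simp add: Du_rad_def u_rad_def dp_def p_def r_def inner_prod_def inner_add_left mult.assoc)
  qed
  show ?thesis
    using integral_modify_at_point(2)[OF int _ eq] zero by simp
qed

text \<open>The square |D\<phi> - \<phi> Dw / w|^2 is nonnegative, and its cross term is, up to the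
  divergence of s(|x|) |\<phi>|^2 x, a multiple of |\<phi>|^2 that \<open>s_supersolution\<close>
  controls. The divergence integrates to 0 because \<phi> has compact support and the field is only
  mildly singular at the origin.\<close>

lemma hardy_test:
  fixes \<phi> :: "'a::euclidean_space \<Rightarrow> 'b::euclidean_space"
  assumes dim: "DIM('a) = N" and \<phi>: "test_fun (ball 0 1) \<phi>"
  shows "0 \<le> (\<integral>x. (\<Sum>i\<in>Basis. (norm (frechet_derivative \<phi> (at x) i))\<^sup>2)
             - (V (norm x) + 1/4) * (norm (\<phi> x))\<^sup>2 \<partial>lebesgue_on (ball 0 1))"
proof -
  obtain K C where K: "compact K" "K \<subseteq> ball 0 1" "\<And>x. x \<notin> K \<Longrightarrow> \<phi> x = 0"
    "\<And>x i. x \<notin> K \<Longrightarrow> frechet_derivative \<phi> (at x) i = 0"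
    and der: "\<And>x. (\<phi> has_derivative frechet_derivative \<phi> (at x)) (at x)"
    and cont: "\<And>i. i \<in> Basis \<Longrightarrow> continuous_on UNIV (\<lambda>x. frechet_derivative \<phi> (at x) i)"
    and C0: "0 \<le> C" and C: "\<And>x. norm (\<phi> x) \<le> C" "\<And>x i. i \<in> Basis \<Longrightarrow> norm (frechet_derivative \<phi> (at x) i) \<le> C"
    using test_funE[OF \<phi> open_ball] by metis
  have dim3: "DIM('a) \<ge> 3" using dim N by simp
  define d where "d x i = frechet_derivative \<phi> (at x) i" for x i
  have cphi: "continuous_on UNIV \<phi>"
    by (intro continuous_at_imp_continuous_on ballI) (use der has_derivative_continuous in blast)
  have cd: "continuous_on UNIV (\<lambda>x. d x i)" if "i \<in> Basis" for i
    unfolding d_def by (intro cont that)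
  have dC: "norm (d x i) \<le> C" if "i \<in> Basis" for x i using C(2)[OF that] by (simp add: d_def)
  have dl: "((\<lambda>t. \<phi> (x + t *\<^sub>R i)) has_vector_derivative d x i) (at 0)" for x i
    unfolding d_def by (rule has_derivative_imp_has_vector_derivative_line[OF der])
  define \<psi> where "\<psi> i x = (x \<bullet> i) * (\<phi> x \<bullet> \<phi> x)" for i x
  define \<psi>' where "\<psi>' i x = \<phi> x \<bullet> \<phi> x + (x \<bullet> i) * (2 * (\<phi> x \<bullet> d x i))" for i x
  have pp: "\<bar>\<phi> x \<bullet> \<phi> x\<bar> \<le> C\<^sup>2" for x
    using power_mono[OF C(1)[of x] norm_ge_zero, of 2] by (simp add: dot_square_norm)
  have \<psi>_le: "\<bar>\<psi> i x\<bar> \<le> norm x * C\<^sup>2" if "i \<in> Basis" for i x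
    unfolding \<psi>_def abs_mult by (intro mult_mono pp[unfolded abs_mult] Basis_le_norm that) auto
  have \<psi>'_le: "\<bar>\<psi>' i x\<bar> \<le> 3 * C\<^sup>2" if i: "i \<in> Basis" and x: "norm x < 1" for i x
  proof -
    have "\<bar>\<phi> x \<bullet> d x i\<bar> \<le> norm (\<phi> x) * norm (d x i)" by (rule Cauchy_Schwarz_ineq2)
    also have "\<dots> \<le> C * C" using C(1) dC[OF i] C0 by (intro mult_mono) auto
    finally have "\<bar>2 * (\<phi> x \<bullet> d x i)\<bar> \<le> 2 * C\<^sup>2" by (simp add: power2_eq_square)
    then have "\<bar>(x \<bullet> i) * (2 * (\<phi> x \<bullet> d x i))\<bar> \<le> 1 * (2 * C\<^sup>2)"
      using Basis_le_norm[OF i, of x] x unfolding abs_mult[of "x \<bullet> i"] by (intro mult_mono) auto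
    then show ?thesis using pp[of x] unfolding \<psi>'_def by linarith
  qed
  define T where "T i x = s (norm x) *\<^sub>R \<psi>' i x + (s' (norm x) * (x \<bullet> i) / norm x) *\<^sub>R \<psi> i x" for i x
  define C2 where "C2 = max ((1 + a) * (3 * C\<^sup>2)) ((M + 2 * real N + 2 * a) * C\<^sup>2)"
  have T: "has_bochner_integral (lebesgue_on (ball 0 1)) (T i) 0"
    if i: "i \<in> Basis" for i
    unfolding T_def
  proof (rule radial_integral_by_parts[OF i dim3 s_der continuous_on_s', where C=C2 and K=K])
    show "((\<lambda>t. \<psi> i (x + t *\<^sub>R i)) has_vector_derivative \<psi>' i x) (at 0)" for x
    proof -
      have "((\<lambda>t. \<phi> (x + t *\<^sub>R i) \<bullet> \<phi> (x + t *\<^sub>R i)) has_vector_derivative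
            (\<phi> (x + 0 *\<^sub>R i) \<bullet> d x i + d x i \<bullet> \<phi> (x + 0 *\<^sub>R i))) (at 0)"
        by (rule bounded_bilinear.has_vector_derivative[OF bounded_bilinear_inner dl dl])
      from has_vector_derivative_coordinate_mult[OF i this, of x] show ?thesis
        by (simp add: \<psi>_def \<psi>'_def inner_commute)
    qed
    show "continuous_on UNIV (\<lambda>x. \<psi> i x)" "continuous_on UNIV (\<lambda>x. \<psi>' i x)"
      unfolding \<psi>_def \<psi>'_def by (intro continuous_intros cphi cd i)+
    show "norm (s (norm x) *\<^sub>R \<psi>' i x) \<le> C2 / (norm x)\<^sup>2" if x: "0 < norm x" "norm x < 1" for x
    proof -
      have "\<bar>s (norm x)\<bar> * \<bar>\<psi>' i x\<bar> \<le> ((1 + a) / (norm x)\<^sup>2) * (3 * C\<^sup>2)"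
        using abs_s_le[OF x] \<psi>'_le[OF i x(2)] x a_nonneg by (intro mult_mono) auto
      also have "\<dots> = (1 + a) * (3 * C\<^sup>2) / (norm x)\<^sup>2" by simp
      also have "\<dots> \<le> C2 / (norm x)\<^sup>2" by (intro divide_right_mono) (auto simp: C2_def)
      finally show ?thesis by (simp add: abs_mult)
    qed
    show "norm (s' (norm x) *\<^sub>R \<psi> i x) \<le> C2 / (norm x)\<^sup>2" if x: "0 < norm x" "norm x < 1" for x
    proof -
      have "\<bar>s' (norm x)\<bar> * \<bar>\<psi> i x\<bar> \<le> ((M + 2 * real N + 2 * a) / norm x ^ 3) * (norm x * C\<^sup>2)"
        using abs_s'_le[OF x] \<psi>_le[OF i, of x] x M_nonneg a_nonneg by (intro mult_mono) auto
      also have "\<dots> = (M + 2 * real N + 2 * a) * C\<^sup>2 / (norm x)\<^sup>2" using x by (simp add: eval_nat_numeral)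
      also have "\<dots> \<le> C2 / (norm x)\<^sup>2" by (intro divide_right_mono) (auto simp: C2_def)
      finally show ?thesis by (simp add: abs_mult)
    qed
  qed (use K in \<open>auto simp: \<psi>_def\<close>)
  have "has_bochner_integral (lebesgue_on (ball 0 1)) (\<lambda>x. \<Sum>i\<in>Basis. T i x) (\<Sum>i\<in>(Basis::'a set). 0)"
    by (intro has_bochner_integral_sum T)
  then have int: "integrable (lebesgue_on (ball 0 1)) (\<lambda>x. \<Sum>i\<in>Basis. T i x)"
    and zero: "(\<integral>x. (\<Sum>i\<in>Basis. T i x) \<partial>lebesgue_on (ball 0 1)) = 0"
    by (simp_all add: has_bochner_integral_iff)
  define G where "G x = (\<Sum>i\<in>Basis. (norm (d x i))\<^sup>2) - (V (norm x) + 1/4) * (norm (\<phi> x))\<^sup>2" for x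
  have le: "(\<Sum>i\<in>Basis. T i x) \<le> G x" if x: "x \<in> ball 0 1" "x \<noteq> 0" for x
  proof -
    define r where "r = norm x"
    have r: "0 < r" "r < 1" using x by (auto simp: r_def)
    \<comment> \<open>Here \<open>s r * (x \<bullet> i)\<close> is the i-th component of Dw / w. The
      cross term equals \<open>- T i x\<close> plus the terms in which the derivative falls on the
      radial field; summed over \<open>i\<close>, these and the last square give N s + r s' + r^2
      s^2.\<close>
    have "0 \<le> (\<Sum>i\<in>Basis. (norm (d x i - (s r * (x \<bullet> i)) *\<^sub>R \<phi> x))\<^sup>2)" by (intro sum_nonneg) auto
    also have "\<dots> = (\<Sum>i\<in>Basis. (norm (d x i))\<^sup>2 - T i x
        + (s r * (\<phi> x \<bullet> \<phi> x) + (s' r / r * (\<phi> x \<bullet> \<phi> x)) * (x \<bullet> i)\<^sup>2 + ((s r)\<^sup>2 * (\<phi> x \<bullet> \<phi> x)) * (x \<bullet> i)\<^sup>2))"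
    proof (rule sum.cong[OF refl])
      fix i :: 'a
      have nd: "(norm (d x i - c *\<^sub>R \<phi> x))\<^sup>2 = (norm (d x i))\<^sup>2 - 2 * c * (\<phi> x \<bullet> d x i) + c\<^sup>2 * (\<phi> x \<bullet> \<phi> x)" for c
        unfolding power2_norm_eq_inner by (simp add: inner_diff_left inner_diff_right inner_commute power2_eq_square)
      show "(norm (d x i - (s r * (x \<bullet> i)) *\<^sub>R \<phi> x))\<^sup>2 = (norm (d x i))\<^sup>2 - T i x
        + (s r * (\<phi> x \<bullet> \<phi> x) + (s' r / r * (\<phi> x \<bullet> \<phi> x)) * (x \<bullet> i)\<^sup>2 + ((s r)\<^sup>2 * (\<phi> x \<bullet> \<phi> x)) * (x \<bullet> i)\<^sup>2)"
        unfolding nd T_def \<psi>_def \<psi>'_def r_def[symmetric] using r by (simp add: field_simps power2_eq_square)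
    qed
    also have "\<dots> = (\<Sum>i\<in>Basis. (norm (d x i))\<^sup>2) - (\<Sum>i\<in>Basis. T i x)
        + (N * (s r * (\<phi> x \<bullet> \<phi> x)) + (s' r / r * (\<phi> x \<bullet> \<phi> x)) * r\<^sup>2 + ((s r)\<^sup>2 * (\<phi> x \<bullet> \<phi> x)) * r\<^sup>2)"
      by (simp only: sum.distrib sum_subtractf sum_distrib_left[symmetric] Basis_sum_square sum_constant dim r_def)
         (simp add: ac_simps)
    also have "N * (s r * (\<phi> x \<bullet> \<phi> x)) + (s' r / r * (\<phi> x \<bullet> \<phi> x)) * r\<^sup>2 + ((s r)\<^sup>2 * (\<phi> x \<bullet> \<phi> x)) * r\<^sup>2
        = - (- (real N * s r + r * s' r + r\<^sup>2 * (s r)\<^sup>2)) * (\<phi> x \<bullet> \<phi> x)"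
      using r by (simp add: field_simps power2_eq_square)
    also have "\<dots> \<le> - (V r + 1/4) * (\<phi> x \<bullet> \<phi> x)"
      using s_supersolution[OF r] by (intro mult_right_mono) auto
    finally show ?thesis unfolding G_def r_def dot_square_norm by linarith
  qed
  have intG: "integrable (lebesgue_on (ball 0 1)) G"
  proof (rule integrable_inverse_square_singularity[OF dim3])
    show "continuous_on (ball 0 1 - {0}) G"
      unfolding G_def
      by (intro continuous_intros continuous_on_radial V_cont continuous_on_subset[OF cphi] continuous_on_subset[OF cd]) auto
    fix x :: 'a assume x: "0 < norm x" "norm x < 1"
    have "0 \<le> (\<Sum>i\<in>Basis. (norm (d x i))\<^sup>2)" by (intro sum_nonneg) auto
    moreover have "(\<Sum>i\<in>Basis. (norm (d x i))\<^sup>2) \<le> (\<Sum>i\<in>(Basis::'a set). C\<^sup>2)"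
      by (intro sum_mono power_mono dC) auto
    moreover have "0 \<le> (V (norm x) + 1/4) * (norm (\<phi> x))\<^sup>2" using V_nonneg[OF x] by simp
    moreover have "(V (norm x) + 1/4) * (norm (\<phi> x))\<^sup>2 \<le> (M + 1/4) * C\<^sup>2"
      using V_le[OF x] M_nonneg C(1) by (intro mult_mono power_mono) auto
    moreover have "0 \<le> (M + 1/4) * C\<^sup>2" "0 \<le> (\<Sum>i\<in>(Basis::'a set). C\<^sup>2)" using M_nonneg by (auto intro!: sum_nonneg)
    ultimately have "\<bar>G x\<bar> \<le> (\<Sum>i\<in>(Basis::'a set). C\<^sup>2) + (M + 1/4) * C\<^sup>2" unfolding G_def by linarith
    moreover have "0 \<le> (\<Sum>i\<in>(Basis::'a set). C\<^sup>2) + (M + 1/4) * C\<^sup>2" using M_nonneg by simp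
    ultimately show "norm (G x) \<le> ((\<Sum>i\<in>(Basis::'a set). C\<^sup>2) + (M + 1/4) * C\<^sup>2) / (norm x)\<^sup>2"
      using le_inverse_square(1)[OF x] unfolding real_norm_def by (meson order_trans)
  qed
  have "0 \<le> (\<integral>x. G x \<partial>lebesgue_on (ball 0 1))"
    \<comment> \<open>The 0 is replaced by the integral of the divergence, which reduces the claim
      to the pointwise inequality \<open>le\<close>.\<close>
    unfolding zero[symmetric]
  proof (rule integral_mono_AE[OF int intG])
    show "AE x in lebesgue_on (ball 0 1). (\<Sum>i\<in>Basis. T i x) \<le> G x"
      using AE_lebesgue_on_neq[of "ball 0 1" "0::'a", simplified] AE_space
      by eventually_elim (use le in auto)
  qed
  then show ?thesis by (simp add: G_def d_def)
qed

end

section \<open>Weak gradients\<close>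

lemma finite_measure_lebesgue_on_ball: "finite_measure (lebesgue_on (ball (0::'a::euclidean_space) r))"
  by (rule finite_measureI) (use emeasure_lborel_ball_finite[of "0::'a" r] in \<open>auto simp: emeasure_restrict_space\<close>)

lemma L2_onD:
  assumes "L2_on S u"
  shows "u \<in> borel_measurable (lebesgue_on S)" "integrable (lebesgue_on S) (\<lambda>x. (norm (u x))\<^sup>2)"
proof -
  show m: "u \<in> borel_measurable (lebesgue_on S)" using assms by (simp add: L2_on_def)
  show "integrable (lebesgue_on S) (\<lambda>x. (norm (u x))\<^sup>2)"
    by (rule integrableI_bounded) (use m assms in \<open>auto simp: L2_on_def\<close>)
qed

lemma L2_onI:
  assumes m: "u \<in> borel_measurable (lebesgue_on S)"
    and i: "integrable (lebesgue_on S) w" and le: "AE x in lebesgue_on S. (norm (u x))\<^sup>2 \<le> w x"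
  shows "L2_on S u"
proof -
  have "integrable (lebesgue_on S) (\<lambda>x. (norm (u x))\<^sup>2)"
    by (rule Bochner_Integration.integrable_bound[OF i]) (use m le in \<open>auto\<close>)
  then show ?thesis using m unfolding L2_on_def integrable_iff_bounded by simp
qed

lemma norm_diff_square_le: "(norm (a - b))\<^sup>2 \<le> 2 * (norm a)\<^sup>2 + 2 * (norm (b::'b::real_normed_vector))\<^sup>2"
proof -
  have "(norm (a - b))\<^sup>2 \<le> (norm a + norm b)\<^sup>2"
    by (intro power_mono norm_triangle_ineq4) auto
  also have "\<dots> \<le> 2 * (norm a)\<^sup>2 + 2 * (norm b)\<^sup>2"
    using zero_le_power2[of "norm a - norm b"] by (simp add: power2_eq_square algebra_simps)
  finally show ?thesis .
qed

lemma L2_on_diff: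
  assumes u: "L2_on S u" and v: "L2_on S v"
  shows "L2_on S (\<lambda>x. u x - v x)"
proof (rule L2_onI)
  show "(\<lambda>x. u x - v x) \<in> borel_measurable (lebesgue_on S)"
    by (intro borel_measurable_diff L2_onD(1) u v)
  show "integrable (lebesgue_on S) (\<lambda>x. 2 * (norm (u x))\<^sup>2 + 2 * (norm (v x))\<^sup>2)"
    by (intro Bochner_Integration.integrable_add integrable_mult_right L2_onD(2) u v)
  show "AE x in lebesgue_on S. (norm (u x - v x))\<^sup>2 \<le> 2 * (norm (u x))\<^sup>2 + 2 * (norm (v x))\<^sup>2"
    by (intro AE_I2 norm_diff_square_le)
qed

lemma integrable_scaleR_L2:
  fixes u :: "'a::euclidean_space \<Rightarrow> 'b::euclidean_space" and \<phi> :: "'a \<Rightarrow> real"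
  assumes u: "L2_on (ball 0 r) u" and c: "continuous_on UNIV \<phi>" and bd: "\<And>x. \<bar>\<phi> x\<bar> \<le> C"
  shows "integrable (lebesgue_on (ball 0 r)) (\<lambda>x. \<phi> x *\<^sub>R u x)"
proof (rule Bochner_Integration.integrable_bound)
  interpret finite_measure "lebesgue_on (ball (0::'a) r)" by (rule finite_measure_lebesgue_on_ball)
  show "integrable (lebesgue_on (ball 0 r)) (\<lambda>x. C * (1 + (norm (u x))\<^sup>2))"
    by (intro integrable_mult_right Bochner_Integration.integrable_add L2_onD(2) u integrable_const)
  have "\<phi> \<in> borel_measurable (lebesgue_on (ball 0 r))"
    using borel_measurable_continuous_onI[OF c] by (intro measurable_restrict_space1 measurable_completion) auto
  then show "(\<lambda>x. \<phi> x *\<^sub>R u x) \<in> borel_measurable (lebesgue_on (ball 0 r))"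
    using L2_onD(1)[OF u] by (intro borel_measurable_scaleR)
  have "norm (\<phi> x *\<^sub>R u x) \<le> norm (C * (1 + (norm (u x))\<^sup>2))" for x
  proof -
    have "0 \<le> (norm (u x) - 1/2)\<^sup>2" by simp
    then have "norm (u x) \<le> 1 + (norm (u x))\<^sup>2" by (simp add: power2_eq_square algebra_simps)
    then have "\<bar>\<phi> x\<bar> * norm (u x) \<le> C * (1 + (norm (u x))\<^sup>2)"
      using bd[of x] by (intro mult_mono) auto
    then show ?thesis by simp
  qed
  then show "AE x in lebesgue_on (ball 0 r). norm (\<phi> x *\<^sub>R u x) \<le> norm (C * (1 + (norm (u x))\<^sup>2))"
    by simp
qed

lemma H1_weak_grad_diff:
  fixes u v :: "'a::euclidean_space \<Rightarrow> 'b::euclidean_space"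
  assumes u: "H1_weak_grad (ball 0 r) u Du" and v: "H1_weak_grad (ball 0 r) v Dv"
  shows "H1_weak_grad (ball 0 r) (\<lambda>x. u x - v x) (\<lambda>x i. Du x i - Dv x i)"
  unfolding H1_weak_grad_def
proof (intro conjI ballI allI impI)
  show "L2_on (ball 0 r) (\<lambda>x. u x - v x)" "\<And>i. i \<in> Basis \<Longrightarrow> L2_on (ball 0 r) (\<lambda>x. Du x i - Dv x i)"
    using u v by (auto simp: H1_weak_grad_def intro!: L2_on_diff)
  fix \<phi> :: "'a \<Rightarrow> real" and i :: 'a assume \<phi>: "test_fun (ball 0 r) \<phi>" and i: "i \<in> Basis"
  obtain C where der: "\<And>x. (\<phi> has_derivative frechet_derivative \<phi> (at x)) (at x)"
    and cont: "continuous_on UNIV (\<lambda>x. frechet_derivative \<phi> (at x) i)"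
    and C: "\<And>x. \<bar>\<phi> x\<bar> \<le> C" "\<And>x. \<bar>frechet_derivative \<phi> (at x) i\<bar> \<le> C"
    using test_funE[OF \<phi> open_ball] i unfolding real_norm_def by metis
  have cphi: "continuous_on UNIV \<phi>"
    by (intro continuous_at_imp_continuous_on ballI) (use der has_derivative_continuous in blast)
  have I: "integrable (lebesgue_on (ball 0 r)) (\<lambda>x. \<phi> x *\<^sub>R w x i)"
    "integrable (lebesgue_on (ball 0 r)) (\<lambda>x. frechet_derivative \<phi> (at x) i *\<^sub>R w' x)"
    if "H1_weak_grad (ball 0 r) w' w" for w w'
    using that i by (auto simp: H1_weak_grad_def intro!: integrable_scaleR_L2[OF _ cphi C(1)] integrable_scaleR_L2[OF _ cont C(2)])
  show "(\<integral>x. \<phi> x *\<^sub>R (Du x i - Dv x i) \<partial>lebesgue_on (ball 0 r)) =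
      - (\<integral>x. frechet_derivative \<phi> (at x) i *\<^sub>R (u x - v x) \<partial>lebesgue_on (ball 0 r))"
    unfolding scaleR_diff_right
    using u v \<phi> i by (simp add: H1_weak_grad_def Bochner_Integration.integral_diff I[OF u] I[OF v])
qed

text \<open>The witness family consists of the functions that agree on \<open>U\<close> with a
  difference of members of the two given families. Agreement on \<open>U\<close> alone is the
  property that survives differentiation, as \<open>frechet_derivative\<close> is additive only
  where both functions are differentiable.\<close>

lemma smooth_on_diff:
  fixes f g :: "'a::euclidean_space \<Rightarrow> 'b::real_normed_vector"
  assumes f: "smooth_on U f" and g: "smooth_on U g" and U: "open U"
  shows "smooth_on U (\<lambda>x. f x - g x)"
proof -
  obtain F where F: "f \<in> F" "\<And>g. g \<in> F \<Longrightarrow> g differentiable_on U"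
      "\<And>g i. g \<in> F \<Longrightarrow> i \<in> Basis \<Longrightarrow> (\<lambda>x. frechet_derivative g (at x) i) \<in> F"
    using f unfolding smooth_on_def by blast
  obtain G where G: "g \<in> G" "\<And>g. g \<in> G \<Longrightarrow> g differentiable_on U"
      "\<And>g i. g \<in> G \<Longrightarrow> i \<in> Basis \<Longrightarrow> (\<lambda>x. frechet_derivative g (at x) i) \<in> G"
    using g unfolding smooth_on_def by blast
  define H where "H = {h. \<exists>a\<in>F. \<exists>b\<in>G. \<forall>x\<in>U. h x = a x - b x}"
  have der: "(h has_derivative (\<lambda>y. frechet_derivative a (at x) y - frechet_derivative b (at x) y)) (at x)"
    if ab: "a \<in> F" "b \<in> G" "\<forall>x\<in>U. h x = a x - b x" and x: "x \<in> U" for h a b x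
  proof -
    have "(a has_derivative frechet_derivative a (at x)) (at x)" "(b has_derivative frechet_derivative b (at x)) (at x)"
      using F(2)[OF ab(1)] G(2)[OF ab(2)] x U
      by (auto simp: differentiable_on_eq_differentiable_at frechet_derivative_works[symmetric])
    then have "((\<lambda>x. a x - b x) has_derivative (\<lambda>y. frechet_derivative a (at x) y - frechet_derivative b (at x) y)) (at x)"
      by (rule has_derivative_diff)
    then show ?thesis
      by (rule has_derivative_transform_within_open[OF _ U x]) (use ab in auto)
  qed
  show ?thesis unfolding smooth_on_def
  proof (intro exI[of _ H] conjI ballI)
    show "(\<lambda>x. f x - g x) \<in> H" using F(1) G(1) by (auto simp: H_def)
    fix h assume "h \<in> H"
    then obtain a b where ab: "a \<in> F" "b \<in> G" "\<forall>x\<in>U. h x = a x - b x" by (auto simp: H_def)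
    show "h differentiable_on U"
      using der[OF ab] U by (auto simp: differentiable_on_eq_differentiable_at differentiable_def)
    fix i :: 'a assume i: "i \<in> Basis"
    have "frechet_derivative h (at x) i = frechet_derivative a (at x) i - frechet_derivative b (at x) i" if "x \<in> U" for x
      using frechet_derivative_at[OF der[OF ab that]] by metis
    then show "(\<lambda>x. frechet_derivative h (at x) i) \<in> H"
      unfolding H_def
      by (intro CollectI bexI[OF _ F(3)[OF ab(1) i]] bexI[OF _ G(3)[OF ab(2) i]]) simp
  qed
qed

lemma test_fun_diff:
  fixes f g :: "'a::euclidean_space \<Rightarrow> 'b::real_normed_vector"
  assumes f: "test_fun U f" and g: "test_fun U g" and U: "open U"
  shows "test_fun U (\<lambda>x. f x - g x)"
proof -
  let ?K = "closure {x. f x \<noteq> 0} \<union> closure {x. g x \<noteq> 0}"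
  have K: "compact ?K" "?K \<subseteq> U" using f g by (auto simp: test_fun_def intro!: compact_Un)
  have sub: "closure {x. f x - g x \<noteq> 0} \<subseteq> ?K"
  proof (rule closure_minimal)
    have "{x. f x - g x \<noteq> 0} \<subseteq> {x. f x \<noteq> 0} \<union> {x. g x \<noteq> 0}" by auto
    also have "\<dots> \<subseteq> ?K" by (intro Un_mono closure_subset)
    finally show "{x. f x - g x \<noteq> 0} \<subseteq> ?K" .
  qed (rule compact_imp_closed[OF K(1)])
  have "compact (?K \<inter> closure {x. f x - g x \<noteq> 0})" by (intro compact_Int_closed K) auto
  moreover have "?K \<inter> closure {x. f x - g x \<noteq> 0} = closure {x. f x - g x \<noteq> 0}" using sub by blast
  ultimately show ?thesis
    using sub K f g smooth_on_diff[OF _ _ U] unfolding test_fun_def by auto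
qed

text \<open>Integration by parts against a scalar test function times (x, 0) is exactly the weak
  formulation, so the classical gradient off the origin is also the weak one. The general
  \<open>q\<close> serves both the radial map, with \<open>q = f\<close>, and the extension (x, 0)
  of the boundary datum, with \<open>q = 1\<close>.\<close>

lemma H1_weak_grad_radial_field:
  fixes q q' :: "real \<Rightarrow> real"
  assumes dim: "DIM('a::euclidean_space) \<ge> 3"
    and q: "\<And>r. 0 < r \<Longrightarrow> r < 1 \<Longrightarrow> (q has_real_derivative q' r) (at r)"
    and q'_cont: "continuous_on {0<..<1} q'"
    and bd: "\<And>r. 0 < r \<Longrightarrow> r < 1 \<Longrightarrow> \<bar>q r\<bar> \<le> 1 / r"
    and bd': "\<And>r. 0 < r \<Longrightarrow> r < 1 \<Longrightarrow> \<bar>q' r\<bar> \<le> 1 / r\<^sup>2"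
  shows "H1_weak_grad (ball (0::'a) 1) (\<lambda>x. (q (norm x) *\<^sub>R x, 0::'c::euclidean_space))
     (\<lambda>x i. (q (norm x) *\<^sub>R i + (q' (norm x) * (x \<bullet> i) / norm x) *\<^sub>R x, 0))"
    (is "H1_weak_grad _ ?u ?Du")
proof -
  have q_cont: "continuous_on {0<..<1} q"
    by (intro continuous_at_imp_continuous_on) (auto intro!: DERIV_isCont q)
  have cu: "continuous_on (ball 0 1 - {0}) ?u"
    by (intro continuous_intros continuous_on_radial q_cont)
  have cDu: "continuous_on (ball 0 1 - {0}) (\<lambda>x. ?Du x i)" for i
    by (intro continuous_intros continuous_on_radial q_cont q'_cont) auto
  have nu: "norm (?u x) \<le> 1" if x: "0 < norm x" "norm x < 1" for x
  proof -
    have "\<bar>q (norm x)\<bar> * norm x \<le> (1 / norm x) * norm x"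
      using bd[OF x] x by (intro mult_right_mono) auto
    then show ?thesis using x by (simp add: norm_Pair)
  qed
  have nDu: "norm (?Du x i) \<le> 2 / norm x" if x: "0 < norm x" "norm x < 1" and i: "i \<in> Basis" for x i
  proof -
    have "norm (q (norm x) *\<^sub>R i) \<le> 1 / norm x" using bd[OF x] i by simp
    moreover have "norm ((q' (norm x) * (x \<bullet> i) / norm x) *\<^sub>R x) \<le> 1 / norm x"
    proof -
      have "\<bar>q' (norm x)\<bar> * \<bar>x \<bullet> i\<bar> \<le> (1 / (norm x)\<^sup>2) * norm x"
        using bd'[OF x] Basis_le_norm[OF i, of x] by (intro mult_mono) auto
      then show ?thesis using x by (simp add: abs_mult power2_eq_square)
    qed
    ultimately have "norm (q (norm x) *\<^sub>R i + (q' (norm x) * (x \<bullet> i) / norm x) *\<^sub>R x) \<le> 1 / norm x + 1 / norm x"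
      using norm_triangle_ineq order_trans add_mono by (metis (no_types, lifting))
    then show ?thesis by (simp add: norm_Pair)
  qed
  have ae: "AE x in lebesgue_on (ball (0::'a) 1). 0 < norm x \<and> norm x < 1"
    using AE_lebesgue_on_neq[of "ball 0 1" "0::'a", simplified] AE_space
    by eventually_elim auto
  have L2u: "L2_on (ball 0 1) ?u"
  proof (rule L2_onI[OF borel_measurable_lebesgue_on_punctured[OF cu open_ball] integrable_lebesgue_on_inverse_square[OF dim, of 1]])
    show "AE x in lebesgue_on (ball 0 1). (norm (?u x))\<^sup>2 \<le> 1 / (norm x)\<^sup>2"
      using ae
    proof eventually_elim
      fix x :: 'a assume "0 < norm x \<and> norm x < 1"
      then have "(norm (?u x))\<^sup>2 \<le> 1" "1 \<le> 1 / (norm x)\<^sup>2"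
        using nu[of x] le_inverse_square(1)[of "norm x" 1] power_mono[of "norm (?u x)" 1 2] by auto
      then show "(norm (?u x))\<^sup>2 \<le> 1 / (norm x)\<^sup>2" by linarith
    qed
  qed
  have L2Du: "L2_on (ball 0 1) (\<lambda>x. ?Du x i)" if i: "i \<in> Basis" for i
  proof (rule L2_onI[OF borel_measurable_lebesgue_on_punctured[OF cDu open_ball] integrable_lebesgue_on_inverse_square[OF dim, of 4]])
    show "AE x in lebesgue_on (ball 0 1). (norm (?Du x i))\<^sup>2 \<le> 4 / (norm x)\<^sup>2"
      using ae
    proof eventually_elim
      fix x :: 'a assume "0 < norm x \<and> norm x < 1"
      then have "(norm (?Du x i))\<^sup>2 \<le> (2 / norm x)\<^sup>2" using nDu[OF _ _ i, of x] by (intro power_mono) auto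
      then show "(norm (?Du x i))\<^sup>2 \<le> 4 / (norm x)\<^sup>2" by (simp add: power_divide)
    qed
  qed
  show ?thesis unfolding H1_weak_grad_def
  proof (intro conjI allI impI ballI L2u L2Du)
    fix \<phi> :: "'a \<Rightarrow> real" and i :: 'a assume \<phi>: "test_fun (ball 0 1) \<phi>" and i: "i \<in> Basis"
    define d where "d x = frechet_derivative \<phi> (at x) i" for x
    obtain K C where K: "compact K" "K \<subseteq> ball 0 1" "\<And>x. x \<notin> K \<Longrightarrow> \<phi> x = 0"
      and der: "\<And>x. (\<phi> has_derivative frechet_derivative \<phi> (at x)) (at x)"
      and cd: "continuous_on UNIV d" and C0: "0 \<le> C"
      and C: "\<And>x. \<bar>\<phi> x\<bar> \<le> C" "\<And>x. \<bar>d x\<bar> \<le> C"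
      using test_funE[OF \<phi> open_ball] i unfolding real_norm_def d_def by metis
    have cphi: "continuous_on UNIV \<phi>"
      by (intro continuous_at_imp_continuous_on ballI) (use der has_derivative_continuous in blast)
    define \<psi> :: "'a \<Rightarrow> 'a \<times> 'c" where "\<psi> x = \<phi> x *\<^sub>R (x, 0)" for x
    define \<psi>' :: "'a \<Rightarrow> 'a \<times> 'c" where "\<psi>' x = d x *\<^sub>R (x, 0) + \<phi> x *\<^sub>R (i, 0)" for x
    have "has_bochner_integral (lebesgue_on (ball 0 1))
        (\<lambda>x. q (norm x) *\<^sub>R \<psi>' x + (q' (norm x) * (x \<bullet> i) / norm x) *\<^sub>R \<psi> x) 0"
    proof (rule radial_integral_by_parts[OF i dim q q'_cont, where K=K and C="2 * C"])
      fix x :: 'a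
      have v: "((\<lambda>t. (x + t *\<^sub>R i, 0::'c)) has_vector_derivative (i, 0)) (at 0)"
        by (auto simp: has_vector_derivative_def intro!: derivative_eq_intros)
      have "((\<lambda>t. \<phi> (x + t *\<^sub>R i)) has_real_derivative d x) (at 0)"
        using has_derivative_imp_has_vector_derivative_line[OF der, of x i]
        by (simp add: d_def has_real_derivative_iff_has_vector_derivative)
      from has_vector_derivative_scaleR[OF this v]
      show "((\<lambda>t. \<psi> (x + t *\<^sub>R i)) has_vector_derivative \<psi>' x) (at 0)"
        by (simp add: \<psi>_def \<psi>'_def add.commute)
      assume x: "0 < norm x" "norm x < 1"
      have n: "norm (\<psi>' x) \<le> 2 * C"
      proof -
        have "norm (\<psi>' x) \<le> \<bar>d x\<bar> * norm x + \<bar>\<phi> x\<bar> * 1"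
          unfolding \<psi>'_def using norm_triangle_ineq[of "d x *\<^sub>R (x, 0::'c)" "\<phi> x *\<^sub>R (i, 0)"] i by (simp add: norm_Pair)
        also have "\<dots> \<le> C * 1 + C * 1" using C x C0 by (intro add_mono mult_mono) auto
        finally show ?thesis by simp
      qed
      have "norm (q (norm x) *\<^sub>R \<psi>' x) \<le> (1 / norm x) * (2 * C)"
        using bd[OF x] n unfolding norm_scaleR by (intro mult_mono) auto
      also have "\<dots> \<le> 2 * C / (norm x)\<^sup>2" using le_inverse_square(2)[OF x, of "2 * C"] C0 by simp
      finally show "norm (q (norm x) *\<^sub>R \<psi>' x) \<le> 2 * C / (norm x)\<^sup>2" .
      have "\<bar>\<phi> x\<bar> * norm x \<le> C * 1" using C x C0 by (intro mult_mono) auto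
      then have n': "norm (\<psi> x) \<le> 2 * C" using C0 by (simp add: \<psi>_def norm_Pair)
      have "norm (q' (norm x) *\<^sub>R \<psi> x) \<le> (1 / (norm x)\<^sup>2) * (2 * C)"
        using bd'[OF x] n' unfolding norm_scaleR by (intro mult_mono) auto
      then show "norm (q' (norm x) *\<^sub>R \<psi> x) \<le> 2 * C / (norm x)\<^sup>2" by simp
    next
      show "continuous_on UNIV \<psi>" "continuous_on UNIV \<psi>'"
        unfolding \<psi>_def \<psi>'_def by (intro continuous_intros cphi cd)+
    qed (use K in \<open>auto simp: \<psi>_def zero_prod_def\<close>)
    moreover have "(\<lambda>x. q (norm x) *\<^sub>R \<psi>' x + (q' (norm x) * (x \<bullet> i) / norm x) *\<^sub>R \<psi> x)
        = (\<lambda>x. \<phi> x *\<^sub>R ?Du x i + d x *\<^sub>R ?u x)"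
      by (auto simp: \<psi>_def \<psi>'_def fun_eq_iff algebra_simps)
    ultimately have "(\<integral>x. \<phi> x *\<^sub>R ?Du x i + d x *\<^sub>R ?u x \<partial>lebesgue_on (ball 0 1)) = 0"
      by (simp only: has_bochner_integral_iff)
    moreover have "integrable (lebesgue_on (ball 0 1)) (\<lambda>x. \<phi> x *\<^sub>R ?Du x i)"
      by (rule integrable_scaleR_L2[OF L2Du[OF i] cphi C(1)])
    moreover have "integrable (lebesgue_on (ball 0 1)) (\<lambda>x. d x *\<^sub>R ?u x)"
      by (rule integrable_scaleR_L2[OF L2u cd C(2)])
    ultimately show "(\<integral>x. \<phi> x *\<^sub>R ?Du x i \<partial>lebesgue_on (ball 0 1)) =
        - (\<integral>x. frechet_derivative \<phi> (at x) i *\<^sub>R ?u x \<partial>lebesgue_on (ball 0 1))"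
      by (simp only: Bochner_Integration.integral_add d_def eq_neg_iff_add_eq_0)
  qed
qed

lemma H1_weak_grad_identity:
  assumes dim: "DIM('a::euclidean_space) \<ge> 3"
  shows "H1_weak_grad (ball (0::'a) 1) (\<lambda>x. (x, 0::'c::euclidean_space)) (\<lambda>x i. (i, 0))"
  using H1_weak_grad_radial_field[OF dim, of "\<lambda>_. 1" "\<lambda>_. 0", where 'c='c] by simp

lemma (in radial_profile) H1_weak_grad_u_rad:
  assumes dim: "DIM('a::euclidean_space) = N"
  shows "H1_weak_grad (ball (0::'a) 1) (u_rad :: 'a \<Rightarrow> 'a \<times> 'c::euclidean_space) Du_rad"
proof -
  have "DIM('a) \<ge> 3" using dim N by simp
  from H1_weak_grad_radial_field[OF this f_der continuous_on_f' abs_f_le abs_f'_le, where 'c='c]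
  show ?thesis by (simp add: u_rad_def[abs_def] Du_rad_def[abs_def] b_def)
qed

section \<open>Smooth radial test functions\<close>

text \<open>\<open>smooth_on\<close> asks for a family closed under partial derivatives. The algebra
  generated by \<open>G\<close> provides one as soon as the partials of the generators lie in it, so
  that only generators have to be differentiated by hand.\<close>

inductive_set falg :: "('a \<Rightarrow> real) set \<Rightarrow> ('a \<Rightarrow> real) set" for G where
  gen: "g \<in> G \<Longrightarrow> g \<in> falg G"
| const: "(\<lambda>_. c) \<in> falg G"
| add: "f \<in> falg G \<Longrightarrow> g \<in> falg G \<Longrightarrow> (\<lambda>x. f x + g x) \<in> falg G"
| mult: "f \<in> falg G \<Longrightarrow> g \<in> falg G \<Longrightarrow> (\<lambda>x. f x * g x) \<in> falg G"

lemma falg_sum: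
  assumes "finite A" "\<And>i. i \<in> A \<Longrightarrow> f i \<in> falg G"
  shows "(\<lambda>x. \<Sum>i\<in>A. f i x) \<in> falg G"
  using assms by (induction A rule: finite_induct) (auto intro: falg.intros)

lemma falg_poly:
  assumes "f \<in> falg G"
  shows "(\<lambda>x. poly p (f x)) \<in> falg G"
proof (induction p)
  case 0
  show ?case using falg.const[of 0 G] by simp
next
  case (pCons a p)
  show ?case using falg.add[OF falg.const falg.mult[OF assms pCons.IH], of a] by simp
qed

definition falg_diff where
  "falg_diff U G g \<longleftrightarrow> (\<exists>g'. (\<forall>x\<in>U. (g has_derivative g' x) (at x)) \<and>
     (\<forall>i\<in>Basis. (\<lambda>x. g' x i) \<in> falg G))"

lemma falg_diff_falg:
  assumes gen: "\<And>g. g \<in> G \<Longrightarrow> falg_diff U G g" and f: "f \<in> falg G"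
  shows "falg_diff U G f"
  using f
proof induction
  case (gen g)
  then show ?case by (rule assms(1))
next
  case (const c)
  show ?case unfolding falg_diff_def
    by (rule exI[of _ "\<lambda>_ _. 0"]) (auto intro: falg.const)
next
  case (add f g)
  then obtain f' g' where d: "\<forall>x\<in>U. (f has_derivative f' x) (at x)" "\<forall>x\<in>U. (g has_derivative g' x) (at x)"
    and f': "\<And>i. i \<in> Basis \<Longrightarrow> (\<lambda>x. f' x i) \<in> falg G" and g': "\<And>i. i \<in> Basis \<Longrightarrow> (\<lambda>x. g' x i) \<in> falg G"
    unfolding falg_diff_def by metis
  show ?case unfolding falg_diff_def
    by (rule exI[of _ "\<lambda>x y. f' x y + g' x y"]) (use d f' g' in \<open>auto intro!: has_derivative_add falg.add\<close>)
next
  case (mult f g)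
  then obtain f' g' where d: "\<forall>x\<in>U. (f has_derivative f' x) (at x)" "\<forall>x\<in>U. (g has_derivative g' x) (at x)"
    and f': "\<And>i. i \<in> Basis \<Longrightarrow> (\<lambda>x. f' x i) \<in> falg G" and g': "\<And>i. i \<in> Basis \<Longrightarrow> (\<lambda>x. g' x i) \<in> falg G"
    unfolding falg_diff_def by metis
  show ?case unfolding falg_diff_def
    by (rule exI[of _ "\<lambda>x y. f x * g' x y + f' x y * g x"])
      (use d f' g' mult.hyps in \<open>auto intro!: has_derivative_mult falg.add falg.mult\<close>)
qed

text \<open>The family consists of maps whose components agree on \<open>U\<close> with members of
  the algebra. Outside \<open>U\<close> nothing is required, since \<open>frechet_derivative\<close>
  may be an arbitrary choice there.\<close>

lemma smooth_on_falg:
  fixes F :: "'a::euclidean_space \<Rightarrow> 'b::euclidean_space"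
  assumes U: "open U" and gen: "\<And>g. g \<in> G \<Longrightarrow> falg_diff U G g"
    and F: "\<And>b. b \<in> Basis \<Longrightarrow> (\<lambda>x. F x \<bullet> b) \<in> falg G"
  shows "smooth_on U F"
proof -
  define H where "H = {h::'a \<Rightarrow> 'b. \<forall>b\<in>Basis. \<exists>a\<in>falg G. \<forall>x\<in>U. h x \<bullet> b = a x}"
  have key: "\<exists>h'. (\<forall>x\<in>U. (h has_derivative h' x) (at x)) \<and> (\<forall>i\<in>Basis. (\<lambda>x. h' x i) \<in> H)" if "h \<in> H" for h
  proof -
    have "\<forall>b\<in>Basis. \<exists>a. a \<in> falg G \<and> (\<forall>x\<in>U. h x \<bullet> b = a x)" using that unfolding H_def by blast
    from bchoice[OF this] obtain a where a: "\<And>b. b \<in> Basis \<Longrightarrow> a b \<in> falg G"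
      "\<And>b x. b \<in> Basis \<Longrightarrow> x \<in> U \<Longrightarrow> h x \<bullet> b = a b x" by blast
    have "\<forall>b\<in>Basis. \<exists>a'. (\<forall>x\<in>U. (a b has_derivative a' x) (at x)) \<and> (\<forall>i\<in>Basis. (\<lambda>x. a' x i) \<in> falg G)"
      using falg_diff_falg[OF gen a(1)] unfolding falg_diff_def by blast
    then obtain a' where a': "\<And>b x. b \<in> Basis \<Longrightarrow> x \<in> U \<Longrightarrow> (a b has_derivative a' b x) (at x)"
      "\<And>b i. b \<in> Basis \<Longrightarrow> i \<in> Basis \<Longrightarrow> (\<lambda>x. a' b x i) \<in> falg G" by metis
    define h' where "h' x y = (\<Sum>b\<in>Basis. a' b x y *\<^sub>R b)" for x y
    have "(h has_derivative h' x) (at x)" if x: "x \<in> U" for x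
    proof -
      have "((\<lambda>x. \<Sum>b\<in>Basis. a b x *\<^sub>R b) has_derivative h' x) (at x)"
        unfolding h'_def[abs_def] by (intro has_derivative_sum has_derivative_scaleR_left a' x)
      then show ?thesis
      proof (rule has_derivative_transform_within_open[OF _ U x])
        fix y assume "y \<in> U"
        then have "(\<Sum>b\<in>Basis. a b y *\<^sub>R b) = (\<Sum>b\<in>Basis. (h y \<bullet> b) *\<^sub>R b)"
          by (intro sum.cong refl) (simp add: a(2))
        then show "(\<Sum>b\<in>Basis. a b y *\<^sub>R b) = h y" by (simp add: euclidean_representation)
      qed
    qed
    moreover have "(\<lambda>x. h' x i) \<in> H" if "i \<in> Basis" for i
      unfolding H_def h'_def using a'(2) that by (auto simp: inner_sum_left_Basis)
    ultimately show ?thesis by blast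
  qed
  show ?thesis unfolding smooth_on_def
  proof (intro exI[of _ H] conjI ballI)
    show "F \<in> H" using F by (auto simp: H_def)
    fix h assume "h \<in> H"
    then obtain h' where h': "\<And>x. x \<in> U \<Longrightarrow> (h has_derivative h' x) (at x)" "\<And>i. i \<in> Basis \<Longrightarrow> (\<lambda>x. h' x i) \<in> H"
      using key by meson
    show "h differentiable_on U"
      using h'(1) U by (auto simp: differentiable_on_eq_differentiable_at differentiable_def)
    fix i :: 'a assume i: "i \<in> Basis"
    have "frechet_derivative h (at x) i = h' x i" if "x \<in> U" for x
      using frechet_derivative_at[OF h'(1)[OF that]] by simp
    then show "(\<lambda>x. frechet_derivative h (at x) i) \<in> H"
      using h'(2)[OF i] unfolding H_def by auto
  qed
qed

text \<open>The classical flat function exp(-1/t), multiplied by a polynomial in 1/t. The polynomial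
  parameter makes the class closed under differentiation.\<close>

definition expbump :: "real poly \<Rightarrow> real \<Rightarrow> real" where
  "expbump p t = (if t > 0 then poly p (1/t) * exp (-(1/t)) else 0)"

text \<open>In the variable y = 1/t one has d/dt = - y^2 d/dy, and d/dy sends p(y) exp(-y) to (p' -
  p)(y) exp(-y).\<close>

definition expbump_deriv :: "real poly \<Rightarrow> real poly" where
  "expbump_deriv p = [:0, 0, 1:] * (p - pderiv p)"

text \<open>The power \<open>y ^ k\<close> is generalised in the induction because passing from
  \<open>pCons a p\<close> to \<open>p\<close> moves one factor y into it.\<close>

lemma poly_mult_exp_neg_tendsto_0: "((\<lambda>y. y ^ k * poly p y * exp (-y)) \<longlongrightarrow> 0) at_top" for p :: "real poly"
proof (induction p arbitrary: k)
  case 0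
  then show ?case by simp
next
  case (pCons a p)
  have "((\<lambda>y. a * (y ^ k / exp y) + y ^ (Suc k) * poly p y * exp (-y)) \<longlongrightarrow> a * 0 + 0) at_top"
    by (intro tendsto_intros tendsto_power_div_exp_0 pCons.IH)
  then show ?case by (simp add: algebra_simps exp_minus divide_inverse)
qed

lemma expbump_has_derivative:
  "(expbump p has_real_derivative expbump (expbump_deriv p) t) (at t)"
proof -
  consider "t > 0" | "t < 0" | "t = 0" by linarith
  then show ?thesis
  proof cases
    case 1
    have inv: "((\<lambda>t. 1/t) has_real_derivative - (1/t)\<^sup>2) (at t)"
      by (rule DERIV_cong[OF DERIV_divide[OF DERIV_const DERIV_ident]])
         (use 1 in \<open>auto simp: power2_eq_square\<close>)
    have "((\<lambda>t. poly p (1/t) * exp (-(1/t))) has_real_derivative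
       (poly (pderiv p) (1/t) * (- (1/t)\<^sup>2)) * exp (-(1/t)) + (exp (-(1/t)) * (- (- (1/t)\<^sup>2))) * poly p (1/t)) (at t)"
      by (intro DERIV_mult DERIV_chain2[OF poly_DERIV inv] DERIV_fun_exp DERIV_minus inv)
    moreover have "(poly (pderiv p) (1/t) * (- (1/t)\<^sup>2)) * exp (-(1/t)) + (exp (-(1/t)) * (- (- (1/t)\<^sup>2))) * poly p (1/t)
       = expbump (expbump_deriv p) t"
      using 1 by (simp add: expbump_def expbump_deriv_def field_simps power2_eq_square)
    ultimately have "((\<lambda>t. poly p (1/t) * exp (-(1/t))) has_real_derivative expbump (expbump_deriv p) t) (at t)" by simp
    then show ?thesis
      by (rule has_field_derivative_transform_within_open[where S="{0<..}"]) (use 1 in \<open>auto simp: expbump_def\<close>)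
  next
    case 2
    have "((\<lambda>_. 0) has_real_derivative 0) (at t)" by simp
    then have "(expbump p has_real_derivative 0) (at t)"
      by (rule has_field_derivative_transform_within_open[where S="{..<0}"]) (use 2 in \<open>auto simp: expbump_def\<close>)
    then show ?thesis using 2 by (simp add: expbump_def)
  next
    case 3
    \<comment> \<open>With y = 1/t the right difference quotient at 0 is y p(y) exp(-y), which tends
      to 0.\<close>
    have r: "((\<lambda>t. expbump p t / t) \<longlongrightarrow> 0) (at_right 0)"
    proof -
      have "((\<lambda>y. y ^ 1 * poly p y * exp (-y)) \<longlongrightarrow> 0) at_top" by (rule poly_mult_exp_neg_tendsto_0)
      then have "((\<lambda>t. (inverse t) ^ 1 * poly p (inverse t) * exp (-(inverse t))) \<longlongrightarrow> 0) (at_right 0)"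
        by (rule filterlim_compose[OF _ filterlim_inverse_at_top_right])
      then show ?thesis
      proof (rule Lim_transform_eventually)
        show "\<forall>\<^sub>F x in at_right 0. inverse x ^ 1 * poly p (inverse x) * exp (- inverse x) = expbump p x / x"
          unfolding eventually_at_right_field by (rule exI[of _ 1]) (auto simp: expbump_def divide_inverse)
      qed
    qed
    have l: "((\<lambda>t. expbump p t / t) \<longlongrightarrow> 0) (at_left 0)"
      by (rule Lim_transform_eventually[OF tendsto_const])
         (auto simp: eventually_at_left_field expbump_def intro!: exI[of _ "-1"])
    have "((\<lambda>t. expbump p t / t) \<longlongrightarrow> 0) (at 0)" using l r by (rule filterlim_split_at)
    then show ?thesis using 3
      by (simp add: has_field_derivative_iff expbump_def)
  qed
qed

lemma has_derivative_norm_square_comp: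
  fixes x :: "'a::euclidean_space"
  assumes "(Q has_real_derivative Q') (at (x \<bullet> x))"
  shows "((\<lambda>x. Q (x \<bullet> x)) has_derivative (\<lambda>y. Q' * (2 * (x \<bullet> y)))) (at x)"
proof -
  have "((\<lambda>x::'a. x \<bullet> x) has_derivative (\<lambda>y. 2 * (x \<bullet> y))) (at x)"
    by (auto intro!: derivative_eq_intros simp: inner_commute)
  from has_derivative_compose[OF this, of Q "(*) Q'"] show ?thesis
    using assms by (simp add: has_field_derivative_def)
qed

text \<open>For K > 0 it is positive exactly for 1/K < t < 1 - 1/K. There is no plateau: for fixed t
  in (0, 1) both arguments grow with \<open>K\<close>, so the values tend to 1 pointwise, which is
  enough for dominated convergence.\<close>

definition cutoff :: "real \<Rightarrow> real \<Rightarrow> real" where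
  "cutoff K t = expbump 1 (K * t - 1) * expbump 1 (K - 1 - K * t)"

lemma expbump_1_bounds: "0 \<le> expbump 1 t" "expbump 1 t \<le> 1"
  by (auto simp: expbump_def)

lemma cutoff_bounds: "0 \<le> cutoff K t" "cutoff K t \<le> 1"
  unfolding cutoff_def using expbump_1_bounds
  by (auto intro!: mult_nonneg_nonneg mult_le_one)

lemma cutoff_eq_0: "K * t \<le> 1 \<or> K - 1 \<le> K * t \<Longrightarrow> cutoff K t = 0"
  by (auto simp: cutoff_def expbump_def)

lemma continuous_on_expbump: "continuous_on S (expbump p)"
  by (intro continuous_at_imp_continuous_on ballI DERIV_isCont[OF expbump_has_derivative])

lemma continuous_on_cutoff: "continuous_on S (cutoff K)"
  unfolding cutoff_def
  by (intro continuous_intros continuous_on_compose2[OF continuous_on_expbump[of UNIV]]) auto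

lemma expbump_1_tendsto: "filterlim g at_top F \<Longrightarrow> ((\<lambda>x. expbump 1 (g x)) \<longlongrightarrow> 1) F"
proof -
  assume g: "filterlim g at_top F"
  have "((\<lambda>x. exp (-(inverse (g x)))) \<longlongrightarrow> exp (- 0)) F"
    by (intro tendsto_intros tendsto_inverse_0_at_top g)
  then show ?thesis
  proof (rule Lim_transform_eventually[OF tendsto_eq_rhs])
    show "\<forall>\<^sub>F x in F. exp (- inverse (g x)) = expbump 1 (g x)"
      using filterlim_at_top_dense[THEN iffD1, OF g, rule_format, of 0]
      by eventually_elim (simp add: expbump_def divide_inverse)
  qed simp
qed

lemma cutoff_tendsto:
  assumes "0 < t" "t < 1"
  shows "(\<lambda>k. cutoff (real (k + 3)) t) \<longlonglongrightarrow> 1"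
proof -
  have K: "filterlim (\<lambda>k. real (k + 3)) at_top sequentially"
    by (rule filterlim_compose[OF filterlim_real_sequentially]) (rule filterlim_add_const_nat_at_top)
  have a: "filterlim (\<lambda>k. -1 + t * real (k + 3)) at_top sequentially"
    by (intro filterlim_tendsto_add_at_top[OF tendsto_const] filterlim_tendsto_pos_mult_at_top[OF tendsto_const] K assms)
  have b: "filterlim (\<lambda>k. -1 + (1 - t) * real (k + 3)) at_top sequentially"
    by (intro filterlim_tendsto_add_at_top[OF tendsto_const] filterlim_tendsto_pos_mult_at_top[OF tendsto_const] K) (use assms in auto)
  have "(\<lambda>k. expbump 1 (-1 + t * real (k + 3)) * expbump 1 (-1 + (1 - t) * real (k + 3))) \<longlonglongrightarrow> 1 * 1"
    by (intro tendsto_mult expbump_1_tendsto a b)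
  moreover have "cutoff K t = expbump 1 (-1 + t * K) * expbump 1 (-1 + (1 - t) * K)" for K
    by (simp add: cutoff_def algebra_simps)
  ultimately show ?thesis by simp
qed

lemma polynomial_approximation:
  fixes g :: "real \<Rightarrow> real"
  assumes "continuous_on {a..b} g" "e > 0"
  obtains p :: "real poly" where "\<And>t. t \<in> {a..b} \<Longrightarrow> \<bar>poly p t - g t\<bar> < e"
proof -
  obtain f where f: "real_polynomial_function f" "\<And>t. t \<in> {a..b} \<Longrightarrow> \<bar>g t - f t\<bar> < e"
    using Stone_Weierstrass_real_polynomial_function[OF compact_Icc assms] by blast
  then obtain c n where "f = (\<lambda>x. \<Sum>i\<le>n. c i * x ^ i)" using real_polynomial_function_iff_sum by blast
  then have "poly (\<Sum>i\<le>n. monom (c i) i) t = f t" for t by (simp add: poly_sum poly_monom)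
  then show ?thesis using f(2) that by (metis abs_minus_commute)
qed

text \<open>The polynomial comes from Weierstrass on the compact interval outside which the cutoff
  vanishes, since \<open>g\<close> may blow up at 0 and 1. The antiderivative is normalised at 1 and
  has zero derivative beyond 1 - 1/K, hence is 0 there.\<close>

lemma smooth_primitive:
  fixes g :: "real \<Rightarrow> real"
  assumes g: "continuous_on {0<..<1} g" and K: "K \<ge> 3"
  obtains p Q where "\<And>t. (Q has_real_derivative cutoff K t * poly p t) (at t)"
    "\<And>t. 1 - 1/K \<le> t \<Longrightarrow> Q t = 0"
    "\<And>t. 1/K \<le> t \<Longrightarrow> t \<le> 1 - 1/K \<Longrightarrow> \<bar>poly p t - g t\<bar> < 1/K"
proof -
  have "0 < 1/K" using K by simp
  then have "0 < t \<and> t < 1" if "t \<in> {1/K..1-1/K}" for t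
    using that unfolding atLeastAtMost_iff by linarith
  then have sub: "{1/K..1-1/K} \<subseteq> {0<..<1}" by auto
  obtain p where p: "\<And>t. t \<in> {1/K..1-1/K} \<Longrightarrow> \<bar>poly p t - g t\<bar> < 1/K"
    by (rule polynomial_approximation[of "1/K" "1-1/K" g "1/K"])
       (use K continuous_on_subset[OF g sub] in auto)
  have "continuous_on UNIV (\<lambda>t. cutoff K t * poly p t)"
    by (intro continuous_intros continuous_on_cutoff)
  then have "\<exists>F. \<forall>t. (F has_vector_derivative cutoff K t * poly p t) (at t)"
    using einterval_antiderivative[of "-\<infinity>" \<infinity> "\<lambda>t. cutoff K t * poly p t"]
    by (auto simp: continuous_on_eq_continuous_at)
  then obtain F where F: "\<And>t. (F has_real_derivative cutoff K t * poly p t) (at t)"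
    by (auto simp: has_real_derivative_iff_has_vector_derivative)
  define Q where "Q t = F t - F 1" for t
  have d: "(Q has_real_derivative cutoff K t * poly p t) (at t)" for t
    unfolding Q_def[abs_def] using DERIV_diff[OF F DERIV_const] by simp
  have "Q t = 0" if t: "1 - 1/K \<le> t" for t
  proof -
    have z: "(Q has_real_derivative 0) (at s)" if "1 - 1/K \<le> s" for s
    proof -
      have "K - 1 \<le> K * s" using that K by (simp add: field_simps)
      then show ?thesis using d[of s] cutoff_eq_0[of K s] by simp
    qed
    have "Q t = Q 1"
    proof (cases "t < 1")
      case True
      then show ?thesis
        by (intro DERIV_isconst_end[symmetric]) (use z t d in \<open>auto intro!: continuous_at_imp_continuous_on DERIV_isCont\<close>)
    next
      case False
      have "0 \<le> 1 / K" using K by simp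
      then have "1 - 1/K \<le> s" if "1 < s" for s using that by linarith
      then have "t \<noteq> 1 \<Longrightarrow> Q t = Q 1"
        using False by (intro DERIV_isconst_end) (use z d in \<open>auto intro!: continuous_at_imp_continuous_on DERIV_isCont\<close>)
      then show ?thesis by blast
    qed
    then show ?thesis by (simp add: Q_def)
  qed
  with d p show ?thesis by (intro that[of Q p]) auto
qed

lemma test_fun_radial:
  fixes Q :: "real \<Rightarrow> real"
  assumes K: "K \<ge> 3" and d: "\<And>t. (Q has_real_derivative cutoff K t * poly p t) (at t)"
    and z: "\<And>t. 1 - 1/K \<le> t \<Longrightarrow> Q t = 0"
  shows "test_fun (ball (0::'a::euclidean_space) 1) (\<lambda>x. (Q (x \<bullet> x) *\<^sub>R x, 0::'c::euclidean_space))"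
proof -
  \<comment> \<open>The generators are the coordinates, the two flat factors of the cutoff with
    every polynomial parameter, and \<open>Q\<close> itself. Polynomials in
    \<open>x \<bullet> x\<close> come from the coordinates, so the partials of
    \<open>Q (x \<bullet> x)\<close>, which are cutoff times polynomial times a coordinate, stay in
    the algebra.\<close>
  define G :: "('a \<Rightarrow> real) set" where "G = (\<lambda>b x. x \<bullet> b) ` Basis \<union> range (\<lambda>p x. expbump p (K * (x \<bullet> x) - 1))
     \<union> range (\<lambda>p x. expbump p (K - 1 - K * (x \<bullet> x))) \<union> {\<lambda>x. Q (x \<bullet> x)}"
  have coord: "(\<lambda>x. x \<bullet> b) \<in> falg G" if "b \<in> Basis" for b
    using that by (intro falg.gen) (auto simp: G_def)
  have coord': "(\<lambda>x. x \<bullet> b) \<in> falg G" if "b = 0 \<or> b \<in> Basis" for b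
    using that coord falg.const[of 0 G] by auto
  have sq: "(\<lambda>x. x \<bullet> x) \<in> falg G"
  proof -
    have "(\<lambda>x. \<Sum>b\<in>Basis. (x \<bullet> b) * (x \<bullet> b)) \<in> falg G"
      by (intro falg_sum falg.mult coord) auto
    then show ?thesis by (simp add: euclidean_inner[symmetric])
  qed
  have e1: "(\<lambda>x. expbump p (K * (x \<bullet> x) - 1)) \<in> falg G" and e2: "(\<lambda>x. expbump p (K - 1 - K * (x \<bullet> x))) \<in> falg G" for p
    by (intro falg.gen; auto simp: G_def)+
  have partial: "falg_diff U G (\<lambda>x. R (x \<bullet> x))"
    if R: "\<And>t. (R has_real_derivative R' t) (at t)" and R': "(\<lambda>x. R' (x \<bullet> x)) \<in> falg G" for R R' U
    unfolding falg_diff_def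
    by (rule exI[of _ "\<lambda>x y. R' (x \<bullet> x) * (2 * (x \<bullet> y))"])
       (intro conjI ballI has_derivative_norm_square_comp R falg.mult R' falg.const coord)
  have gen: "falg_diff (ball 0 1) G g" if "g \<in> G" for g
  proof -
    from that consider b where "b \<in> Basis" "g = (\<lambda>x. x \<bullet> b)" | p where "g = (\<lambda>x. expbump p (K * (x \<bullet> x) - 1))"
      | p where "g = (\<lambda>x. expbump p (K - 1 - K * (x \<bullet> x)))" | "g = (\<lambda>x. Q (x \<bullet> x))"
      unfolding G_def by blast
    then show ?thesis
    proof cases
      case 1
      show ?thesis unfolding falg_diff_def 1
        by (rule exI[of _ "\<lambda>x y. y \<bullet> b"]) (auto intro!: falg.const derivative_eq_intros)
    next
      case 2
      show ?thesis unfolding 2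
      proof (rule partial[of "\<lambda>t. expbump p (K * t - 1)" "\<lambda>t. expbump (expbump_deriv p) (K * t - 1) * K"])
        show "((\<lambda>t. expbump p (K * t - 1)) has_real_derivative expbump (expbump_deriv p) (K * t - 1) * K) (at t)" for t
          by (rule DERIV_chain2[OF expbump_has_derivative]) (auto intro!: derivative_eq_intros)
      qed (intro falg.mult e1 falg.const)
    next
      case 3
      show ?thesis unfolding 3
      proof (rule partial[of "\<lambda>t. expbump p (K - 1 - K * t)" "\<lambda>t. expbump (expbump_deriv p) (K - 1 - K * t) * (- K)"])
        show "((\<lambda>t. expbump p (K - 1 - K * t)) has_real_derivative expbump (expbump_deriv p) (K - 1 - K * t) * (- K)) (at t)" for t
          by (rule DERIV_chain2[OF expbump_has_derivative]) (auto intro!: derivative_eq_intros)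
      qed (intro falg.mult e2 falg.const)
    next
      case 4
      show ?thesis unfolding 4
        by (rule partial[OF d]) (unfold cutoff_def, intro falg.mult e1 e2 falg_poly sq)
    qed
  qed
  have sm: "smooth_on (ball 0 1) (\<lambda>x::'a. (Q (x \<bullet> x) *\<^sub>R x, 0::'c))"
  proof (rule smooth_on_falg[where G=G])
    show "open (ball (0::'a) 1)" by simp
    show "falg_diff (ball 0 1) G g" if "g \<in> G" for g by (rule gen[OF that])
  next
    fix b :: "'a \<times> 'c" assume "b \<in> Basis"
    then have b: "fst b = 0 \<or> fst b \<in> Basis" by (auto simp: Basis_prod_def)
    have "(\<lambda>x. Q (x \<bullet> x) * (x \<bullet> fst b)) \<in> falg G"
      by (intro falg.mult coord' b falg.gen) (auto simp: G_def)
    then show "(\<lambda>x::'a. (Q (x \<bullet> x) *\<^sub>R x, 0) \<bullet> b) \<in> falg G" by (simp add: inner_prod_def)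
  qed
  define R where "R = sqrt (1 - 1/K)"
  have R: "R < 1" using K by (simp add: R_def)
  have "{x::'a. (Q (x \<bullet> x) *\<^sub>R x, 0::'c) \<noteq> 0} \<subseteq> cball 0 R"
  proof
    fix x :: 'a assume "x \<in> {x. (Q (x \<bullet> x) *\<^sub>R x, 0::'c) \<noteq> 0}"
    then have "Q (x \<bullet> x) \<noteq> 0" by (auto simp: zero_prod_def)
    then have "x \<bullet> x < 1 - 1/K" using z[of "x \<bullet> x"] by linarith
    then have "(norm x)\<^sup>2 \<le> 1 - 1/K" by (simp add: dot_square_norm)
    then show "x \<in> cball 0 R" by (simp add: R_def real_le_rsqrt)
  qed
  then have sub: "closure {x::'a. (Q (x \<bullet> x) *\<^sub>R x, 0::'c) \<noteq> 0} \<subseteq> cball 0 R" by (simp add: closure_minimal)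
  moreover have "cball (0::'a) R \<subseteq> ball 0 1" using R by auto
  moreover have "compact (closure {x::'a. (Q (x \<bullet> x) *\<^sub>R x, 0::'c) \<noteq> 0})"
    using bounded_subset[OF bounded_cball sub] by (simp add: compact_eq_bounded_closed)
  ultimately show ?thesis using sm unfolding test_fun_def by blast
qed

section \<open>The boundary values of the radial map\<close>

context radial_profile
begin

text \<open>Here t stands for r^2. Since d/dt = (1/(2r)) d/dr, the derivative of the profile in t is
  half of \<open>b\<close>.\<close>

lemma profile_sqrt_der:
  assumes "0 < t" "t < 1"
  shows "((\<lambda>t. f (sqrt t) - 1) has_real_derivative b (sqrt t) / 2) (at t)"
proof -
  have s: "0 < sqrt t" "sqrt t < 1" using assms by auto
  have "((\<lambda>t. f (sqrt t) - 1) has_real_derivative f' (sqrt t) * (inverse (sqrt t) / 2) - 0) (at t)"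
    by (intro DERIV_diff DERIV_chain2[OF f_der[OF s] DERIV_real_sqrt] DERIV_const assms)
  moreover have "f' (sqrt t) * (inverse (sqrt t) / 2) - 0 = b (sqrt t) / 2"
    by (simp only: b_def divide_inverse diff_0_right mult.assoc)
  ultimately show ?thesis by simp
qed

lemma b_nonpos: "0 < r \<Longrightarrow> r < 1 \<Longrightarrow> b r \<le> 0"
  using f'_nonpos[of r] by (simp add: b_def divide_nonpos_pos)

text \<open>Smooth radial approximations: their radial derivatives are polynomials approximating that of
  \<open>f\<close>, multiplied by a cutoff, and their primitives are normalised to vanish near the boundary.\<close>
lemma smooth_profile_approximation:
  obtains Q :: "nat \<Rightarrow> real \<Rightarrow> real" and Q' where
    "\<And>k. test_fun (ball (0::'a::euclidean_space) 1) (\<lambda>x. (Q k (x \<bullet> x) *\<^sub>R x, 0::'c::euclidean_space))"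
    "\<And>k t. (Q k has_real_derivative Q' k t) (at t)"
    "\<And>k. continuous_on UNIV (Q' k)"
    "\<And>k r. 0 < r \<Longrightarrow> r < 1 \<Longrightarrow> \<bar>Q' k (r\<^sup>2)\<bar> \<le> 2 / r ^ 3"
    "\<And>k r. 0 < r \<Longrightarrow> r < 1 \<Longrightarrow> \<bar>Q k (r\<^sup>2)\<bar> \<le> 1 / r"
    "\<And>r. 0 < r \<Longrightarrow> r < 1 \<Longrightarrow> (\<lambda>k. Q' k (r\<^sup>2)) \<longlonglongrightarrow> b r / 2"
    "\<And>r. 0 < r \<Longrightarrow> r < 1 \<Longrightarrow> (\<lambda>k. Q k (r\<^sup>2)) \<longlonglongrightarrow> f r - 1"
proof -
  define P where "P t = f (sqrt t) - 1" for t
  define P' where "P' t = b (sqrt t) / 2" for t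
  define K where "K k = real (k + 3)" for k
  have K: "K k \<ge> 3" for k by (simp add: K_def)
  have P_der: "(P has_real_derivative P' t) (at t)" if "0 < t" "t < 1" for t
    unfolding P_def[abs_def] P'_def by (rule profile_sqrt_der[OF that])
  have P'_cont: "continuous_on {0<..<1} P'"
    unfolding P'_def[abs_def]
    by (intro continuous_intros continuous_on_compose2[OF continuous_on_b]) auto
  have P'_nonpos: "P' t \<le> 0" if "0 < t" "t < 1" for t
    unfolding P'_def using b_nonpos[of "sqrt t"] that by simp
  have P_cont: "continuous_on {s..1} P" if "0 < s" for s
    unfolding P_def[abs_def] f_def[abs_def] using that
    by (intro continuous_intros continuous_on_compose2[OF h_cont]) auto
  have P1: "P 1 = 0" by (simp add: P_def f_def h_1)
  have ex: "\<exists>p Q. (\<forall>t. (Q has_real_derivative cutoff (K k) t * poly p t) (at t)) \<and>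
    (\<forall>t. 1 - 1/K k \<le> t \<longrightarrow> Q t = 0) \<and>
    (\<forall>t. 1/K k \<le> t \<longrightarrow> t \<le> 1 - 1/K k \<longrightarrow> \<bar>poly p t - P' t\<bar> < 1/K k)" for k
    by (rule smooth_primitive[OF P'_cont K[of k]]) blast
  obtain p Q where Q: "\<And>k t. (Q k has_real_derivative cutoff (K k) t * poly (p k) t) (at t)"
    and Q0: "\<And>k t. 1 - 1/K k \<le> t \<Longrightarrow> Q k t = 0"
    and p: "\<And>k t. 1/K k \<le> t \<Longrightarrow> t \<le> 1 - 1/K k \<Longrightarrow> \<bar>poly (p k) t - P' t\<bar> < 1/K k"
    using ex by metis
  define Q' where "Q' k t = cutoff (K k) t * poly (p k) t" for k t
  have Kinv: "0 < 1 / K k" "1 / K k \<le> 1" for k using K[of k] by auto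
  \<comment> \<open>As \<open>P' \<le> 0\<close>, the bound is |P'| + 1, where the 1 absorbs the
    approximation error 1/K.\<close>
  have Q'_le: "\<bar>Q' k t\<bar> \<le> 1 - P' t" if t: "0 < t" "t < 1" for k t
  proof (cases "1/K k \<le> t \<and> t \<le> 1 - 1/K k")
    case True
    have "\<bar>poly (p k) t\<bar> \<le> 1 - P' t" using p[of k t] True P'_nonpos[OF t] Kinv(2)[of k] by linarith
    moreover have "\<bar>cutoff (K k) t\<bar> \<le> 1" using cutoff_bounds[of "K k" t] by simp
    ultimately have "\<bar>cutoff (K k) t\<bar> * \<bar>poly (p k) t\<bar> \<le> 1 * (1 - P' t)" by (intro mult_mono) auto
    then show ?thesis by (simp add: Q'_def abs_mult)
  next
    case False
    have "K k * t \<le> 1 \<or> K k - 1 \<le> K k * t" using False K[of k] by (auto simp: field_simps)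
    then have "cutoff (K k) t = 0" by (rule cutoff_eq_0)
    then show ?thesis using P'_nonpos[OF t] by (simp add: Q'_def)
  qed
  have Q1: "Q k 1 = 0" for k using Q0[of k 1] Kinv[of k] by simp
  have Q_cont: "continuous_on S (Q k)" for S k
    by (intro continuous_at_imp_continuous_on ballI DERIV_isCont[OF Q])
  \<comment> \<open>The bound on \<open>Q'\<close> integrated from s to 1, where \<open>P\<close>
    and \<open>Q\<close> both vanish. The two signs \<open>c\<close> give the two halves of the
    absolute value.\<close>
  have Q_le: "\<bar>Q k s\<bar> \<le> P s + (1 - s)" if s: "0 < s" "s < 1" for k s
  proof -
    have "P 1 + (1 - 1) + c * Q k 1 \<le> P s + (1 - s) + c * Q k s" if c: "\<bar>c\<bar> = 1" for c
    proof (rule DERIV_nonpos_imp_decreasing_open[of s 1])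
      fix x assume x: "s < x" "x < 1"
      have "((\<lambda>s. P s + (1 - s) + c * Q k s) has_real_derivative P' x + (0 - 1) + c * Q' k x) (at x)"
        unfolding Q'_def using x s by (intro DERIV_add DERIV_diff DERIV_const DERIV_ident DERIV_cmult P_der Q) auto
      moreover have "c * Q' k x \<le> 1 - P' x"
      proof -
        have "c * Q' k x \<le> \<bar>c\<bar> * \<bar>Q' k x\<bar>" by (metis abs_ge_self abs_mult)
        also have "\<dots> \<le> 1 - P' x" using Q'_le[of x k] x s c by simp
        finally show ?thesis .
      qed
      ultimately show "\<exists>y. ((\<lambda>s. P s + (1 - s) + c * Q k s) has_real_derivative y) (at x) \<and> y \<le> 0"
        by (intro exI conjI) auto
    qed (use s in \<open>auto intro!: continuous_intros P_cont Q_cont\<close>)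
    from this[of 1] this[of "-1"] show ?thesis using P1 Q1 by auto
  qed
  have Kt: "filterlim K at_top sequentially"
    unfolding K_def by (rule filterlim_compose[OF filterlim_real_sequentially]) (rule filterlim_add_const_nat_at_top)
  have Q'_lim: "(\<lambda>k. Q' k t) \<longlonglongrightarrow> P' t" if t: "0 < t" "t < 1" for t
  proof -
    have e1: "\<forall>\<^sub>F k in sequentially. 1 / t < K k" and e2: "\<forall>\<^sub>F k in sequentially. 1 / (1 - t) < K k"
      using Kt by (auto simp: filterlim_at_top_dense)
    have "(\<lambda>k. poly (p k) t - P' t) \<longlonglongrightarrow> 0"
    proof (rule Lim_null_comparison)
      show "\<forall>\<^sub>F k in sequentially. norm (poly (p k) t - P' t) \<le> inverse (K k)"
        using e1 e2
      proof eventually_elim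
        fix k assume a: "1 / t < K k" "1 / (1 - t) < K k"
        have "1 / K k \<le> t" "1 / K k \<le> 1 - t" using a t K[of k] by (auto simp: field_simps)
        then have "\<bar>poly (p k) t - P' t\<bar> < 1 / K k" by (intro p) auto
        then show "norm (poly (p k) t - P' t) \<le> inverse (K k)" by (simp add: inverse_eq_divide)
      qed
      show "(\<lambda>k. inverse (K k)) \<longlonglongrightarrow> 0" by (rule tendsto_inverse_0_at_top[OF Kt])
    qed
    then have "(\<lambda>k. poly (p k) t) \<longlonglongrightarrow> P' t" by (simp add: LIM_zero_iff)
    then have "(\<lambda>k. Q' k t) \<longlonglongrightarrow> 1 * P' t"
      unfolding Q'_def K_def by (intro tendsto_mult cutoff_tendsto t)
    then show ?thesis by simp
  qed
  have P'_le: "\<bar>P' t\<bar> \<le> 1 / (sqrt s) ^ 3" if "0 < s" "s \<le> t" "t < 1" for s t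
  proof -
    have "\<bar>b (sqrt t)\<bar> \<le> 1 / (sqrt t) ^ 3" using that by (intro abs_b_le) auto
    also have "\<dots> \<le> 1 / (sqrt s) ^ 3"
      using that by (intro divide_left_mono power_mono) auto
    finally show ?thesis using that by (simp add: P'_def)
  qed
  have Q_lim: "(\<lambda>k. Q k s) \<longlonglongrightarrow> P s" if s: "0 < s" "s < 1" for s
  proof -
    \<comment> \<open>The values at the endpoints are set to 0 because the bounds on
      \<open>P'\<close> hold only inside (0, 1), whereas dominated convergence is applied with a
      bound at every point of the closed interval.\<close>
    define D where "D k t = (if t \<in> {s<..<1} then Q' k t - P' t else 0)" for k t
    have hi: "(D k has_integral (P s - Q k s)) {s..1}" for k
    proof -
      have "((\<lambda>t. Q' k t - P' t) has_integral ((Q k 1 - P 1) - (Q k s - P s))) {s..1}"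
      proof (rule fundamental_theorem_of_calculus_interior)
        show "continuous_on {s..1} (\<lambda>t. Q k t - P t)" using s by (intro continuous_intros Q_cont P_cont)
        show "((\<lambda>t. Q k t - P t) has_vector_derivative Q' k t - P' t) (at t)" if "t \<in> {s<..<1}" for t
          unfolding has_real_derivative_iff_has_vector_derivative[symmetric] Q'_def
          using that s by (intro DERIV_diff Q P_der) auto
      qed (use s in auto)
      then have "((\<lambda>t. Q' k t - P' t) has_integral (P s - Q k s)) {s..1}" using P1 Q1 by simp
      then show ?thesis
        by (rule has_integral_spike_finite[of "{s, 1}", rotated 2]) (auto simp: D_def)
    qed
    have "(\<lambda>k. integral {s..1} (D k)) \<longlonglongrightarrow> integral {s..1} (\<lambda>_. 0)"
    proof (rule dominated_convergence(2))
      show "D k integrable_on {s..1}" for k using hi by blast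
      show "(\<lambda>_. 1 + 2 * (1 / (sqrt s) ^ 3)) integrable_on {s..1}" by (rule integrable_const_ivl)
      show "norm (D k t) \<le> 1 + 2 * (1 / (sqrt s) ^ 3)" if "t \<in> {s..1}" for k t
      proof (cases "t \<in> {s<..<1}")
        case True
        then show ?thesis using Q'_le[of t k] P'_le[of s t] s unfolding D_def by auto
      next
        case False
        have "0 \<le> 1 / (sqrt s) ^ 3" using s by simp
        then show ?thesis unfolding D_def if_not_P[OF False] by simp
      qed
      show "(\<lambda>k. D k t) \<longlonglongrightarrow> 0" if "t \<in> {s..1}" for t
      proof (cases "t \<in> {s<..<1}")
        case True
        then have "(\<lambda>k. Q' k t - P' t) \<longlonglongrightarrow> 0" using Q'_lim[of t] s by (simp add: LIM_zero_iff)
        then show ?thesis using True by (simp add: D_def)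
      qed (auto simp: D_def)
    qed
    then have "(\<lambda>k. P s - Q k s) \<longlonglongrightarrow> 0" using integral_unique[OF hi] by simp
    from tendsto_diff[OF tendsto_const[of "P s"] this] show ?thesis by simp
  qed
  show ?thesis
  proof (rule that[of Q Q'])
    show "test_fun (ball (0::'a) 1) (\<lambda>x. (Q k (x \<bullet> x) *\<^sub>R x, 0::'c))" for k
      by (rule test_fun_radial[OF K Q Q0])
    show "(Q k has_real_derivative Q' k t) (at t)" for k t unfolding Q'_def by (rule Q)
    show "continuous_on UNIV (Q' k)" for k
      unfolding Q'_def by (intro continuous_intros continuous_on_cutoff)
    fix r :: real assume r: "0 < r" "r < 1"
    have r2: "0 < r\<^sup>2" "r\<^sup>2 < 1" "sqrt (r\<^sup>2) = r" using r by (auto simp: power_less_one_iff)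
    have r3: "1 \<le> 1 / r ^ 3" using r by (simp add: power_le_one)
    show "\<bar>Q' k (r\<^sup>2)\<bar> \<le> 2 / r ^ 3" for k
      using Q'_le[OF r2(1,2), of k] P'_le[OF r2(1) order_refl r2(2)] r3 unfolding r2(3) by linarith
    \<comment> \<open>The 1 cancels the -1 in \<open>P\<close>: the left-hand side is f r -
      r^2.\<close>
    have "P (r\<^sup>2) + (1 - r\<^sup>2) \<le> 1 / r" using f_le[OF r] r2(1) unfolding P_def r2(3) by linarith
    then show "\<bar>Q k (r\<^sup>2)\<bar> \<le> 1 / r" for k using Q_le[OF r2(1,2), of k] by linarith
    show "(\<lambda>k. Q' k (r\<^sup>2)) \<longlonglongrightarrow> b r / 2" using Q'_lim[OF r2(1,2)] unfolding P'_def r2(3) .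
    show "(\<lambda>k. Q k (r\<^sup>2)) \<longlonglongrightarrow> f r - 1" using Q_lim[OF r2(1,2)] unfolding P_def r2(3) .
  qed
qed

text \<open>The difference of the two maps is radial with profile f - 1, which is 0 at r = 1 because
  h 1 = 1. The smooth approximants and their gradients converge pointwise off the origin, and the
  squared errors are dominated by a multiple of 1/|x|^2, so dominated convergence gives convergence
  in H^1.\<close>

lemma trace_eq_u_rad:
  assumes dim: "DIM('a::euclidean_space) = N"
  shows "trace_eq (ball (0::'a) 1) (u_rad :: 'a \<Rightarrow> 'a \<times> 'c::euclidean_space) Du_rad (\<lambda>x. (x, 0)) (\<lambda>x i. (i, 0))"
proof -
  have dim3: "DIM('a) \<ge> 3" using dim N by simp
  let ?B = "ball (0::'a) 1"
  obtain Q Q' where test: "\<And>k::nat. test_fun ?B (\<lambda>x. (Q k (x \<bullet> x) *\<^sub>R x, 0::'c))"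
    and Q: "\<And>k t. (Q k has_real_derivative Q' k t) (at t)" and Q'_cont: "\<And>k. continuous_on UNIV (Q' k)"
    and Q'_le: "\<And>k r. 0 < r \<Longrightarrow> r < 1 \<Longrightarrow> \<bar>Q' k (r\<^sup>2)\<bar> \<le> 2 / r ^ 3"
    and Q_le: "\<And>k r. 0 < r \<Longrightarrow> r < 1 \<Longrightarrow> \<bar>Q k (r\<^sup>2)\<bar> \<le> 1 / r"
    and Q'_lim: "\<And>r. 0 < r \<Longrightarrow> r < 1 \<Longrightarrow> (\<lambda>k. Q' k (r\<^sup>2)) \<longlonglongrightarrow> b r / 2"
    and Q_lim: "\<And>r. 0 < r \<Longrightarrow> r < 1 \<Longrightarrow> (\<lambda>k. Q k (r\<^sup>2)) \<longlonglongrightarrow> f r - 1"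
    by (rule smooth_profile_approximation[where 'a='a and 'c='c]) blast
  define \<phi> where "\<phi> k x = (Q k (x \<bullet> x) *\<^sub>R x, 0::'c)" for k and x :: 'a
  define v where "v x = u_rad x - (x, 0::'c)" for x :: 'a
  define Dv where "Dv x i = Du_rad x i - (i, 0::'c)" for x i :: 'a
  define d where "d k x = Q k ((norm x)\<^sup>2) - (f (norm x) - 1)" for k and x :: 'a
  define e where "e k x = 2 * Q' k ((norm x)\<^sup>2) - b (norm x)" for k and x :: 'a
  define J where "J k x = (norm (d k x *\<^sub>R x))\<^sup>2
     + (\<Sum>i\<in>Basis. (norm (d k x *\<^sub>R i + (e k x * (x \<bullet> i)) *\<^sub>R x))\<^sup>2)" for k and x :: 'a
  have d\<phi>: "frechet_derivative (\<phi> k) (at x) i = (Q k (x \<bullet> x) *\<^sub>R i + (2 * Q' k (x \<bullet> x) * (x \<bullet> i)) *\<^sub>R x, 0)" for k x i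
  proof -
    have "((\<lambda>x. Q k (x \<bullet> x) *\<^sub>R x) has_derivative
       (\<lambda>y. Q k (x \<bullet> x) *\<^sub>R y + (Q' k (x \<bullet> x) * (2 * (x \<bullet> y))) *\<^sub>R x)) (at x)"
      by (intro has_derivative_scaleR has_derivative_norm_square_comp Q has_derivative_ident)
    then have "(\<phi> k has_derivative (\<lambda>y. (Q k (x \<bullet> x) *\<^sub>R y + (Q' k (x \<bullet> x) * (2 * (x \<bullet> y))) *\<^sub>R x, 0))) (at x)"
      unfolding \<phi>_def[abs_def] by (intro has_derivative_Pair has_derivative_const)
    then show ?thesis
      by (simp only: frechet_derivative_at[symmetric]) (simp add: mult_ac)
  qed
  have J_eq: "(norm (\<phi> k x - v x))\<^sup>2 + (\<Sum>i\<in>Basis. (norm (frechet_derivative (\<phi> k) (at x) i - Dv x i))\<^sup>2) = J k x" for k x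
  proof -
    have "\<phi> k x - v x = (d k x *\<^sub>R x, 0)"
      by (simp add: \<phi>_def v_def u_rad_def d_def dot_square_norm algebra_simps)
    moreover have "frechet_derivative (\<phi> k) (at x) i - Dv x i = (d k x *\<^sub>R i + (e k x * (x \<bullet> i)) *\<^sub>R x, 0)" for i
      by (simp add: d\<phi> Dv_def Du_rad_def d_def e_def dot_square_norm algebra_simps)
    ultimately show ?thesis by (simp add: J_def norm_Pair)
  qed
  have contQ: "continuous_on UNIV (Q k)" for k
    by (intro continuous_at_imp_continuous_on ballI DERIV_isCont[OF Q])
  have "continuous_on (?B - {0}) (J k)" for k
    unfolding J_def[abs_def] d_def e_def
    by (intro continuous_intros continuous_on_compose2[OF contQ] continuous_on_compose2[OF Q'_cont]
        continuous_on_radial continuous_on_f continuous_on_b) auto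
  then have J_meas: "J k \<in> borel_measurable (lebesgue_on ?B)" for k
    by (rule borel_measurable_lebesgue_on_punctured) simp
  \<comment> \<open>From |d| <= 3/r and |e| <= 5/r^3: the map contributes 3^2 = 9, and each partial
    derivative (3 + 5)^2 = 64.\<close>
  define C where "C = 9 + (\<Sum>i\<in>(Basis::'a set). (64::real))"
  have d_le: "\<bar>d k x\<bar> \<le> 3 / norm x" and e_le: "\<bar>e k x\<bar> \<le> 5 / norm x ^ 3"
    if x: "0 < norm x" "norm x < 1" for k x
  proof -
    have "1 \<le> 1 / norm x" using x by simp
    then show "\<bar>d k x\<bar> \<le> 3 / norm x" using Q_le[OF x, of k] abs_f_le[OF x] unfolding d_def by linarith
    show "\<bar>e k x\<bar> \<le> 5 / norm x ^ 3" using Q'_le[OF x, of k] abs_b_le[OF x] unfolding e_def by linarith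
  qed
  have J_le: "J k x \<le> C / (norm x)\<^sup>2" if x: "0 < norm x" "norm x < 1" for k x
  proof -
    have "(norm (d k x *\<^sub>R x))\<^sup>2 \<le> 3\<^sup>2"
    proof (rule power_mono)
      have "\<bar>d k x\<bar> * norm x \<le> (3 / norm x) * norm x" using d_le[OF x] by (intro mult_right_mono) auto
      then show "norm (d k x *\<^sub>R x) \<le> 3" using x by simp
    qed simp
    also have "3\<^sup>2 \<le> 9 / (norm x)\<^sup>2" using le_inverse_square(1)[OF x, of 9] by simp
    finally have 1: "(norm (d k x *\<^sub>R x))\<^sup>2 \<le> 9 / (norm x)\<^sup>2" .
    have 2: "(norm (d k x *\<^sub>R i + (e k x * (x \<bullet> i)) *\<^sub>R x))\<^sup>2 \<le> 64 / (norm x)\<^sup>2" if i: "i \<in> Basis" for i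
    proof -
      have "\<bar>e k x\<bar> * \<bar>x \<bullet> i\<bar> * norm x \<le> (5 / norm x ^ 3) * norm x * norm x"
        using e_le[OF x] Basis_le_norm[OF i] by (intro mult_mono) auto
      also have "\<dots> = 5 / norm x" using x by (simp add: power3_eq_cube)
      finally have "norm ((e k x * (x \<bullet> i)) *\<^sub>R x) \<le> 5 / norm x" by (simp add: abs_mult)
      moreover have "norm (d k x *\<^sub>R i) \<le> 3 / norm x" using d_le[OF x] i by simp
      ultimately have "norm (d k x *\<^sub>R i + (e k x * (x \<bullet> i)) *\<^sub>R x) \<le> 8 / norm x"
        using norm_triangle_ineq[of "d k x *\<^sub>R i" "(e k x * (x \<bullet> i)) *\<^sub>R x"] by linarith
      then have "(norm (d k x *\<^sub>R i + (e k x * (x \<bullet> i)) *\<^sub>R x))\<^sup>2 \<le> (8 / norm x)\<^sup>2"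
        by (intro power_mono) auto
      then show ?thesis by (simp add: power_divide)
    qed
    have "J k x \<le> 9 / (norm x)\<^sup>2 + (\<Sum>i\<in>(Basis::'a set). 64 / (norm x)\<^sup>2)"
      unfolding J_def by (intro add_mono 1 sum_mono 2)
    then show ?thesis by (simp add: C_def add_divide_distrib)
  qed
  have J_lim: "(\<lambda>k. J k x) \<longlonglongrightarrow> 0" if x: "0 < norm x" "norm x < 1" for x
  proof -
    have d0: "(\<lambda>k. d k x) \<longlonglongrightarrow> 0" unfolding d_def using Q_lim[OF x] by (simp add: LIM_zero_iff)
    have e0: "(\<lambda>k. e k x) \<longlonglongrightarrow> 0"
      unfolding e_def using tendsto_mult[OF tendsto_const[of 2] Q'_lim[OF x]] by (simp add: LIM_zero_iff)
    have "(\<lambda>k. J k x) \<longlonglongrightarrow> (norm (0 *\<^sub>R x))\<^sup>2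
        + (\<Sum>i\<in>Basis. (norm (0 *\<^sub>R i + (0 * (x \<bullet> i)) *\<^sub>R x))\<^sup>2)"
      unfolding J_def by (intro tendsto_intros d0 e0)
    then show ?thesis by simp
  qed
  have ae: "AE x in lebesgue_on ?B. 0 < norm x \<and> norm x < 1"
    using AE_lebesgue_on_neq[of ?B "0::'a", simplified] AE_space by eventually_elim auto
  have "(\<lambda>k. \<integral>\<^sup>+ x. ennreal (J k x) \<partial>lebesgue_on ?B) \<longlonglongrightarrow> (\<integral>\<^sup>+ x. 0 \<partial>lebesgue_on ?B)"
  proof (rule nn_integral_dominated_convergence[where w="\<lambda>x. ennreal (C / (norm x)\<^sup>2)"])
    have i: "integrable (lebesgue_on ?B) (\<lambda>x. C / (norm x)\<^sup>2)" by (rule integrable_lebesgue_on_inverse_square[OF dim3])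
    show "(\<lambda>x. ennreal (C / (norm x)\<^sup>2)) \<in> borel_measurable (lebesgue_on ?B)"
      using borel_measurable_integrable[OF i] by simp
    have C0: "0 \<le> C" by (simp add: C_def)
    then show "(\<integral>\<^sup>+ x. ennreal (C / (norm x)\<^sup>2) \<partial>lebesgue_on ?B) < \<infinity>"
      using i unfolding integrable_iff_bounded by simp
    show "AE x in lebesgue_on ?B. ennreal (J k x) \<le> ennreal (C / (norm x)\<^sup>2)" for k
      using ae by eventually_elim (auto intro!: ennreal_leI J_le)
    show "AE x in lebesgue_on ?B. (\<lambda>k. ennreal (J k x)) \<longlonglongrightarrow> 0"
      using ae by eventually_elim (use tendsto_ennrealI[OF J_lim] in auto)
  qed (use J_meas in auto)
  then have conv: "(\<lambda>k. \<integral>\<^sup>+ x. ennreal (J k x) \<partial>lebesgue_on ?B) \<longlonglongrightarrow> 0" by simp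
  have H: "H1_weak_grad ?B v Dv"
    unfolding v_def Dv_def by (rule H1_weak_grad_diff[OF H1_weak_grad_u_rad[OF dim] H1_weak_grad_identity[OF dim3]])
  show ?thesis
    unfolding trace_eq_def H10_def v_def[symmetric] Dv_def[symmetric]
    using H test conv by (intro conjI exI[of _ \<phi>]) (auto simp: J_eq \<phi>_def[symmetric])
qed

end

section \<open>Density and minimality\<close>

lemma test_fun_L2:
  fixes \<phi> :: "'a::euclidean_space \<Rightarrow> 'b::euclidean_space"
  assumes \<phi>: "test_fun (ball 0 r) \<phi>"
  shows "L2_on (ball 0 r) \<phi>" "\<And>i. i \<in> Basis \<Longrightarrow> L2_on (ball 0 r) (\<lambda>x. frechet_derivative \<phi> (at x) i)"
proof -
  obtain C where der: "\<And>x. (\<phi> has_derivative frechet_derivative \<phi> (at x)) (at x)"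
    and cont: "\<And>i. i \<in> Basis \<Longrightarrow> continuous_on UNIV (\<lambda>x. frechet_derivative \<phi> (at x) i)"
    and C: "\<And>x. norm (\<phi> x) \<le> C" "\<And>x i. i \<in> Basis \<Longrightarrow> norm (frechet_derivative \<phi> (at x) i) \<le> C"
    using test_funE[OF \<phi> open_ball] by metis
  have cphi: "continuous_on UNIV \<phi>"
    by (intro continuous_at_imp_continuous_on ballI) (use der has_derivative_continuous in blast)
  have L2: "L2_on (ball 0 r) w" if c: "continuous_on UNIV w" and b: "\<And>x. norm (w x) \<le> C" for w :: "'a \<Rightarrow> 'b"
  proof (rule L2_onI)
    show "w \<in> borel_measurable (lebesgue_on (ball 0 r))"
      using borel_measurable_continuous_onI[OF c] by (intro measurable_restrict_space1 measurable_completion) auto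
    show "integrable (lebesgue_on (ball 0 r)) (\<lambda>x. C\<^sup>2)" by (rule finite_measure.integrable_const[OF finite_measure_lebesgue_on_ball])
    show "AE x in lebesgue_on (ball 0 r). (norm (w x))\<^sup>2 \<le> C\<^sup>2"
      by (intro AE_I2 power_mono b) auto
  qed
  show "L2_on (ball 0 r) \<phi>" by (rule L2[OF cphi C(1)])
  show "L2_on (ball 0 r) (\<lambda>x. frechet_derivative \<phi> (at x) i)" if "i \<in> Basis" for i
    by (rule L2[OF cont[OF that] C(2)[OF that]])
qed

text \<open>Needed to pass from two trace conditions relative to the same boundary extension to a
  difference u - u_eps in H^1_0. The approximating sequences are subtracted, and |a - b|^2 <= 2|a|^2
  + 2|b|^2 controls the error.\<close>

lemma H10_diff:
  fixes v w :: "'a::euclidean_space \<Rightarrow> 'b::euclidean_space"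
  assumes v: "H10 (ball 0 r) v Dv" and w: "H10 (ball 0 r) w Dw"
  shows "H10 (ball 0 r) (\<lambda>x. v x - w x) (\<lambda>x i. Dv x i - Dw x i)"
proof -
  let ?B = "ball (0::'a) r"
  define Z where "Z \<phi> v Dv x = (norm (\<phi> x - v x))\<^sup>2
      + (\<Sum>i\<in>Basis. (norm (frechet_derivative \<phi> (at x) i - Dv x i))\<^sup>2)" for \<phi> v :: "'a \<Rightarrow> 'b" and Dv x
  obtain \<phi> where \<phi>: "\<And>k. test_fun ?B (\<phi> k)" and l1: "(\<lambda>k::nat. \<integral>\<^sup>+ x. ennreal (Z (\<phi> k) v Dv x) \<partial>lebesgue_on ?B) \<longlonglongrightarrow> 0"
    using v unfolding H10_def Z_def by blast
  obtain \<psi> where \<psi>: "\<And>k. test_fun ?B (\<psi> k)" and l2: "(\<lambda>k::nat. \<integral>\<^sup>+ x. ennreal (Z (\<psi> k) w Dw x) \<partial>lebesgue_on ?B) \<longlonglongrightarrow> 0"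
    using w unfolding H10_def Z_def by blast
  have Hv: "H1_weak_grad ?B v Dv" and Hw: "H1_weak_grad ?B w Dw" using v w by (auto simp: H10_def)
  have Zm: "(\<lambda>x. ennreal (Z \<phi> v Dv x)) \<in> borel_measurable (lebesgue_on ?B)"
    if "test_fun ?B \<phi>" "H1_weak_grad ?B v Dv" for \<phi> v Dv
  proof -
    have L2: "L2_on ?B v" "\<And>i. i \<in> Basis \<Longrightarrow> L2_on ?B (\<lambda>x. Dv x i)"
      using that(2) by (simp_all add: H1_weak_grad_def)
    have m: "(\<lambda>x. \<phi> x - v x) \<in> borel_measurable (lebesgue_on ?B)"
      "\<And>i. i \<in> Basis \<Longrightarrow> (\<lambda>x. frechet_derivative \<phi> (at x) i - Dv x i) \<in> borel_measurable (lebesgue_on ?B)"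
      by (intro L2_onD(1) L2_on_diff test_fun_L2 that(1) L2; assumption)+
    have "Z \<phi> v Dv \<in> borel_measurable (lebesgue_on ?B)"
      unfolding Z_def[abs_def]
      by (intro borel_measurable_add borel_measurable_sum borel_measurable_power
          measurable_compose[OF m(1) borel_measurable_norm] measurable_compose[OF m(2) borel_measurable_norm])
    then show ?thesis by simp
  qed
  have Z0: "0 \<le> Z \<phi> v Dv x" for \<phi> v Dv x unfolding Z_def by (auto intro!: add_nonneg_nonneg sum_nonneg)
  have Zle: "Z (\<lambda>x. \<phi> k x - \<psi> k x) (\<lambda>x. v x - w x) (\<lambda>x i. Dv x i - Dw x i) x
      \<le> 2 * Z (\<phi> k) v Dv x + 2 * Z (\<psi> k) w Dw x" for k x
  proof -
    have d: "frechet_derivative (\<lambda>x. \<phi> k x - \<psi> k x) (at x) i = frechet_derivative (\<phi> k) (at x) i - frechet_derivative (\<psi> k) (at x) i" for i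
    proof -
      have "(\<phi> k has_derivative frechet_derivative (\<phi> k) (at x)) (at x)"
        using test_funE[OF \<phi> open_ball] by metis
      moreover have "(\<psi> k has_derivative frechet_derivative (\<psi> k) (at x)) (at x)"
        using test_funE[OF \<psi> open_ball] by metis
      ultimately have "((\<lambda>x. \<phi> k x - \<psi> k x) has_derivative
          (\<lambda>y. frechet_derivative (\<phi> k) (at x) y - frechet_derivative (\<psi> k) (at x) y)) (at x)"
        by (rule has_derivative_diff)
      then show ?thesis by (simp only: frechet_derivative_at[symmetric])
    qed
    have e: "(a - b) - (c - d) = (a - c) - (b - d)" for a b c d :: 'b by simp
    have "Z (\<lambda>x. \<phi> k x - \<psi> k x) (\<lambda>x. v x - w x) (\<lambda>x i. Dv x i - Dw x i) x
      \<le> (2 * (norm (\<phi> k x - v x))\<^sup>2 + 2 * (norm (\<psi> k x - w x))\<^sup>2)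
        + (\<Sum>i\<in>Basis. 2 * (norm (frechet_derivative (\<phi> k) (at x) i - Dv x i))\<^sup>2
           + 2 * (norm (frechet_derivative (\<psi> k) (at x) i - Dw x i))\<^sup>2)"
      unfolding Z_def d e[of "\<phi> k x"] e[of "frechet_derivative (\<phi> k) (at x) _"]
      by (intro add_mono sum_mono norm_diff_square_le)
    then show ?thesis by (simp add: Z_def sum.distrib sum_distrib_left[symmetric] algebra_simps)
  qed
  have "(\<lambda>k. \<integral>\<^sup>+ x. ennreal (Z (\<lambda>x. \<phi> k x - \<psi> k x) (\<lambda>x. v x - w x) (\<lambda>x i. Dv x i - Dw x i) x) \<partial>lebesgue_on ?B) \<longlonglongrightarrow> 0"
  proof (rule tendsto_sandwich[where f="\<lambda>_. 0"])
    show "\<forall>\<^sub>F k in sequentially. (\<integral>\<^sup>+ x. ennreal (Z (\<lambda>x. \<phi> k x - \<psi> k x) (\<lambda>x. v x - w x) (\<lambda>x i. Dv x i - Dw x i) x) \<partial>lebesgue_on ?B)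
       \<le> 2 * (\<integral>\<^sup>+ x. ennreal (Z (\<phi> k) v Dv x) \<partial>lebesgue_on ?B) + 2 * (\<integral>\<^sup>+ x. ennreal (Z (\<psi> k) w Dw x) \<partial>lebesgue_on ?B)"
    proof (rule always_eventually, rule allI)
      fix k
      have "(\<integral>\<^sup>+ x. ennreal (Z (\<lambda>x. \<phi> k x - \<psi> k x) (\<lambda>x. v x - w x) (\<lambda>x i. Dv x i - Dw x i) x) \<partial>lebesgue_on ?B)
        \<le> (\<integral>\<^sup>+ x. 2 * ennreal (Z (\<phi> k) v Dv x) + 2 * ennreal (Z (\<psi> k) w Dw x) \<partial>lebesgue_on ?B)"
      proof (rule nn_integral_mono)
        fix x
        have "ennreal (Z (\<lambda>x. \<phi> k x - \<psi> k x) (\<lambda>x. v x - w x) (\<lambda>x i. Dv x i - Dw x i) x)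
           \<le> ennreal (2 * Z (\<phi> k) v Dv x + 2 * Z (\<psi> k) w Dw x)" by (intro ennreal_leI Zle)
        also have "\<dots> = 2 * ennreal (Z (\<phi> k) v Dv x) + 2 * ennreal (Z (\<psi> k) w Dw x)"
          using Z0 by (simp add: ennreal_plus ennreal_mult del: ennreal_plus[symmetric])
        finally show "ennreal (Z (\<lambda>x. \<phi> k x - \<psi> k x) (\<lambda>x. v x - w x) (\<lambda>x i. Dv x i - Dw x i) x)
           \<le> 2 * ennreal (Z (\<phi> k) v Dv x) + 2 * ennreal (Z (\<psi> k) w Dw x)" .
      qed
      also have "\<dots> = 2 * (\<integral>\<^sup>+ x. ennreal (Z (\<phi> k) v Dv x) \<partial>lebesgue_on ?B) + 2 * (\<integral>\<^sup>+ x. ennreal (Z (\<psi> k) w Dw x) \<partial>lebesgue_on ?B)"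
        using Zm[OF \<phi> Hv] Zm[OF \<psi> Hw]
        by (subst nn_integral_add) (auto simp: nn_integral_cmult intro!: borel_measurable_times_ennreal)
      finally show "(\<integral>\<^sup>+ x. ennreal (Z (\<lambda>x. \<phi> k x - \<psi> k x) (\<lambda>x. v x - w x) (\<lambda>x i. Dv x i - Dw x i) x) \<partial>lebesgue_on ?B)
        \<le> 2 * (\<integral>\<^sup>+ x. ennreal (Z (\<phi> k) v Dv x) \<partial>lebesgue_on ?B) + 2 * (\<integral>\<^sup>+ x. ennreal (Z (\<psi> k) w Dw x) \<partial>lebesgue_on ?B)" .
    qed
    have "(\<lambda>k. 2 * (\<integral>\<^sup>+ x. ennreal (Z (\<phi> k) v Dv x) \<partial>lebesgue_on ?B) + 2 * (\<integral>\<^sup>+ x. ennreal (Z (\<psi> k) w Dw x) \<partial>lebesgue_on ?B)) \<longlonglongrightarrow> 2 * 0 + 2 * 0"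
      by (intro tendsto_add ennreal_tendsto_cmult l1 l2) auto
    then show "(\<lambda>k. 2 * (\<integral>\<^sup>+ x. ennreal (Z (\<phi> k) v Dv x) \<partial>lebesgue_on ?B) + 2 * (\<integral>\<^sup>+ x. ennreal (Z (\<psi> k) w Dw x) \<partial>lebesgue_on ?B)) \<longlonglongrightarrow> 0"
      by simp
  qed auto
  moreover have "test_fun ?B (\<lambda>x. \<phi> k x - \<psi> k x)" for k by (intro test_fun_diff \<phi> \<psi> open_ball)
  ultimately show ?thesis
    unfolding H10_def using H1_weak_grad_diff[OF Hv Hw]
    by (intro conjI exI[of _ "\<lambda>k x. \<phi> k x - \<psi> k x"]) (auto simp: Z_def)
qed

lemma young_inner:
  fixes a b :: "'b::real_inner"
  assumes "0 < \<delta>"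
  shows "\<bar>a \<bullet> b\<bar> \<le> \<delta> * (norm a)\<^sup>2 + (norm b)\<^sup>2 / \<delta>"
proof -
  have "\<bar>a \<bullet> b\<bar> \<le> norm a * norm b" by (rule Cauchy_Schwarz_ineq2)
  also have "\<dots> \<le> 2 * (norm a * norm b)" by simp
  also have "\<dots> \<le> \<delta> * (norm a)\<^sup>2 + (norm b)\<^sup>2 / \<delta>"
  proof -
    have "0 \<le> (\<delta> * norm a - norm b)\<^sup>2 / \<delta>" using assms by simp
    also have "\<dots> = \<delta> * (norm a)\<^sup>2 + (norm b)\<^sup>2 / \<delta> - 2 * (norm a * norm b)"
      using assms by (simp add: power2_eq_square field_simps)
    finally show ?thesis by simp
  qed
  finally show ?thesis .
qed

lemma integrable_inner_L2:
  fixes u v :: "'a::euclidean_space \<Rightarrow> 'b::euclidean_space"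
  assumes u: "L2_on S u" and v: "L2_on S v"
  shows "integrable (lebesgue_on S) (\<lambda>x. u x \<bullet> v x)"
proof (rule Bochner_Integration.integrable_bound)
  show "integrable (lebesgue_on S) (\<lambda>x. (norm (u x))\<^sup>2 + (norm (v x))\<^sup>2)"
    by (intro Bochner_Integration.integrable_add L2_onD(2) u v)
  show "(\<lambda>x. u x \<bullet> v x) \<in> borel_measurable (lebesgue_on S)"
    by (intro borel_measurable_inner L2_onD(1) u v)
  show "AE x in lebesgue_on S. norm (u x \<bullet> v x) \<le> norm ((norm (u x))\<^sup>2 + (norm (v x))\<^sup>2)"
    using young_inner[of 1] by (intro AE_I2) simp
qed

context radial_profile
begin

lemma integrable_V_mult:
  fixes g :: "'a::euclidean_space \<Rightarrow> real"
  assumes g: "integrable (lebesgue_on (ball 0 1)) g"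
  shows "integrable (lebesgue_on (ball 0 1)) (\<lambda>x. V (norm x) * g x)"
proof (rule Bochner_Integration.integrable_bound)
  show "integrable (lebesgue_on (ball 0 1)) (\<lambda>x. M * g x)" by (intro integrable_mult_right g)
  have "(\<lambda>x::'a. V (norm x)) \<in> borel_measurable (lebesgue_on (ball 0 1))"
    by (rule borel_measurable_lebesgue_on_punctured[OF continuous_on_radial[OF V_cont] open_ball])
  then show "(\<lambda>x. V (norm x) * g x) \<in> borel_measurable (lebesgue_on (ball 0 1))"
    by (intro borel_measurable_times borel_measurable_integrable[OF g])
  show "AE x in lebesgue_on (ball 0 1). norm (V (norm x) * g x) \<le> norm (M * g x)"
    using AE_lebesgue_on_neq[of "ball 0 1" "0::'a", simplified] AE_space
  proof eventually_elim
    fix x :: 'a assume "x \<noteq> 0" "x \<in> space (lebesgue_on (ball 0 1))"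
    then have x: "0 < norm x" "norm x < 1" by auto
    have "\<bar>V (norm x)\<bar> * \<bar>g x\<bar> \<le> \<bar>M\<bar> * \<bar>g x\<bar>"
      using V_nonneg[OF x] V_le[OF x] by (intro mult_right_mono) auto
    then show "norm (V (norm x) * g x) \<le> norm (M * g x)" by (simp add: abs_mult)
  qed
qed

text \<open>Lower bound for the energy excess at \<open>u_rad + v\<close>, up to the coercive term \<open>|v|^2 / 8\<close>.\<close>
definition excess ::
  "('a::euclidean_space \<Rightarrow> 'a \<times> 'c::euclidean_space) \<Rightarrow> ('a \<Rightarrow> 'a \<Rightarrow> 'a \<times> 'c) \<Rightarrow> 'a \<Rightarrow> real" where
  "excess v Dv x = ((\<Sum>i\<in>Basis. Du_rad x i \<bullet> Dv x i) - V (norm x) * (u_rad x \<bullet> v x))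
     + 1/2 * ((\<Sum>i\<in>Basis. (norm (Dv x i))\<^sup>2) - (V (norm x) + 1/4) * (norm (v x))\<^sup>2)"

lemma integrable_excess_parts:
  fixes v :: "'a::euclidean_space \<Rightarrow> 'a \<times> 'c::euclidean_space" and Dv :: "'a \<Rightarrow> 'a \<Rightarrow> 'a \<times> 'c"
  assumes dim: "DIM('a) = N" and v: "L2_on (ball 0 1) v" and Dv: "\<And>i. i \<in> Basis \<Longrightarrow> L2_on (ball 0 1) (\<lambda>x. Dv x i)"
  shows "integrable (lebesgue_on (ball 0 1)) (\<lambda>x. (\<Sum>i\<in>Basis. Du_rad x i \<bullet> Dv x i) - V (norm x) * (u_rad x \<bullet> v x))"
    "integrable (lebesgue_on (ball 0 1)) (\<lambda>x. (\<Sum>i\<in>Basis. (norm (Dv x i))\<^sup>2) - (V (norm x) + 1/4) * (norm (v x))\<^sup>2)"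
proof -
  have u: "L2_on (ball 0 1) (u_rad :: 'a \<Rightarrow> 'a \<times> 'c)"
    and Du: "\<And>i. i \<in> Basis \<Longrightarrow> L2_on (ball 0 1) (\<lambda>x::'a. (Du_rad x i :: 'a \<times> 'c))"
    using H1_weak_grad_u_rad[OF dim, where 'c='c] unfolding H1_weak_grad_def by blast+
  show "integrable (lebesgue_on (ball 0 1)) (\<lambda>x. (\<Sum>i\<in>Basis. Du_rad x i \<bullet> Dv x i) - V (norm x) * (u_rad x \<bullet> v x))"
    by (intro Bochner_Integration.integrable_diff Bochner_Integration.integrable_sum integrable_V_mult integrable_inner_L2 u Du v Dv)
  show "integrable (lebesgue_on (ball 0 1)) (\<lambda>x. (\<Sum>i\<in>Basis. (norm (Dv x i))\<^sup>2) - (V (norm x) + 1/4) * (norm (v x))\<^sup>2)"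
    unfolding ring_distribs
    by (intro Bochner_Integration.integrable_diff Bochner_Integration.integrable_add Bochner_Integration.integrable_sum
        integrable_mult_right integrable_V_mult L2_onD(2) v Dv)
qed

lemma integrable_excess:
  fixes v :: "'a::euclidean_space \<Rightarrow> 'a \<times> 'c::euclidean_space" and Dv :: "'a \<Rightarrow> 'a \<Rightarrow> 'a \<times> 'c"
  assumes dim: "DIM('a) = N" and v: "L2_on (ball 0 1) v" and Dv: "\<And>i. i \<in> Basis \<Longrightarrow> L2_on (ball 0 1) (\<lambda>x. Dv x i)"
  shows "integrable (lebesgue_on (ball 0 1)) (excess v Dv)"
  unfolding excess_def[abs_def]
  by (intro Bochner_Integration.integrable_add integrable_mult_right integrable_excess_parts assms)

text \<open>The linear part integrates to 0 by the Euler-Lagrange equation, the quadratic part is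
  nonnegative by the Hardy-type inequality.\<close>

lemma excess_test_nonneg:
  fixes \<phi> :: "'a::euclidean_space \<Rightarrow> 'a \<times> 'c::euclidean_space"
  assumes dim: "DIM('a) = N" and \<phi>: "test_fun (ball 0 1) \<phi>"
  shows "0 \<le> (\<integral>x. excess \<phi> (\<lambda>x. frechet_derivative \<phi> (at x)) x \<partial>lebesgue_on (ball 0 1))"
proof -
  note i = integrable_excess_parts[OF dim test_fun_L2[OF \<phi>]]
  show ?thesis
    unfolding excess_def
    using euler_lagrange_test[OF dim \<phi>] hardy_test[OF dim \<phi>]
    by (subst Bochner_Integration.integral_add[OF i(1) integrable_mult_right[OF i(2)]]) simp_all
qed

text \<open>Every mixed product is split by Young's inequality with weight \<delta>: the fixed
  functions carry the small factor \<delta>, the approximation error carries 1/\<delta>. After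
  integration the error can be sent to 0 before \<delta>.\<close>

lemma excess_perturbation:
  fixes v :: "'a::euclidean_space \<Rightarrow> 'a \<times> 'c::euclidean_space" and Dv :: "'a \<Rightarrow> 'a \<Rightarrow> 'a \<times> 'c"
  assumes x: "0 < norm x" "norm x < 1" and \<delta>: "0 < \<delta>" "\<delta> \<le> 1"
  shows "excess \<phi> D\<phi> x - \<delta> * ((\<Sum>i\<in>Basis. (norm (Du_rad x i :: 'a \<times> 'c))\<^sup>2 + (norm (Dv x i))\<^sup>2)
       + (M + 1) * ((norm (u_rad x :: 'a \<times> 'c))\<^sup>2 + (norm (v x))\<^sup>2))
     - (2 * M + 5) / \<delta> * ((norm (\<phi> x - v x))\<^sup>2 + (\<Sum>i\<in>Basis. (norm (D\<phi> x i - Dv x i))\<^sup>2))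
    \<le> excess v Dv x"
proof -
  define z where "z = \<phi> x - v x"
  define dz where "dz i = D\<phi> x i - Dv x i" for i
  define U where "U = (u_rad x :: 'a \<times> 'c)"
  define A where "A i = (Du_rad x i :: 'a \<times> 'c)" for i
  define VV where "VV = V (norm x)"
  have \<phi>: "\<phi> x = v x + z" and D\<phi>: "\<And>i. D\<phi> x i = Dv x i + dz i" by (auto simp: z_def dz_def)
  have VV: "0 \<le> VV" "VV \<le> M" using V_nonneg[OF x] V_le[OF x] by (auto simp: VV_def)
  have sq: "(norm (a + b))\<^sup>2 = (norm a)\<^sup>2 + 2 * (a \<bullet> b) + (norm b)\<^sup>2" for a b :: "'a \<times> 'c"
    unfolding power2_norm_eq_inner by (simp add: inner_add_left inner_add_right inner_commute)
  have e\<phi>: "excess \<phi> D\<phi> x = (\<Sum>i\<in>Basis. A i \<bullet> Dv x i + A i \<bullet> dz i) - VV * (U \<bullet> v x + U \<bullet> z)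
     + 1/2 * ((\<Sum>i\<in>Basis. (norm (Dv x i))\<^sup>2 + 2 * (Dv x i \<bullet> dz i) + (norm (dz i))\<^sup>2)
        - (VV + 1/4) * ((norm (v x))\<^sup>2 + 2 * (v x \<bullet> z) + (norm z)\<^sup>2))"
    unfolding excess_def \<phi> D\<phi> sq inner_add_right A_def U_def VV_def by simp
  have ev: "excess v Dv x = (\<Sum>i\<in>Basis. A i \<bullet> Dv x i) - VV * (U \<bullet> v x)
     + 1/2 * ((\<Sum>i\<in>Basis. (norm (Dv x i))\<^sup>2) - (VV + 1/4) * (norm (v x))\<^sup>2)"
    unfolding excess_def A_def U_def VV_def by simp
  have split: "excess \<phi> D\<phi> x = excess v Dv x + (\<Sum>i\<in>Basis. A i \<bullet> dz i + Dv x i \<bullet> dz i + 1/2 * (norm (dz i))\<^sup>2)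
      - VV * (U \<bullet> z) - (VV + 1/4) * (v x \<bullet> z) - 1/2 * ((VV + 1/4) * (norm z)\<^sup>2)"
    unfolding e\<phi> ev by (simp add: sum.distrib sum_distrib_left[symmetric] algebra_simps sum_divide_distrib[symmetric])
  have "(\<Sum>i\<in>Basis. A i \<bullet> dz i + Dv x i \<bullet> dz i + 1/2 * (norm (dz i))\<^sup>2)
      \<le> (\<Sum>i\<in>Basis. \<delta> * ((norm (A i))\<^sup>2 + (norm (Dv x i))\<^sup>2) + 3 / \<delta> * (norm (dz i))\<^sup>2)"
  proof (rule sum_mono)
    fix i :: 'a
    \<comment> \<open>With \<delta> <= 1 the pure square of \<open>dz i\<close> fits into a term
      with 1/\<delta>; together with the two Young terms this gives the coefficient
      3/\<delta>.\<close>
    have "(norm (dz i))\<^sup>2 * \<delta> \<le> (norm (dz i))\<^sup>2 * 1" using \<delta> by (intro mult_left_mono) auto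
    then have "(norm (dz i))\<^sup>2 \<le> (norm (dz i))\<^sup>2 / \<delta>" using \<delta> by (simp add: pos_le_divide_eq)
    then have "A i \<bullet> dz i + Dv x i \<bullet> dz i + 1/2 * (norm (dz i))\<^sup>2
      \<le> (\<delta> * (norm (A i))\<^sup>2 + (norm (dz i))\<^sup>2 / \<delta>) + (\<delta> * (norm (Dv x i))\<^sup>2 + (norm (dz i))\<^sup>2 / \<delta>) + (norm (dz i))\<^sup>2 / \<delta>"
      using young_inner[OF \<delta>(1), of "A i" "dz i"] young_inner[OF \<delta>(1), of "Dv x i" "dz i"] zero_le_power2[of "norm (dz i)"]
      by linarith
    then show "A i \<bullet> dz i + Dv x i \<bullet> dz i + 1/2 * (norm (dz i))\<^sup>2
      \<le> \<delta> * ((norm (A i))\<^sup>2 + (norm (Dv x i))\<^sup>2) + 3 / \<delta> * (norm (dz i))\<^sup>2"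
      by (simp add: algebra_simps)
  qed
  also have "\<dots> = \<delta> * (\<Sum>i\<in>Basis. (norm (A i))\<^sup>2 + (norm (Dv x i))\<^sup>2) + 3 / \<delta> * (\<Sum>i\<in>Basis. (norm (dz i))\<^sup>2)"
    by (simp only: sum.distrib sum_distrib_left[symmetric])
  finally have 1: "(\<Sum>i\<in>Basis. A i \<bullet> dz i + Dv x i \<bullet> dz i + 1/2 * (norm (dz i))\<^sup>2)
    \<le> \<delta> * (\<Sum>i\<in>Basis. (norm (A i))\<^sup>2 + (norm (Dv x i))\<^sup>2) + 3 / \<delta> * (\<Sum>i\<in>Basis. (norm (dz i))\<^sup>2)" .
  have pt: "- (c * (a \<bullet> z)) \<le> (M + 1) * (\<delta> * (norm a)\<^sup>2 + (norm z)\<^sup>2 / \<delta>)" if c: "0 \<le> c" "c \<le> M + 1" for c and a :: "'a \<times> 'c"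
  proof -
    have "- (c * (a \<bullet> z)) \<le> c * \<bar>a \<bullet> z\<bar>" using mult_left_mono[of "- (a \<bullet> z)" "\<bar>a \<bullet> z\<bar>" c] c by simp
    also have "\<dots> \<le> (M + 1) * (\<delta> * (norm a)\<^sup>2 + (norm z)\<^sup>2 / \<delta>)"
      using c M_nonneg young_inner[OF \<delta>(1), of a z] by (intro mult_mono) auto
    finally show ?thesis .
  qed
  have 2: "- (VV * (U \<bullet> z)) - (VV + 1/4) * (v x \<bullet> z)
     \<le> (M + 1) * (\<delta> * (norm U)\<^sup>2 + (norm z)\<^sup>2 / \<delta>) + (M + 1) * (\<delta> * (norm (v x))\<^sup>2 + (norm z)\<^sup>2 / \<delta>)"
    using pt[of VV U] pt[of "VV + 1/4" "v x"] VV by linarith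
  have 3: "0 \<le> 1/2 * ((VV + 1/4) * (norm z)\<^sup>2)" using VV by simp
  have 4: "0 \<le> (norm z)\<^sup>2 / \<delta>" "0 \<le> (2 * M + 2) * ((\<Sum>i\<in>Basis. (norm (dz i))\<^sup>2) / \<delta>)"
    using \<delta> M_nonneg by (auto intro!: mult_nonneg_nonneg divide_nonneg_nonneg sum_nonneg)
  \<comment> \<open>The constant \<open>2 * M + 5\<close> is the sum of \<open>2 * M + 2\<close>,
    produced by \<open>z\<close>, and 3, produced by \<open>dz\<close>. The surplus on either part
    is nonnegative by \<open>4\<close>.\<close>
  have 5: "\<delta> * ((\<Sum>i\<in>Basis. (norm (A i))\<^sup>2 + (norm (Dv x i))\<^sup>2) + (M + 1) * ((norm U)\<^sup>2 + (norm (v x))\<^sup>2))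
     + (2 * M + 5) / \<delta> * ((norm z)\<^sup>2 + (\<Sum>i\<in>Basis. (norm (dz i))\<^sup>2))
    = (\<delta> * (\<Sum>i\<in>Basis. (norm (A i))\<^sup>2 + (norm (Dv x i))\<^sup>2) + 3 / \<delta> * (\<Sum>i\<in>Basis. (norm (dz i))\<^sup>2))
     + ((M + 1) * (\<delta> * (norm U)\<^sup>2 + (norm z)\<^sup>2 / \<delta>) + (M + 1) * (\<delta> * (norm (v x))\<^sup>2 + (norm z)\<^sup>2 / \<delta>))
     + 3 * ((norm z)\<^sup>2 / \<delta>) + (2 * M + 2) * ((\<Sum>i\<in>Basis. (norm (dz i))\<^sup>2) / \<delta>)"
    using \<delta>(1) by (simp add: field_simps)
  show ?thesis
    using split 1 2 3 4 5 unfolding z_def[symmetric] dz_def[symmetric] A_def[symmetric] U_def[symmetric] by linarith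
qed

text \<open>Two successive limits in the perturbation estimate: along the approximating test
  functions with \<delta> fixed, where the term with 1/\<delta> disappears, and then \<delta> to
  0.\<close>

lemma excess_nonneg:
  fixes v :: "'a::euclidean_space \<Rightarrow> 'a \<times> 'c::euclidean_space" and Dv :: "'a \<Rightarrow> 'a \<Rightarrow> 'a \<times> 'c"
  assumes dim: "DIM('a) = N" and v: "H10 (ball 0 1) v Dv"
  shows "0 \<le> (\<integral>x. excess v Dv x \<partial>lebesgue_on (ball 0 1))"
proof -
  let ?B = "ball (0::'a) 1"
  have L2v: "L2_on ?B v" "\<And>i. i \<in> Basis \<Longrightarrow> L2_on ?B (\<lambda>x. Dv x i)"
    using v by (auto simp: H10_def H1_weak_grad_def)
  have L2u: "L2_on ?B (u_rad :: 'a \<Rightarrow> 'a \<times> 'c)" "\<And>i. i \<in> Basis \<Longrightarrow> L2_on ?B (\<lambda>x::'a. (Du_rad x i :: 'a \<times> 'c))"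
    using H1_weak_grad_u_rad[OF dim, where 'c='c] unfolding H1_weak_grad_def by blast+
  define Z where "Z \<phi> x = (norm (\<phi> x - v x))\<^sup>2
      + (\<Sum>i\<in>Basis. (norm (frechet_derivative \<phi> (at x) i - Dv x i))\<^sup>2)" for \<phi> x
  obtain \<phi> where \<phi>: "\<And>k. test_fun ?B (\<phi> k)" and lim: "(\<lambda>k::nat. \<integral>\<^sup>+ x. ennreal (Z (\<phi> k) x) \<partial>lebesgue_on ?B) \<longlonglongrightarrow> 0"
    using v unfolding H10_def Z_def by blast
  have Zi: "integrable (lebesgue_on ?B) (Z (\<phi> k))" for k
    unfolding Z_def[abs_def]
    by (intro Bochner_Integration.integrable_add Bochner_Integration.integrable_sum L2_onD(2) L2_on_diff test_fun_L2 \<phi> L2v)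
  have Z0: "0 \<le> Z \<phi> x" for \<phi> x unfolding Z_def by (auto intro!: add_nonneg_nonneg sum_nonneg)
  define \<zeta> where "\<zeta> k = (\<integral>x. Z (\<phi> k) x \<partial>lebesgue_on ?B)" for k
  have "(\<integral>\<^sup>+ x. ennreal (Z (\<phi> k) x) \<partial>lebesgue_on ?B) = ennreal (\<zeta> k)" for k
    unfolding \<zeta>_def by (rule nn_integral_eq_integral[OF Zi]) (use Z0 in auto)
  then have "(\<lambda>k. ennreal (\<zeta> k)) \<longlonglongrightarrow> ennreal 0" using lim by simp
  then have \<zeta>: "\<zeta> \<longlonglongrightarrow> 0"
    by (rule tendsto_ennrealD) (auto simp: \<zeta>_def intro!: always_eventually integral_nonneg_AE Z0)
  define \<Phi> where "\<Phi> x = (\<Sum>i\<in>Basis. (norm (Du_rad x i :: 'a \<times> 'c))\<^sup>2 + (norm (Dv x i))\<^sup>2)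
       + (M + 1) * ((norm (u_rad x :: 'a \<times> 'c))\<^sup>2 + (norm (v x))\<^sup>2)" for x
  have \<Phi>i: "integrable (lebesgue_on ?B) \<Phi>"
    unfolding \<Phi>_def[abs_def]
    by (intro Bochner_Integration.integrable_add Bochner_Integration.integrable_sum integrable_mult_right L2_onD(2) L2v L2u)
  define I where "I = (\<integral>x. \<Phi> x \<partial>lebesgue_on ?B)"
  define J where "J = (\<integral>x. excess v Dv x \<partial>lebesgue_on ?B)"
  have step: "- (\<delta> * I) - (2 * M + 5) / \<delta> * \<zeta> k \<le> J" if \<delta>: "0 < \<delta>" "\<delta> \<le> 1" for \<delta> k
  proof -
    define E where "E = excess (\<phi> k) (\<lambda>x. frechet_derivative (\<phi> k) (at x))"
    have Ei: "integrable (lebesgue_on ?B) E" unfolding E_def by (rule integrable_excess[OF dim test_fun_L2[OF \<phi>]])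
    have "(\<integral>x. E x - \<delta> * \<Phi> x - (2 * M + 5) / \<delta> * Z (\<phi> k) x \<partial>lebesgue_on ?B) \<le> J"
      unfolding J_def
    proof (rule integral_mono_AE)
      show "integrable (lebesgue_on ?B) (\<lambda>x. E x - \<delta> * \<Phi> x - (2 * M + 5) / \<delta> * Z (\<phi> k) x)"
        by (intro Bochner_Integration.integrable_diff integrable_mult_right Ei \<Phi>i Zi)
      show "integrable (lebesgue_on ?B) (excess v Dv)" by (rule integrable_excess[OF dim L2v])
      show "AE x in lebesgue_on ?B. E x - \<delta> * \<Phi> x - (2 * M + 5) / \<delta> * Z (\<phi> k) x \<le> excess v Dv x"
        using AE_lebesgue_on_neq[of ?B "0::'a", simplified] AE_space
      proof eventually_elim
        fix x :: 'a assume "x \<noteq> 0" "x \<in> space (lebesgue_on ?B)"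
        then have "0 < norm x" "norm x < 1" by auto
        from excess_perturbation[OF this \<delta>, of "\<phi> k" "\<lambda>x. frechet_derivative (\<phi> k) (at x)" Dv v]
        show "E x - \<delta> * \<Phi> x - (2 * M + 5) / \<delta> * Z (\<phi> k) x \<le> excess v Dv x"
          unfolding E_def \<Phi>_def Z_def .
      qed
    qed
    also have "(\<integral>x. E x - \<delta> * \<Phi> x - (2 * M + 5) / \<delta> * Z (\<phi> k) x \<partial>lebesgue_on ?B)
        = (\<integral>x. E x \<partial>lebesgue_on ?B) - \<delta> * I - (2 * M + 5) / \<delta> * \<zeta> k"
      unfolding I_def \<zeta>_def using Ei \<Phi>i Zi by simp
    finally show ?thesis using excess_test_nonneg[OF dim \<phi>, of k] by (simp add: E_def)
  qed
  have "- (\<delta> * I) \<le> J" if \<delta>: "0 < \<delta>" "\<delta> \<le> 1" for \<delta>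
  proof (rule tendsto_upperbound)
    have "(\<lambda>k. - (\<delta> * I) - (2 * M + 5) / \<delta> * \<zeta> k) \<longlonglongrightarrow> - (\<delta> * I) - (2 * M + 5) / \<delta> * 0"
      by (intro tendsto_intros \<zeta>)
    then show "(\<lambda>k. - (\<delta> * I) - (2 * M + 5) / \<delta> * \<zeta> k) \<longlonglongrightarrow> - (\<delta> * I)" by simp
  qed (use step[OF \<delta>] in auto)
  then have ev: "\<forall>\<^sub>F \<delta> in at_right 0. - (\<delta> * I) \<le> J"
    unfolding eventually_at_right_field by (intro exI[of _ 1]) auto
  have "((\<lambda>\<delta>. - (\<delta> * I)) \<longlongrightarrow> - (0 * I)) (at_right 0)" by (intro tendsto_intros)
  then have "- (0 * I) \<le> J" by (rule tendsto_upperbound[OF _ ev]) simp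
  then show ?thesis by (simp add: J_def)
qed

end

section \<open>Convexity of the potential and comparison of energies\<close>

lemma strictly_convex_on_imp_convex_on:
  assumes "strictly_convex_on S f" "convex S"
  shows "convex_on S f"
proof (rule convex_onI)
  fix t x y :: real assume a: "0 < t" "t < 1" "x \<in> S" "y \<in> S"
  show "f ((1 - t) *\<^sub>R x + t *\<^sub>R y) \<le> (1 - t) * f x + t * f y"
  proof (cases "x = y")
    case True
    have "(1 - t) * z + t * z = z" for z by (simp add: left_diff_distrib)
    then show ?thesis using True by simp
  next
    case False
    then have "y \<noteq> x \<and> 0 < t \<and> t < 1" using a by simp
    from assms(1)[unfolded strictly_convex_on_def, rule_format, OF a(4) a(3) this]
    have "f ((1 - t) * x + t * y) < (1 - t) * f x + t * f y" by (simp only: add.commute)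
    then show ?thesis by simp
  qed
qed (rule assms)

text \<open>The target R^n is modelled as R^m x R^k with k = n - m, which is positive because index
  types are nonempty. The pointwise bound e(u) >= e(u_eps) + excess + |v|^2 / 8, once integrated,
  yields minimality and uniqueness together.\<close>

theorem theorem1p5:
  fixes W W' :: "real \<Rightarrow> real"
    and \<epsilon> :: real
    and h :: "real \<Rightarrow> real"
  assumes W_deriv: "\<And>t. t \<le> 1 \<Longrightarrow> (W has_real_derivative W' t) (at t within {..1})"
    and W'_cont: "continuous_on {..1} W'"
    and W0: "W 0 = 0"
    and Wpos: "\<And>t. t \<le> 1 \<Longrightarrow> t \<noteq> 0 \<Longrightarrow> W t > 0"
    and Wconv: "strictly_convex_on {..1} W"
    and m_ge: "CARD('m::finite) \<ge> 7"
    and eps: "\<epsilon> > 0"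
    and h_cont: "continuous_on {0..1} h"
    and h_ode: "\<exists>h' h''. \<forall>r\<in>{0<..<1}. (h has_real_derivative h' r) (at r)
        \<and> (h' has_real_derivative h'' r) (at r)
        \<and> - h'' r - (real CARD('m) - 1) / r * h' r + (real CARD('m) - 1) / r\<^sup>2 * h r
            = h r / \<epsilon>\<^sup>2 * W' (1 - (h r)\<^sup>2)"
    and h0: "h 0 = 0" and h1: "h 1 = 1"
    and h_incr: "strict_mono_on {0..1} h"
    and h_pos: "\<And>r. r \<in> {0<..1} \<Longrightarrow> h r > 0"
  shows "let B = ball (0::real^'m) 1;
             u\<^sub>\<epsilon> = (\<lambda>x. (h (norm x) *\<^sub>R sgn x, 0::real^'k::finite));
             g = (\<lambda>x. (x, 0::real^'k));
             Dg = (\<lambda>x i. (i, 0::real^'k))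
         in \<exists>Du\<^sub>\<epsilon>. H1_weak_grad B u\<^sub>\<epsilon> Du\<^sub>\<epsilon> \<and> trace_eq B u\<^sub>\<epsilon> Du\<^sub>\<epsilon> g Dg
             \<and> (\<forall>u Du. H1_weak_grad B u Du \<and> trace_eq B u Du g Dg \<longrightarrow>
                  GL_energy W \<epsilon> B u\<^sub>\<epsilon> Du\<^sub>\<epsilon> \<le> GL_energy W \<epsilon> B u Du
                  \<and> (GL_energy W \<epsilon> B u Du = GL_energy W \<epsilon> B u\<^sub>\<epsilon> Du\<^sub>\<epsilon>
                       \<longrightarrow> (AE x in lebesgue_on B. u x = u\<^sub>\<epsilon> x)))"
proof -
  define N where "N = CARD('m)"
  have dim: "DIM(real^'m) = N" by (simp add: N_def)
  obtain h' h'' where H: "\<And>r. r \<in> {0<..<1} \<Longrightarrow> (h has_real_derivative h' r) (at r)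
        \<and> (h' has_real_derivative h'' r) (at r)
        \<and> - h'' r - (real N - 1) / r * h' r + (real N - 1) / r\<^sup>2 * h r
            = h r / \<epsilon>\<^sup>2 * W' (1 - (h r)\<^sup>2)"
    using h_ode unfolding N_def by blast
  define V where "V r = W' (1 - (h r)\<^sup>2) / \<epsilon>\<^sup>2" for r
  have hp: "0 < h r" if "0 < r" "r < 1" for r using h_pos[of r] that by simp
  have hl: "h r < 1" if "0 < r" "r < 1" for r
    using strict_mono_onD[OF h_incr, of r 1] that h1 by simp
  have hs: "0 < 1 - (h r)\<^sup>2" "1 - (h r)\<^sup>2 < 1" if "0 < r" "r < 1" for r
    using hp[OF that] hl[OF that] power_strict_mono[of "h r" 1 2] by auto
  have Wcx: "convex_on {..1} W" by (rule strictly_convex_on_imp_convex_on[OF Wconv]) simp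
  \<comment> \<open>The condition s < 1 puts s in the interior of the domain of \<open>W\<close>. It
    holds for s = 1 - h^2 at every point of the ball except the origin, where h = 0.\<close>
  have tangent: "W t \<ge> W s + W' s * (t - s)" if "s < 1" "t \<le> 1" for s t
  proof -
    have "W t - W s \<ge> W' s * (t - s)"
    proof (rule convex_on_imp_above_tangent[OF Wcx])
      show "s \<in> interior {..1}" using that by simp
      show "(W has_field_derivative W' s) (at s within {..1})" using W_deriv[of s] that by simp
    qed (use that in auto)
    then show ?thesis by linarith
  qed
  have W_nonneg: "0 \<le> W t" if "t \<le> 1" for t using W0 Wpos[OF that] by (cases "t = 0") auto
  \<comment> \<open>The tangent at s, evaluated at 0 where \<open>W\<close> vanishes, gives W s <= s
    W'(s), and W s > 0.\<close>
  have W'_nonneg: "0 \<le> W' s" if s: "0 < s" "s < 1" for s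
  proof -
    have "W s \<le> W' s * s" using tangent[of s 0] s W0 by simp
    then have "0 < W' s * s" using Wpos[of s] s by auto
    then show ?thesis using s by (simp add: zero_less_mult_iff)
  qed
  have "compact (W' ` {0..1})"
    by (intro compact_continuous_image continuous_on_subset[OF W'_cont]) auto
  then have "bounded (W' ` {0..1})" by (rule compact_imp_bounded)
  then obtain C where C: "\<And>s. s \<in> {0..1} \<Longrightarrow> W' s \<le> C"
    unfolding bounded_iff by (metis abs_le_D1 image_eqI real_norm_def)
  interpret radial_profile N h h' h'' V "C / \<epsilon>\<^sup>2"
  proof
    show "N \<ge> 7" using m_ge by (simp add: N_def)
    show "continuous_on {0<..<1} V"
      unfolding V_def using eps
      by (intro continuous_intros continuous_on_compose2[OF W'_cont] continuous_on_subset[OF h_cont]) auto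
    fix r :: real assume r: "0 < r" "r < 1"
    show "(h has_real_derivative h' r) (at r)" "(h' has_real_derivative h'' r) (at r)"
      "- h'' r - (real N - 1) / r * h' r + (real N - 1) / r\<^sup>2 * h r = h r * V r"
      using H[of r] r by (auto simp: V_def)
    show "0 \<le> V r" "V r \<le> C / \<epsilon>\<^sup>2"
      unfolding V_def using W'_nonneg[OF hs[OF r]] C[of "1 - (h r)\<^sup>2"] hs[OF r] eps
      by (auto intro!: divide_right_mono)
    show "0 < h r" "h r < 1" using hp[OF r] hl[OF r] .
    show "0 \<le> h' r"
    proof (rule mono_on_imp_deriv_nonneg[of "{0..1}" h])
      show "mono_on {0..1} h" using h_incr by (rule strict_mono_on_imp_mono_on)
      show "(h has_real_derivative h' r) (at r)" using H[of r] r by auto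
    qed (use r in auto)
  qed (use h_cont h0 h1 in auto)
  let ?B = "ball (0::real^'m) 1"
  let ?u = "u_rad :: real^'m \<Rightarrow> (real^'m) \<times> (real^'k)"
  let ?Du = "Du_rad :: real^'m \<Rightarrow> real^'m \<Rightarrow> (real^'m) \<times> (real^'k)"
  have nu: "norm (?u x) = h (norm x)" if "norm x < 1" for x by (rule norm_u_rad[OF that])
  define e where "e u Du x = 1/2 * (\<Sum>i\<in>Basis. (norm (Du x i))\<^sup>2) + 1 / (2 * \<epsilon>\<^sup>2) * W (1 - (norm (u x))\<^sup>2)"
    for u :: "real^'m \<Rightarrow> (real^'m) \<times> (real^'k)" and Du :: "real^'m \<Rightarrow> real^'m \<Rightarrow> (real^'m) \<times> (real^'k)" and x
  have GL: "GL_energy W \<epsilon> ?B u Du = (\<integral>\<^sup>+ x. ennreal (e u Du x) \<partial>lebesgue_on ?B)" for u Du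
    by (simp add: GL_energy_def e_def)
  have e0: "0 \<le> e u Du x" for u Du x
    unfolding e_def using W_nonneg by (auto intro!: add_nonneg_nonneg mult_nonneg_nonneg sum_nonneg)
  have W_cont: "continuous_on {..1} W"
    by (intro continuous_on_vector_derivative[where f'=W'])
       (use W_deriv in \<open>auto simp: has_real_derivative_iff_has_vector_derivative\<close>)
  have e_meas: "e u Du \<in> borel_measurable (lebesgue_on ?B)" if u: "H1_weak_grad ?B u Du" for u Du
  proof -
    have m: "u \<in> borel_measurable (lebesgue_on ?B)" "\<And>i. i \<in> Basis \<Longrightarrow> (\<lambda>x. Du x i) \<in> borel_measurable (lebesgue_on ?B)"
      using u unfolding H1_weak_grad_def by (blast intro: L2_onD(1))+
    \<comment> \<open>The minimum changes nothing, as 1 - t^2 <= 1; it only makes visible that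
      \<open>W\<close> is evaluated in its domain, so that the composition is continuous on the
      whole line.\<close>
    have min1: "min 1 (1 - t\<^sup>2) = 1 - t\<^sup>2" for t :: real by (rule min_absorb2) simp
    have "continuous_on UNIV (\<lambda>t. W (min 1 (1 - t\<^sup>2)))"
      by (intro continuous_on_compose2[OF W_cont] continuous_intros) auto
    then have "(\<lambda>t. W (min 1 (1 - t\<^sup>2))) \<in> borel_measurable borel" by (rule borel_measurable_continuous_onI)
    then have "(\<lambda>x. W (min 1 (1 - (norm (u x))\<^sup>2))) \<in> borel_measurable (lebesgue_on ?B)"
      by (rule measurable_compose[OF measurable_compose[OF m(1) borel_measurable_norm]])
    then have "(\<lambda>x. W (1 - (norm (u x))\<^sup>2)) \<in> borel_measurable (lebesgue_on ?B)" by (simp only: min1)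
    then show ?thesis unfolding e_def[abs_def]
      by (intro borel_measurable_add borel_measurable_times borel_measurable_const borel_measurable_sum
          borel_measurable_power measurable_compose[OF m(2) borel_measurable_norm])
  qed
  have H1: "H1_weak_grad ?B ?u ?Du" by (rule H1_weak_grad_u_rad[OF dim])
  have tr: "trace_eq ?B ?u ?Du (\<lambda>x. (x, 0)) (\<lambda>x i. (i, 0))" by (rule trace_eq_u_rad[OF dim])
  have ae: "AE x in lebesgue_on ?B. 0 < norm x \<and> norm x < 1"
    using AE_lebesgue_on_neq[of ?B "0::real^'m", simplified] AE_space by eventually_elim auto
  have "compact (W ` {0..1})"
    by (intro compact_continuous_image continuous_on_subset[OF W_cont]) auto
  then have "bounded (W ` {0..1})" by (rule compact_imp_bounded)
  then obtain K where K: "\<And>s. s \<in> {0..1} \<Longrightarrow> W s \<le> K"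
    unfolding bounded_iff by (metis abs_le_D1 image_eqI real_norm_def)
  have e_rad: "integrable (lebesgue_on ?B) (e ?u ?Du)"
  proof (rule Bochner_Integration.integrable_bound)
    show "integrable (lebesgue_on ?B) (\<lambda>x. 1/2 * (\<Sum>i\<in>Basis. (norm (?Du x i))\<^sup>2) + 1 / (2 * \<epsilon>\<^sup>2) * K)"
      by (intro Bochner_Integration.integrable_add integrable_mult_right Bochner_Integration.integrable_sum L2_onD(2)
          finite_measure.integrable_const[OF finite_measure_lebesgue_on_ball])
         (use H1 in \<open>simp add: H1_weak_grad_def\<close>)
    show "e ?u ?Du \<in> borel_measurable (lebesgue_on ?B)" by (rule e_meas[OF H1])
    show "AE x in lebesgue_on ?B. norm (e ?u ?Du x) \<le> norm (1/2 * (\<Sum>i\<in>Basis. (norm (?Du x i))\<^sup>2) + 1 / (2 * \<epsilon>\<^sup>2) * K)"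
      using ae
    proof eventually_elim
      fix x :: "real^'m" assume x: "0 < norm x \<and> norm x < 1"
      have "W (1 - (norm (?u x))\<^sup>2) \<le> K"
        using hs[of "norm x"] x nu[of x] by (intro K) auto
      then have "1 / (2 * \<epsilon>\<^sup>2) * W (1 - (norm (?u x))\<^sup>2) \<le> 1 / (2 * \<epsilon>\<^sup>2) * K"
        by (intro mult_left_mono) auto
      then have "e ?u ?Du x \<le> 1/2 * (\<Sum>i\<in>Basis. (norm (?Du x i))\<^sup>2) + 1 / (2 * \<epsilon>\<^sup>2) * K" by (simp add: e_def)
      then show "norm (e ?u ?Du x) \<le> norm (1/2 * (\<Sum>i\<in>Basis. (norm (?Du x i))\<^sup>2) + 1 / (2 * \<epsilon>\<^sup>2) * K)"
        using e0[of ?u ?Du x] unfolding real_norm_def by linarith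
    qed
  qed
  have GL_rad: "GL_energy W \<epsilon> ?B ?u ?Du = ennreal (\<integral>x. e ?u ?Du x \<partial>lebesgue_on ?B)"
    unfolding GL by (rule nn_integral_eq_integral[OF e_rad]) (use e0 in auto)
  have main: "GL_energy W \<epsilon> ?B ?u ?Du \<le> GL_energy W \<epsilon> ?B u Du
      \<and> (GL_energy W \<epsilon> ?B u Du = GL_energy W \<epsilon> ?B ?u ?Du \<longrightarrow> (AE x in lebesgue_on ?B. u x = ?u x))"
    if u: "H1_weak_grad ?B u Du" and tu: "trace_eq ?B u Du (\<lambda>x. (x, 0)) (\<lambda>x i. (i, 0))" for u Du
  \<comment> \<open>An H^1 competitor may have infinite energy, since the growth of \<open>W\<close>
    at minus infinity is not bounded. The radial map has finite energy, which settles that case;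
    otherwise both energies are real integrals and can be compared by subtraction.\<close>
  proof (cases "GL_energy W \<epsilon> ?B u Du = \<infinity>")
    case True
    then show ?thesis using GL_rad by simp
  next
    case False
    have ei: "integrable (lebesgue_on ?B) (e u Du)"
      unfolding integrable_iff_bounded using e_meas[OF u] e0 False by (simp add: GL top.not_eq_extremum)
    have GLu: "GL_energy W \<epsilon> ?B u Du = ennreal (\<integral>x. e u Du x \<partial>lebesgue_on ?B)"
      unfolding GL by (rule nn_integral_eq_integral[OF ei]) (use e0 in auto)
    define v where "v x = u x - ?u x" for x
    define Dv where "Dv x i = Du x i - ?Du x i" for x i
    have v: "H10 ?B v Dv"
      using H10_diff[OF tu[unfolded trace_eq_def] tr[unfolded trace_eq_def]] by (simp add: v_def[abs_def] Dv_def[abs_def])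
    then have L2v: "L2_on ?B v" "\<And>i. i \<in> Basis \<Longrightarrow> L2_on ?B (\<lambda>x. Dv x i)"
      by (simp_all add: H10_def H1_weak_grad_def)
    \<comment> \<open>Convexity is used through the tangent to \<open>W\<close> at 1 - |u_eps|^2.
      The constant 1/8 is half of the 1/4 built into \<open>excess\<close>.\<close>
    have le: "e ?u ?Du x + excess v Dv x + 1/8 * (norm (v x))\<^sup>2 \<le> e u Du x" if x: "0 < norm x" "norm x < 1" for x
    proof -
      have uv: "u x = ?u x + v x" "\<And>i. Du x i = ?Du x i + Dv x i" by (auto simp: v_def Dv_def)
      have sq: "(norm (a + b))\<^sup>2 = (norm a)\<^sup>2 + 2 * (a \<bullet> b) + (norm b)\<^sup>2" for a b :: "(real^'m) \<times> (real^'k)"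
        unfolding power2_norm_eq_inner by (simp add: inner_add_left inner_add_right inner_commute)
      define \<sigma> where "\<sigma> = 1 - (norm (?u x))\<^sup>2"
      have \<sigma>: "\<sigma> = 1 - (h (norm x))\<^sup>2" using nu[OF x(2)] by (simp add: \<sigma>_def)
      have "W \<sigma> + W' \<sigma> * ((1 - (norm (u x))\<^sup>2) - \<sigma>) \<le> W (1 - (norm (u x))\<^sup>2)"
        by (rule tangent) (use hs[OF x] \<sigma> in auto)
      moreover have "(1 - (norm (u x))\<^sup>2) - \<sigma> = - (2 * (?u x \<bullet> v x) + (norm (v x))\<^sup>2)"
        unfolding \<sigma>_def uv(1) sq by simp
      ultimately have "1 / (2 * \<epsilon>\<^sup>2) * (W \<sigma> + W' \<sigma> * - (2 * (?u x \<bullet> v x) + (norm (v x))\<^sup>2))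
          \<le> 1 / (2 * \<epsilon>\<^sup>2) * W (1 - (norm (u x))\<^sup>2)"
        by (intro mult_left_mono) auto
      moreover have "1 / (2 * \<epsilon>\<^sup>2) * (W \<sigma> + W' \<sigma> * - (2 * (?u x \<bullet> v x) + (norm (v x))\<^sup>2))
          = 1 / (2 * \<epsilon>\<^sup>2) * W \<sigma> - V (norm x) * (?u x \<bullet> v x) - 1/2 * (V (norm x) * (norm (v x))\<^sup>2)"
        unfolding V_def \<sigma>[symmetric] using eps by (simp add: field_simps)
      moreover have "(\<Sum>i\<in>Basis. (norm (Du x i))\<^sup>2) = (\<Sum>i\<in>Basis. (norm (?Du x i))\<^sup>2)
          + 2 * (\<Sum>i\<in>Basis. ?Du x i \<bullet> Dv x i) + (\<Sum>i\<in>Basis. (norm (Dv x i))\<^sup>2)"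
        unfolding uv(2) sq by (simp add: sum.distrib sum_distrib_left)
      moreover have "excess v Dv x = (\<Sum>i\<in>Basis. ?Du x i \<bullet> Dv x i) - V (norm x) * (?u x \<bullet> v x)
          + 1/2 * (\<Sum>i\<in>Basis. (norm (Dv x i))\<^sup>2) - 1/2 * (V (norm x) * (norm (v x))\<^sup>2) - 1/8 * (norm (v x))\<^sup>2"
        unfolding excess_def by (simp add: algebra_simps)
      ultimately show ?thesis unfolding e_def \<sigma>_def[symmetric] by linarith
    qed
    have xi: "integrable (lebesgue_on ?B) (excess v Dv)" by (rule integrable_excess[OF dim L2v])
    have vi: "integrable (lebesgue_on ?B) (\<lambda>x. (norm (v x))\<^sup>2)" by (rule L2_onD(2)[OF L2v(1)])
    have "(\<integral>x. e ?u ?Du x + excess v Dv x + 1/8 * (norm (v x))\<^sup>2 \<partial>lebesgue_on ?B) \<le> (\<integral>x. e u Du x \<partial>lebesgue_on ?B)"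
    proof (rule integral_mono_AE)
      show "AE x in lebesgue_on ?B. e ?u ?Du x + excess v Dv x + 1/8 * (norm (v x))\<^sup>2 \<le> e u Du x"
        using ae by eventually_elim (use le in blast)
    qed (intro Bochner_Integration.integrable_add integrable_mult_right e_rad xi vi ei)+
    moreover have "(\<integral>x. e ?u ?Du x + excess v Dv x + 1/8 * (norm (v x))\<^sup>2 \<partial>lebesgue_on ?B)
       = (\<integral>x. e ?u ?Du x \<partial>lebesgue_on ?B) + (\<integral>x. excess v Dv x \<partial>lebesgue_on ?B) + 1/8 * (\<integral>x. (norm (v x))\<^sup>2 \<partial>lebesgue_on ?B)"
      using e_rad xi vi by simp
    moreover have "0 \<le> (\<integral>x. excess v Dv x \<partial>lebesgue_on ?B)" by (rule excess_nonneg[OF dim v])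
    ultimately have key: "(\<integral>x. e ?u ?Du x \<partial>lebesgue_on ?B) + 1/8 * (\<integral>x. (norm (v x))\<^sup>2 \<partial>lebesgue_on ?B)
        \<le> (\<integral>x. e u Du x \<partial>lebesgue_on ?B)" by linarith
    have v0: "0 \<le> (\<integral>x. (norm (v x))\<^sup>2 \<partial>lebesgue_on ?B)" by (intro integral_nonneg_AE) simp
    have i0: "0 \<le> (\<integral>x. e w Dw x \<partial>lebesgue_on ?B)" for w Dw by (intro integral_nonneg_AE) (simp add: e0)
    show ?thesis
    proof (intro conjI impI)
      show "GL_energy W \<epsilon> ?B ?u ?Du \<le> GL_energy W \<epsilon> ?B u Du"
        unfolding GLu GL_rad using key v0 by (intro ennreal_leI) linarith
      assume "GL_energy W \<epsilon> ?B u Du = GL_energy W \<epsilon> ?B ?u ?Du"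
      then have "(\<integral>x. e u Du x \<partial>lebesgue_on ?B) = (\<integral>x. e ?u ?Du x \<partial>lebesgue_on ?B)"
        unfolding GLu GL_rad using i0 by simp
      \<comment> \<open>Equal energies reduce \<open>key\<close> to 1/8 of this integral being at
        most 0.\<close>
      then have "(\<integral>x. (norm (v x))\<^sup>2 \<partial>lebesgue_on ?B) = 0" using key v0 by linarith
      then have "AE x in lebesgue_on ?B. (norm (v x))\<^sup>2 = 0"
        using integral_nonneg_eq_0_iff_AE[OF vi] by simp
      then show "AE x in lebesgue_on ?B. u x = ?u x" by eventually_elim (simp add: v_def)
    qed
  qed
  have ueq: "(\<lambda>x. (h (norm x) *\<^sub>R sgn x, 0)) = ?u" by (simp add: u_rad_eq fun_eq_iff)
  show ?thesis
    unfolding Let_def ueq using H1 tr main by blast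
qed

end
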